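(* Let $a\in\mathbb{C}\setminus\{0,-1\}$ and let $M=M^{2|2}=\mathbb{C}^{2|2}$ with even coordinates $x_1,x_2$ and odd coordinates $\xi_1,\xi_2$. Let $\mathcal{V}=\mathcal{V}_1\cup\mathcal{V}_2\subset\mathbb{P}^{1|2}=\mathbb{P}(\mathbb{C}^{2|2})$ be the supervariety with components $$\mathcal{V}_1=\{[x_1:x_2:\xi_1:\xi_2]=[1:(1+a)\theta\varphi:\theta:\varphi]\},\qquad \mathcal{V}_2=\{[x_1:x_2:\xi_1:\xi_2]=[-\tau\nu:a^2:a\tau:a\nu]\}$$ ($\theta,\varphi,\tau,\nu$ odd parameters), and let $\mathcal{V}_M=M\times\mathcal{V}\subset\mathbb{P}(\mathcal{T}M)$ be the cone structure obtained by translating $\mathcal{V}$ by the flat connection for which the coordinate vector fields $\partial_{x_1},\partial_{x_2},\partial_{\xi_1},\partial_{\xi_2}$ are parallel. Then the Lie superalgebra of infinitesimal symmetries of the cone structure $\mathcal{V}_M$ is $D(2,1;a)$.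
   Context: The components are the images of morphisms $\mathbb{P}^{0|2}\to\mathbb{P}^{1|2}$; equivalently they are given by the homogeneous relations $\mathcal{V}_1:\ x_1x_2-(1+a)\xi_1\xi_2=0,\ x_2\xi_1=0,\ x_2\xi_2=0,\ x_2^2=0$; $\mathcal{V}_2:\ x_1x_2+\xi_1\xi_2=0,\ x_1\xi_1=0,\ x_1\xi_2=0,\ x_1^2=0$. Homogeneous coordinates $[x_1:x_2:\xi_1:\xi_2]$ on the fiber of $\mathbb{P}(\mathcal{T}M)$ are right coordinates of a tangent supervector with respect to the frame $\partial_{x_1},\partial_{x_2},\partial_{\xi_1},\partial_{\xi_2}$ (i.e. coefficients written to the right of the basis vectors). An infinitesimal symmetry is a supervector field on $M$ whose natural lift to $\mathbb{P}(\mathcal{T}M)$ is tangent to $\mathcal{V}_M$. $D(2,1;a)=\Gamma(-1-a,1,a)$, where for $s_1+s_2+s_3=0$, $\Gamma(s_1,s_2,s_3)$ is the Lie superalgebra with even part $\mathfrak{sl}_2^{\oplus3}$ ($i$-th copy with standard basis $X_i,H_i,Y_i$), odd part $\mathbb{C}^2\boxtimes\mathbb{C}^2\boxtimes\mathbb{C}^2$ (each $\mathbb{C}^2=\langle x,y\rangle$ standard: $X=x\partial_y$, $H=x\partial_x-y\partial_y$, $Y=y\partial_x$), and odd-odd bracket $[v_1v_2v_3,w_1w_2w_3]=s_1\varphi_1(v_1w_1)\eta_2(v_2,w_2)\eta_3(v_3,w_3)+s_2\eta_1(v_1,w_1)\varphi_2(v_2w_2)\eta_3(v_3,w_3)+s_3\eta_1(v_1,w_1)\eta_2(v_2,w_2)\varphi_3(v_3w_3)$,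 with $\eta_i$ skew, $\eta_i(x,y)=1$, $\varphi_i:x^2\mapsto X_i,\ -2xy\mapsto H_i,\ -y^2\mapsto Y_i$. *)

theory Defs
  imports "HOL-Analysis.Analysis" "HOL-Library.Function_Algebras"
begin

section \<open>Lie superalgebras over the complex numbers\<close>

record 'v superalgebra =
  ev_part :: "'v set"
  od_part :: "'v set"
  sscale :: "complex \<Rightarrow> 'v \<Rightarrow> 'v"
  sbracket :: "'v \<Rightarrow> 'v \<Rightarrow> 'v"

text \<open>Degrees are natural numbers; only their parity matters.\<close>

definition part :: "'v superalgebra \<Rightarrow> nat \<Rightarrow> 'v set" where
  "part L p = (if even p then ev_part L else od_part L)"

definition scarrier :: "'v::ab_group_add superalgebra \<Rightarrow> 'v set" where
  "scarrier L = {u + v | u v. u \<in> ev_part L \<and> v \<in> od_part L}"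

definition lie_superalgebra :: "'v::ab_group_add superalgebra \<Rightarrow> bool" where
  "lie_superalgebra L \<longleftrightarrow>
     vector_space (sscale L) \<and>
     module.subspace (sscale L) (ev_part L) \<and>
     module.subspace (sscale L) (od_part L) \<and>
     ev_part L \<inter> od_part L = {0} \<and>
     (\<forall>x\<in>scarrier L. \<forall>y\<in>scarrier L. \<forall>z\<in>scarrier L. \<forall>c.
        sbracket L (x + y) z = sbracket L x z + sbracket L y z \<and>
        sbracket L z (x + y) = sbracket L z x + sbracket L z y \<and>
        sbracket L (sscale L c x) y = sscale L c (sbracket L x y) \<and>
        sbracket L x (sscale L c y) = sscale L c (sbracket L x y)) \<and>
     (\<forall>p q. \<forall>x\<in>part L p. \<forall>y\<in>part L q.
        sbracket L x y \<in> part L (p + q) \<and>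
        sbracket L x y = - sscale L ((-1) ^ (p * q)) (sbracket L y x)) \<and>
     (\<forall>p q r. \<forall>x\<in>part L p. \<forall>y\<in>part L q. \<forall>z\<in>part L r.
        sbracket L x (sbracket L y z) =
          sbracket L (sbracket L x y) z + sscale L ((-1) ^ (p * q)) (sbracket L y (sbracket L x z)))"

definition superalgebra_iso ::
  "('v \<Rightarrow> 'w) \<Rightarrow> 'v::ab_group_add superalgebra \<Rightarrow> 'w::ab_group_add superalgebra \<Rightarrow> bool" where
  "superalgebra_iso f L L' \<longleftrightarrow>
     bij_betw f (scarrier L) (scarrier L') \<and>
     f ` ev_part L = ev_part L' \<and>
     f ` od_part L = od_part L' \<and>
     (\<forall>x\<in>scarrier L. \<forall>y\<in>scarrier L. f (x + y) = f x + f y) \<and>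
     (\<forall>c. \<forall>x\<in>scarrier L. f (sscale L c x) = sscale L' c (f x)) \<and>
     (\<forall>x\<in>scarrier L. \<forall>y\<in>scarrier L. f (sbracket L x y) = sbracket L' (f x) (f y))"

definition lie_superalgebra_isomorphic ::
  "'v::ab_group_add superalgebra \<Rightarrow> 'w::ab_group_add superalgebra \<Rightarrow> bool" where
  "lie_superalgebra_isomorphic L L' \<longleftrightarrow>
     lie_superalgebra L \<and> lie_superalgebra L' \<and> (\<exists>f. superalgebra_iso f L L')"

section \<open>The Lie superalgebras \<open>\<Gamma>(s\<^sub>1,s\<^sub>2,s\<^sub>3)\<close> and \<open>D(2,1;a)\<close>\<close>

text \<open>
  The standard basis \<open>x, y\<close> of \<open>\<complex>\<^sup>2\<close> is \<open>axis 1 1, axis 2 1\<close>, and the derivations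
  \<open>X = x\<partial>\<^sub>y\<close>, \<open>H = x\<partial>\<^sub>x - y\<partial>\<^sub>y\<close>, \<open>Y = y\<partial>\<^sub>x\<close> are identified with their matrices in this basis.
  For \<open>t :: complex^2^2^2\<close> the entry \<open>t $ i $ j $ k\<close> is the coefficient of
  \<open>e\<^sub>i \<otimes> e\<^sub>j \<otimes> e\<^sub>k\<close>.
\<close>

type_synonym mat2 = "complex^2^2"
type_synonym tensor222 = "complex^2^2^2"
type_synonym gamma_elt = "(mat2 \<times> mat2 \<times> mat2) \<times> tensor222"

definition mat_scale :: "complex \<Rightarrow> mat2 \<Rightarrow> mat2" where
  "mat_scale c A = (\<chi> i j. c * A $ i $ j)"

definition tensor_scale :: "complex \<Rightarrow> tensor222 \<Rightarrow> tensor222" where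
  "tensor_scale c t = (\<chi> i j k. c * t $ i $ j $ k)"

definition matX :: mat2 where "matX = vector [vector [0, 1], vector [0, 0]]"
definition matH :: mat2 where "matH = vector [vector [1, 0], vector [0, -1]]"
definition matY :: mat2 where "matY = vector [vector [0, 0], vector [1, 0]]"

definition eta :: "complex^2 \<Rightarrow> complex^2 \<Rightarrow> complex" where
  "eta v w = v $ 1 * w $ 2 - v $ 2 * w $ 1"

text \<open>
  \<open>phi v w\<close> is \<open>\<phi>(vw)\<close>, where \<open>vw = v\<^sub>1w\<^sub>1 x\<^sup>2 + (v\<^sub>1w\<^sub>2 + v\<^sub>2w\<^sub>1) xy + v\<^sub>2w\<^sub>2 y\<^sup>2\<close> and
  \<open>\<phi>(x\<^sup>2) = X\<close>, \<open>\<phi>(xy) = -H/2\<close>, \<open>\<phi>(y\<^sup>2) = -Y\<close>.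
\<close>

definition phi :: "complex^2 \<Rightarrow> complex^2 \<Rightarrow> mat2" where
  "phi v w = mat_scale (v $ 1 * w $ 1) matX
           + mat_scale (- (v $ 1 * w $ 2 + v $ 2 * w $ 1) / 2) matH
           + mat_scale (- (v $ 2 * w $ 2)) matY"

definition commutator :: "mat2 \<Rightarrow> mat2 \<Rightarrow> mat2" where
  "commutator A B = A ** B - B ** A"

fun sl2_act :: "mat2 \<times> mat2 \<times> mat2 \<Rightarrow> tensor222 \<Rightarrow> tensor222" where
  "sl2_act (A1, A2, A3) t =
     (\<chi> i j k. (\<Sum>l\<in>UNIV. A1 $ i $ l * t $ l $ j $ k)
             + (\<Sum>l\<in>UNIV. A2 $ j $ l * t $ i $ l $ k)
             + (\<Sum>l\<in>UNIV. A3 $ k $ l * t $ i $ j $ l))"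

definition gamma_odd_pure ::
  "complex \<Rightarrow> complex \<Rightarrow> complex \<Rightarrow> complex^2 \<Rightarrow> complex^2 \<Rightarrow> complex^2 \<Rightarrow>
     complex^2 \<Rightarrow> complex^2 \<Rightarrow> complex^2 \<Rightarrow> mat2 \<times> mat2 \<times> mat2" where
  "gamma_odd_pure s1 s2 s3 v1 v2 v3 w1 w2 w3 =
     (mat_scale (s1 * eta v2 w2 * eta v3 w3) (phi v1 w1),
      mat_scale (s2 * eta v1 w1 * eta v3 w3) (phi v2 w2),
      mat_scale (s3 * eta v1 w1 * eta v2 w2) (phi v3 w3))"

fun mat3_scale :: "complex \<Rightarrow> mat2 \<times> mat2 \<times> mat2 \<Rightarrow> mat2 \<times> mat2 \<times> mat2" where
  "mat3_scale c (A1, A2, A3) = (mat_scale c A1, mat_scale c A2, mat_scale c A3)"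

definition gamma_odd ::
  "complex \<Rightarrow> complex \<Rightarrow> complex \<Rightarrow> tensor222 \<Rightarrow> tensor222 \<Rightarrow> mat2 \<times> mat2 \<times> mat2" where
  "gamma_odd s1 s2 s3 t u =
     (\<Sum>i\<in>UNIV. \<Sum>j\<in>UNIV. \<Sum>k\<in>UNIV. \<Sum>l\<in>UNIV. \<Sum>m\<in>UNIV. \<Sum>n\<in>UNIV.
        mat3_scale (t $ i $ j $ k * u $ l $ m $ n)
          (gamma_odd_pure s1 s2 s3 (axis i 1) (axis j 1) (axis k 1)
             (axis l 1) (axis m 1) (axis n 1)))"

fun gamma_scale :: "complex \<Rightarrow> gamma_elt \<Rightarrow> gamma_elt" where
  "gamma_scale c (A, t) = (mat3_scale c A, tensor_scale c t)"

fun gamma_bracket ::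
  "complex \<Rightarrow> complex \<Rightarrow> complex \<Rightarrow> gamma_elt \<Rightarrow> gamma_elt \<Rightarrow> gamma_elt" where
  "gamma_bracket s1 s2 s3 ((A1, A2, A3), t) ((B1, B2, B3), u) =
     ((commutator A1 B1, commutator A2 B2, commutator A3 B3) + gamma_odd s1 s2 s3 t u,
      sl2_act (A1, A2, A3) u - sl2_act (B1, B2, B3) t)"

definition Gamma_superalgebra ::
  "complex \<Rightarrow> complex \<Rightarrow> complex \<Rightarrow> gamma_elt superalgebra" where
  "Gamma_superalgebra s1 s2 s3 =
     \<lparr> ev_part = {((A1, A2, A3), 0) | A1 A2 A3. trace A1 = 0 \<and> trace A2 = 0 \<and> trace A3 = 0},
       od_part = {(0, t) | t. True},
       sscale = gamma_scale,
       sbracket = gamma_bracket s1 s2 s3 \<rparr>"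

definition D21 :: "complex \<Rightarrow> gamma_elt superalgebra" where
  "D21 a = Gamma_superalgebra (- 1 - a) 1 a"

section \<open>Superfunctions\<close>

text \<open>
  All superfunctions live in one algebra, whose elements are functions on the body \<open>\<complex>\<^sup>2\<close> with
  values in \<open>\<complex>[y\<^sub>1,y\<^sub>2] \<otimes> \<Lambda>[\<zeta>\<^sub>0,\<zeta>\<^sub>1,\<zeta>\<^sub>2,\<zeta>\<^sub>3]\<close>: the value \<open>f x (k, l, S)\<close> is the coefficient of
  \<open>y\<^sub>1\<^sup>k y\<^sub>2\<^sup>l \<zeta>\<^sup>S\<close> at the point \<open>x\<close>, where \<open>\<zeta>\<^sup>S\<close> is the product of the \<open>\<zeta>\<^sub>i\<close>, \<open>i \<in> S\<close>, in increasing
  order.  Here \<open>\<zeta>\<^sub>0 = \<xi>\<^sub>1\<close> and \<open>\<zeta>\<^sub>1 = \<xi>\<^sub>2\<close> are the odd coordinates of \<open>M = \<complex>\<^sup>2\<^sup>|\<^sup>2\<close>.  On the total space of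
  \<open>TM\<close>, \<open>y\<^sub>1, y\<^sub>2\<close> and \<open>\<zeta>\<^sub>2, \<zeta>\<^sub>3\<close> are the even and odd fibre coordinates, that is, the right
  coordinates of a tangent supervector with respect to the coordinate frame.  On the components
  of \<open>M \<times> \<V>\<close>, \<open>\<zeta>\<^sub>2, \<zeta>\<^sub>3\<close> are the odd parameters (\<open>\<theta>, \<phi>\<close> or \<open>\<tau>, \<nu>\<close>) and the \<open>y\<^sub>i\<close> do not occur.
\<close>

type_synonym smono = "nat \<times> nat \<times> nat set"
type_synonym sfun = "complex \<times> complex \<Rightarrow> smono \<Rightarrow> complex"

definition monomial :: "smono \<Rightarrow> sfun" where
  "monomial m = (\<lambda>x m'. if m' = m then 1 else 0)"

definition cmul :: "complex \<Rightarrow> sfun \<Rightarrow> sfun" where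
  "cmul c f = (\<lambda>x m. c * f x m)"

text \<open>\<open>\<zeta>\<^sup>T \<zeta>\<^sup>U = koszul T U \<cdot> \<zeta>\<^sup>T\<^sup>\<union>\<^sup>U\<close> for disjoint finite \<open>T\<close> and \<open>U\<close>.\<close>

definition koszul :: "nat set \<Rightarrow> nat set \<Rightarrow> complex" where
  "koszul T U = (-1) ^ card {(t, u). t \<in> T \<and> u \<in> U \<and> u < t}"

definition smul :: "sfun \<Rightarrow> sfun \<Rightarrow> sfun" (infixl "\<odot>" 70) where
  "f \<odot> g = (\<lambda>x (k, l, S). \<Sum>i\<le>k. \<Sum>j\<le>l. \<Sum>T\<in>Pow S.
              koszul T (S - T) * f x (i, j, T) * g x (k - i, l - j, S - T))"

primrec spow :: "sfun \<Rightarrow> nat \<Rightarrow> sfun" where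
  "spow f 0 = monomial (0, 0, {})"
| "spow f (Suc n) = f \<odot> spow f n"

definition holomorphic2 :: "(complex \<times> complex \<Rightarrow> complex) \<Rightarrow> bool" where
  "holomorphic2 f \<longleftrightarrow>
     (\<forall>x. \<exists>A B. (f has_derivative (\<lambda>h. A * fst h + B * snd h)) (at x))"

text \<open>
  Superfunctions on \<open>TM\<close> that are homogeneous polynomials of degree \<open>d\<close> in the fibre coordinates.
  In degree \<open>0\<close> these are the holomorphic superfunctions on \<open>M\<close>.
\<close>

definition fibre_form :: "nat \<Rightarrow> sfun \<Rightarrow> bool" where
  "fibre_form d F \<longleftrightarrow>
     (\<forall>m. holomorphic2 (\<lambda>x. F x m)) \<and>
     (\<forall>x k l S. F x (k, l, S) \<noteq> 0 \<longrightarrow> S \<subseteq> {0,1,2,3} \<and> k + l + card (S \<inter> {2,3}) = d)"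

abbreviation superfunction :: "sfun \<Rightarrow> bool" where
  "superfunction f \<equiv> fibre_form 0 f"

text \<open>Left derivative with respect to \<open>\<zeta>\<^sub>n\<close>.\<close>

definition d_odd :: "nat \<Rightarrow> sfun \<Rightarrow> sfun" where
  "d_odd n f = (\<lambda>x (k, l, S).
     if n \<in> S then 0 else (-1) ^ card {s \<in> S. s < n} * f x (k, l, insert n S))"

text \<open>The coordinates \<open>x\<^sub>1, x\<^sub>2, \<xi>\<^sub>1, \<xi>\<^sub>2\<close> of \<open>M\<close>.\<close>

datatype coord = Ev1 | Ev2 | Od1 | Od2

lemma UNIV_coord: "UNIV = {Ev1, Ev2, Od1, Od2}"
  using coord.exhaust by auto

instance coord :: finite
  by standard (simp add: UNIV_coord)

fun par :: "coord \<Rightarrow> nat" where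
  "par Ev1 = 0" | "par Ev2 = 0" | "par Od1 = 1" | "par Od2 = 1"

fun d_base :: "coord \<Rightarrow> sfun \<Rightarrow> sfun" where
  "d_base Ev1 F = (\<lambda>x m. deriv (\<lambda>t. F (t, snd x) m) (fst x))"
| "d_base Ev2 F = (\<lambda>x m. deriv (\<lambda>t. F (fst x, t) m) (snd x))"
| "d_base Od1 F = d_odd 0 F"
| "d_base Od2 F = d_odd 1 F"

fun d_fibre :: "coord \<Rightarrow> sfun \<Rightarrow> sfun" where
  "d_fibre Ev1 F = (\<lambda>x (k, l, S). of_nat (Suc k) * F x (Suc k, l, S))"
| "d_fibre Ev2 F = (\<lambda>x (k, l, S). of_nat (Suc l) * F x (k, Suc l, S))"
| "d_fibre Od1 F = d_odd 2 F"
| "d_fibre Od2 F = d_odd 3 F"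

fun fibre_coord :: "coord \<Rightarrow> sfun" where
  "fibre_coord Ev1 = monomial (1, 0, {})"
| "fibre_coord Ev2 = monomial (0, 1, {})"
| "fibre_coord Od1 = monomial (0, 0, {2})"
| "fibre_coord Od2 = monomial (0, 0, {3})"

section \<open>Supervector fields on \<open>M\<close>\<close>

text \<open>\<open>X :: vfield\<close> stands for \<open>\<Sum>\<^sub>i X i \<partial>\<^sub>i\<close>.\<close>

type_synonym vfield = "coord \<Rightarrow> sfun"

definition vector_field :: "vfield \<Rightarrow> bool" where
  "vector_field X \<longleftrightarrow> (\<forall>i. superfunction (X i))"

definition vf_scale :: "complex \<Rightarrow> vfield \<Rightarrow> vfield" where
  "vf_scale c X = (\<lambda>i. cmul c (X i))"

text \<open>The component of parity \<open>p\<close>: the coefficient of \<open>\<partial>\<^sub>i\<close> has parity \<open>p + |i|\<close>.\<close>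

definition vf_part :: "nat \<Rightarrow> vfield \<Rightarrow> vfield" where
  "vf_part p X = (\<lambda>i x (k, l, S). if even (card S + par i + p) then X i x (k, l, S) else 0)"

definition vf_apply :: "vfield \<Rightarrow> sfun \<Rightarrow> sfun" where
  "vf_apply X f = (\<Sum>i\<in>UNIV. X i \<odot> d_base i f)"

definition vf_bracket :: "vfield \<Rightarrow> vfield \<Rightarrow> vfield" where
  "vf_bracket X Y = (\<lambda>i. \<Sum>p\<in>{0,1}. \<Sum>q\<in>{0,1}.
     vf_apply (vf_part p X) (vf_part q Y i)
       - cmul ((-1) ^ (p * q)) (vf_apply (vf_part q Y) (vf_part p X i)))"

text \<open>
  The natural lift of \<open>X\<close> to \<open>TM\<close>, acting on superfunctions on \<open>TM\<close>.  The points of \<open>TM\<close> are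
  even tangent supervectors \<open>v = \<Sum>\<^sub>i \<partial>\<^sub>i y\<^sub>i = \<Sum>\<^sub>i (-1)\<^sup>|\<^sup>i\<^sup>| y\<^sub>i \<partial>\<^sub>i\<close>, and the lift sends the left coordinate
  \<open>v(x\<^sub>j) = (-1)\<^sup>|\<^sup>j\<^sup>| y\<^sub>j\<close> to \<open>v(X j)\<close>; hence \<open>y\<^sub>j\<close> is sent to
  \<open>\<Sum>\<^sub>i (-1)\<^sup>|\<^sup>i\<^sup>|\<^sup>+\<^sup>|\<^sup>j\<^sup>| y\<^sub>i \<partial>\<^sub>i(X j)\<close>.  It preserves the degree in the fibre coordinates, and so induces the
  lift to \<open>\<P>(TM)\<close>.
\<close>

definition lift_coord :: "vfield \<Rightarrow> coord \<Rightarrow> sfun" where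
  "lift_coord X j =
     (\<Sum>i\<in>UNIV. cmul ((-1) ^ (par i + par j)) (fibre_coord i \<odot> d_base i (X j)))"

definition lift :: "vfield \<Rightarrow> sfun \<Rightarrow> sfun" where
  "lift X F = vf_apply X F + (\<Sum>j\<in>UNIV. lift_coord X j \<odot> d_fibre j F)"

section \<open>The cone structure and its infinitesimal symmetries\<close>

fun component1 :: "complex \<Rightarrow> coord \<Rightarrow> sfun" where
  "component1 a Ev1 = monomial (0, 0, {})"
| "component1 a Ev2 = cmul (1 + a) (monomial (0, 0, {2}) \<odot> monomial (0, 0, {3}))"
| "component1 a Od1 = monomial (0, 0, {2})"
| "component1 a Od2 = monomial (0, 0, {3})"

fun component2 :: "complex \<Rightarrow> coord \<Rightarrow> sfun" where
  "component2 a Ev1 = cmul (- 1) (monomial (0, 0, {2}) \<odot> monomial (0, 0, {3}))"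
| "component2 a Ev2 = cmul (a\<^sup>2) (monomial (0, 0, {}))"
| "component2 a Od1 = cmul a (monomial (0, 0, {2}))"
| "component2 a Od2 = cmul a (monomial (0, 0, {3}))"

text \<open>Substitution of \<open>c\<close> for the fibre coordinates; coordinates on \<open>M\<close> are left unchanged.\<close>

fun subst_monomial :: "(coord \<Rightarrow> sfun) \<Rightarrow> smono \<Rightarrow> sfun" where
  "subst_monomial c (k, l, S) =
     monomial (0, 0, S \<inter> {0,1}) \<odot> spow (c Ev1) k \<odot> spow (c Ev2) l
       \<odot> (if 2 \<in> S then c Od1 else monomial (0, 0, {}))
       \<odot> (if 3 \<in> S then c Od2 else monomial (0, 0, {}))"

definition pullback :: "(coord \<Rightarrow> sfun) \<Rightarrow> sfun \<Rightarrow> sfun" where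
  "pullback c F = (\<lambda>x m'. \<Sum>m\<in>{m. F x m \<noteq> 0}. F x m * subst_monomial c m x m')"

text \<open>
  The forms vanishing on both components make up the homogeneous ideal of
  \<open>\<V>\<^sub>M = M \<times> (\<V>\<^sub>1 \<union> \<V>\<^sub>2)\<close>; the flat connection enters through the parametrizations being independent of
  the point of \<open>M\<close>.
\<close>

definition vanishes_on_cone :: "complex \<Rightarrow> sfun \<Rightarrow> bool" where
  "vanishes_on_cone a F \<longleftrightarrow>
     pullback (component1 a) F = 0 \<and> pullback (component2 a) F = 0"

text \<open>Tangency of the lift to \<open>\<V>\<^sub>M\<close>: it preserves the homogeneous ideal of \<open>\<V>\<^sub>M\<close>.\<close>

definition infinitesimal_symmetry :: "complex \<Rightarrow> vfield \<Rightarrow> bool" where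
  "infinitesimal_symmetry a X \<longleftrightarrow>
     vector_field X \<and>
     (\<forall>d F. fibre_form d F \<and> vanishes_on_cone a F \<longrightarrow> vanishes_on_cone a (lift X F))"

definition symmetry_superalgebra :: "complex \<Rightarrow> vfield superalgebra" where
  "symmetry_superalgebra a =
     \<lparr> ev_part = {X. infinitesimal_symmetry a X \<and> vf_part 0 X = X},
       od_part = {X. infinitesimal_symmetry a X \<and> vf_part 1 X = X},
       sscale = vf_scale,
       sbracket = vf_bracket \<rparr>"

end

theory Submission
  imports Defs
begin

text \<open>
  In fibre degree 3 the ideal of the cone is spanned by \<open>y\<^sub>1y\<^sub>2\<zeta>\<^sub>2\<close>, \<open>y\<^sub>1y\<^sub>2\<zeta>\<^sub>3\<close>,
  \<open>y\<^sub>1(y\<^sub>1y\<^sub>2 - (1+a)\<zeta>\<^sub>2\<zeta>\<^sub>3)\<close> and \<open>y\<^sub>2(y\<^sub>1y\<^sub>2 + \<zeta>\<^sub>2\<zeta>\<^sub>3)\<close>.  Testing a vector field on the first three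
  shows that its Jacobian takes values in a (5|4)-dimensional subalgebra of \<open>\<gg>\<ll>(2|2)\<close>; conversely
  each of nine generators of this subalgebra preserves the whole ideal.  The resulting linear
  first-order system says, coefficient by coefficient in \<open>\<xi>\<^sub>1, \<xi>\<^sub>2\<close>, that \<open>\<partial>\<^sub>1 g\<close> depends only on
  \<open>x\<^sub>2\<close> and \<open>\<partial>\<^sub>2 g\<close> only on \<open>x\<^sub>1\<close>, so that every coefficient is a polynomial of degree at most two;
  the coefficient of \<open>\<xi>\<^sub>1\<xi>\<^sub>2\<close> in the trace condition is where \<open>a \<noteq> 0\<close> enters.  The 17-dimensional
  solution space carries the grading \<open>(2|2) + (5|4) + (2|2)\<close>: the first two copies of \<open>\<ss>\<ll>\<^sub>2\<close> act by
  projective fields on the \<open>x\<^sub>2\<close>-line and the \<open>x\<^sub>1\<close>-line, the third one rotates \<open>\<xi>\<^sub>1, \<xi>\<^sub>2\<close>.  The Jacobi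
  identity is checked only in \<open>\<Gamma>(s\<^sub>1,s\<^sub>2,s\<^sub>3)\<close> and transported to the vector fields.
\<close>

section \<open>The Lie superalgebra \<open>\<Gamma>(s\<^sub>1,s\<^sub>2,s\<^sub>3)\<close>\<close>

text \<open>Degree 3 is the lowest degree whose forms suffice for every a. In degree 2 only
  \<open>y1 y2\<close> and \<open>\<zeta>2 \<zeta>3\<close> can occur, and the components ask
  \<open>(1 + a) c + e = 0\<close> and \<open>c = e\<close> of their coefficients c and e, so that
  nothing vanishes on both unless a = -2.

  The condition a \<noteq> 0 also enters through the second parametrization, in which
  \<open>y2\<close>, \<open>\<zeta>2\<close> and \<open>\<zeta>3\<close> carry powers of a that have
  to be cancelled. The condition a \<noteq> -1 enters twice: the trace equation is obtained only
  after multiplication by 1 + a, and the \<open>x1\<close>-derivatives of the odd components are (1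
  + a)-th parts of coefficients of the \<open>\<partial>2\<close>-component.

  The lift splits into X along the base and a linear vector field on the fibres. The base part is
  harmless because the equations of the cone are constant along M, so the whole problem lies in the
  matrix of the fibre part.

  A direct proof of the Jacobi identity for supervector fields would rest on a graded Leibniz rule
  for all superfunctions. Matching the brackets of explicit polynomial fields with those of
  \<open>D21 a\<close> needs only products and derivatives of these polynomials.\<close>

lemma axis_components [simp]:
  "axis 1 (1::complex) $ (1::2) = 1" "axis 1 (1::complex) $ (2::2) = 0"
  "axis 2 (1::complex) $ (1::2) = 0" "axis 2 (1::complex) $ (2::2) = 1"
  by (simp_all add: axis_def)

lemma mat_basis_components [simp]:
  "matX $ 1 $ 1 = 0" "matX $ 1 $ 2 = 1" "matX $ 2 $ 1 = 0" "matX $ 2 $ 2 = 0"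
  "matH $ 1 $ 1 = 1" "matH $ 1 $ 2 = 0" "matH $ 2 $ 1 = 0" "matH $ 2 $ 2 = -1"
  "matY $ 1 $ 1 = 0" "matY $ 1 $ 2 = 0" "matY $ 2 $ 1 = 1" "matY $ 2 $ 2 = 0"
  by (simp_all add: matX_def matH_def matY_def)

lemma scale_components [simp]:
  "mat_scale c A $ i $ j = c * A $ i $ j"
  "tensor_scale c t $ i $ j $ k = c * t $ i $ j $ k"
  by (simp_all add: mat_scale_def tensor_scale_def)

lemma commutator_component:
  "commutator A B $ i $ j =
     A $ i $ 1 * B $ 1 $ j + A $ i $ 2 * B $ 2 $ j - (B $ i $ 1 * A $ 1 $ j + B $ i $ 2 * A $ 2 $ j)"
  by (simp add: commutator_def matrix_matrix_mult_def sum_2)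

lemma mat2_eq_iff:
  "(A::mat2) = B \<longleftrightarrow> A $ 1 $ 1 = B $ 1 $ 1 \<and> A $ 1 $ 2 = B $ 1 $ 2 \<and> A $ 2 $ 1 = B $ 2 $ 1 \<and> A $ 2 $ 2 = B $ 2 $ 2"
  by (simp add: vec_eq_iff forall_2)

lemma tensor_eq_iff:
  "(t::tensor222) = u \<longleftrightarrow>
     t $ 1 $ 1 $ 1 = u $ 1 $ 1 $ 1 \<and> t $ 1 $ 1 $ 2 = u $ 1 $ 1 $ 2 \<and>
     t $ 1 $ 2 $ 1 = u $ 1 $ 2 $ 1 \<and> t $ 1 $ 2 $ 2 = u $ 1 $ 2 $ 2 \<and>
     t $ 2 $ 1 $ 1 = u $ 2 $ 1 $ 1 \<and> t $ 2 $ 1 $ 2 = u $ 2 $ 1 $ 2 \<and>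
     t $ 2 $ 2 $ 1 = u $ 2 $ 2 $ 1 \<and> t $ 2 $ 2 $ 2 = u $ 2 $ 2 $ 2"
  by (simp add: vec_eq_iff forall_2)

text \<open>This is \<phi> of the quadratic form \<open>p x^2 + q x y + r y^2\<close>.\<close>

definition sym_mat :: "complex \<Rightarrow> complex \<Rightarrow> complex \<Rightarrow> mat2" where
  "sym_mat p q r = vector [vector [- q / 2, p], vector [- r, q / 2]]"

lemma sym_mat_components [simp]:
  "sym_mat p q r $ 1 $ 1 = - q / 2" "sym_mat p q r $ 1 $ 2 = p"
  "sym_mat p q r $ 2 $ 1 = - r" "sym_mat p q r $ 2 $ 2 = q / 2"
  by (simp_all add: sym_mat_def)

lemma phi_eq: "phi v w = sym_mat (v $ 1 * w $ 1) (v $ 1 * w $ 2 + v $ 2 * w $ 1) (v $ 2 * w $ 2)"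
  by (simp add: phi_def mat2_eq_iff field_simps)

text \<open>The tensors t and u are contracted by \<eta> in two of the three slots; i and l are the
  indices left open in the remaining slot, which is the first here, then the second and the
  third.\<close>

definition odd1 :: "tensor222 \<Rightarrow> tensor222 \<Rightarrow> 2 \<Rightarrow> 2 \<Rightarrow> complex" where
  "odd1 t u i l = t $ i $ 1 $ 1 * u $ l $ 2 $ 2 - t $ i $ 1 $ 2 * u $ l $ 2 $ 1
                - t $ i $ 2 $ 1 * u $ l $ 1 $ 2 + t $ i $ 2 $ 2 * u $ l $ 1 $ 1"
definition odd2 :: "tensor222 \<Rightarrow> tensor222 \<Rightarrow> 2 \<Rightarrow> 2 \<Rightarrow> complex" where
  "odd2 t u i l = t $ 1 $ i $ 1 * u $ 2 $ l $ 2 - t $ 1 $ i $ 2 * u $ 2 $ l $ 1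
                - t $ 2 $ i $ 1 * u $ 1 $ l $ 2 + t $ 2 $ i $ 2 * u $ 1 $ l $ 1"
definition odd3 :: "tensor222 \<Rightarrow> tensor222 \<Rightarrow> 2 \<Rightarrow> 2 \<Rightarrow> complex" where
  "odd3 t u i l = t $ 1 $ 1 $ i * u $ 2 $ 2 $ l - t $ 1 $ 2 $ i * u $ 2 $ 1 $ l
                - t $ 2 $ 1 $ i * u $ 1 $ 2 $ l + t $ 2 $ 2 $ i * u $ 1 $ 1 $ l"

definition odd_mat :: "complex \<Rightarrow> (2 \<Rightarrow> 2 \<Rightarrow> complex) \<Rightarrow> mat2" where
  "odd_mat s c = mat_scale s (sym_mat (c 1 1) (c 1 2 + c 2 1) (c 2 2))"

lemma odd_mat_components [simp]:
  "odd_mat s c $ 1 $ 1 = - (s * (c 1 2 + c 2 1) / 2)" "odd_mat s c $ 1 $ 2 = s * c 1 1"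
  "odd_mat s c $ 2 $ 1 = - (s * c 2 2)" "odd_mat s c $ 2 $ 2 = s * (c 1 2 + c 2 1) / 2"
  by (simp_all add: odd_mat_def algebra_simps)

text \<open>Each slot is \<phi> of the contraction over the other two. This closed form turns all
  later statements about the odd bracket into polynomial identities in the tensor entries.\<close>

lemma gamma_odd_eq:
  "gamma_odd s1 s2 s3 t u =
     (odd_mat s1 (odd1 t u), odd_mat s2 (odd2 t u), odd_mat s3 (odd3 t u))"
  unfolding gamma_odd_def gamma_odd_pure_def
  by (simp add: sum_2 eta_def phi_eq mat2_eq_iff odd1_def odd2_def odd3_def algebra_simps prod_eq_iff
     add_divide_distrib diff_divide_distrib)

lemma sl2_act_component:
  "sl2_act (A1, A2, A3) t $ i $ j $ k =
     A1 $ i $ 1 * t $ 1 $ j $ k + A1 $ i $ 2 * t $ 2 $ j $ k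
   + (A2 $ j $ 1 * t $ i $ 1 $ k + A2 $ j $ 2 * t $ i $ 2 $ k)
   + (A3 $ k $ 1 * t $ i $ j $ 1 + A3 $ k $ 2 * t $ i $ j $ 2)"
  by (simp add: sum_2)

lemma sl2_act_commutator:
  "sl2_act (commutator A1 B1, commutator A2 B2, commutator A3 B3) t =
     sl2_act (A1, A2, A3) (sl2_act (B1, B2, B3) t) - sl2_act (B1, B2, B3) (sl2_act (A1, A2, A3) t)"
  by (simp add: vec_eq_iff sl2_act_component commutator_component forall_2 del: sl2_act.simps)
     (simp add: algebra_simps)

lemma gamma_odd_commute: "gamma_odd s1 s2 s3 t u = gamma_odd s1 s2 s3 u t"
  by (simp add: gamma_odd_eq mat2_eq_iff odd1_def odd2_def odd3_def algebra_simps)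

lemma trace_mat2: "trace (A::mat2) = A $ 1 $ 1 + A $ 2 $ 2"
  by (simp add: trace_def sum_2)

text \<open>In general \<open>\<eta>(Av,w) + \<eta>(v,Aw) = tr A * \<eta>(v,w)\<close>, so \<eta> is
  invariant under trace-free matrices, and for these \<phi> carries the action on quadratic forms to
  the commutator. This is the Jacobi identity for one even and two odd elements.\<close>

lemma gamma_odd_invariant:
  assumes "trace A1 = 0" "trace A2 = 0" "trace A3 = 0"
  shows "gamma_odd s1 s2 s3 (sl2_act (A1, A2, A3) t) u + gamma_odd s1 s2 s3 t (sl2_act (A1, A2, A3) u) =
    (commutator A1 (fst (gamma_odd s1 s2 s3 t u)), commutator A2 (fst (snd (gamma_odd s1 s2 s3 t u))),
     commutator A3 (snd (snd (gamma_odd s1 s2 s3 t u))))"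
proof -
  have tr: "A1 $ 2 $ 2 = - A1 $ 1 $ 1" "A2 $ 2 $ 2 = - A2 $ 1 $ 1" "A3 $ 2 $ 2 = - A3 $ 1 $ 1"
    using assms by (simp_all add: trace_mat2 eq_neg_iff_add_eq_0 add.commute)
  show ?thesis
    by (simp add: gamma_odd_eq mat2_eq_iff odd1_def odd2_def odd3_def sl2_act_component commutator_component tr
       del: sl2_act.simps)
       (intro conjI; simp add: field_simps)
qed

text \<open>The odd part occurs just once in its own symmetric cube, so by the symmetry of the three
  slots each of \<open>s1\<close>, \<open>s2\<close>, \<open>s3\<close> multiplies the same
  equivariant cubic map, and the total is a multiple of their sum. The proof eliminates
  \<open>s3\<close> and compares entries.\<close>

lemma gamma_odd_jacobi:
  assumes "s1 + s2 + s3 = 0"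
  shows "sl2_act (gamma_odd s1 s2 s3 t u) v + sl2_act (gamma_odd s1 s2 s3 u v) t
       + sl2_act (gamma_odd s1 s2 s3 v t) u = 0"
proof -
  have s: "s3 = - s1 - s2" using assms by (simp add: algebra_simps eq_neg_iff_add_eq_0)
  show ?thesis
    unfolding s gamma_odd_eq
    by (simp add: tensor_eq_iff odd1_def odd2_def odd3_def sl2_act_component del: sl2_act.simps)
       (intro conjI; simp add: field_simps)
qed

lemma commutator_linear:
  "commutator (A + B) C = commutator A C + commutator B C"
  "commutator C (A + B) = commutator C A + commutator C B"
  "commutator (mat_scale c A) C = mat_scale c (commutator A C)"
  "commutator C (mat_scale c A) = mat_scale c (commutator C A)"
  "commutator 0 C = 0" "commutator C 0 = 0"
  by (simp_all add: mat2_eq_iff commutator_component algebra_simps)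

lemma sl2_act_linear:
  "sl2_act (A + B) t = sl2_act A t + sl2_act B t"
  "sl2_act A (t + u) = sl2_act A t + sl2_act A u"
  "sl2_act (mat3_scale c A) t = tensor_scale c (sl2_act A t)"
  "sl2_act A (tensor_scale c t) = tensor_scale c (sl2_act A t)"
  "sl2_act 0 t = 0" "sl2_act A 0 = 0"
  by (cases A; cases B; simp add: tensor_eq_iff sl2_act_component zero_prod_def algebra_simps
        del: sl2_act.simps)+

lemma gamma_odd_linear:
  "gamma_odd s1 s2 s3 (t + u) v = gamma_odd s1 s2 s3 t v + gamma_odd s1 s2 s3 u v"
  "gamma_odd s1 s2 s3 (tensor_scale c t) v = mat3_scale c (gamma_odd s1 s2 s3 t v)"
  "gamma_odd s1 s2 s3 0 v = 0"
  by (simp_all add: gamma_odd_eq mat2_eq_iff odd1_def odd2_def odd3_def zero_prod_def)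
     (intro conjI; simp add: field_simps)+

lemma sl2_act_neg: "sl2_act A (- t) = - sl2_act A t"
  by (cases A; simp add: tensor_eq_iff sl2_act_component del: sl2_act.simps)

lemma gamma_odd_neg:
  "gamma_odd s1 s2 s3 (- t) u = - gamma_odd s1 s2 s3 t u"
  "gamma_odd s1 s2 s3 t (- u) = - gamma_odd s1 s2 s3 t u"
  by (simp_all add: gamma_odd_eq mat2_eq_iff odd1_def odd2_def odd3_def)
     (intro conjI; simp add: field_simps)+

section \<open>Bilinearity, grading and the Jacobi identity\<close>

lemma vector_space_gamma_scale: "vector_space gamma_scale"
  by (unfold_locales; clarsimp simp: mat2_eq_iff tensor_eq_iff algebra_simps)

lemma trace_mat_scale: "trace (mat_scale c A) = c * trace A"
  by (simp add: trace_mat2 algebra_simps)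

lemma trace_commutator: "trace (commutator A B) = 0"
  by (simp add: trace_mat2 commutator_component)

lemma gamma_bracket_linear:
  "gamma_bracket s1 s2 s3 (x + y) z = gamma_bracket s1 s2 s3 x z + gamma_bracket s1 s2 s3 y z"
  "gamma_bracket s1 s2 s3 z (x + y) = gamma_bracket s1 s2 s3 z x + gamma_bracket s1 s2 s3 z y"
  "gamma_bracket s1 s2 s3 (gamma_scale c x) y = gamma_scale c (gamma_bracket s1 s2 s3 x y)"
  "gamma_bracket s1 s2 s3 x (gamma_scale c y) = gamma_scale c (gamma_bracket s1 s2 s3 x y)"
proof -
  have mat3_add: "mat3_scale c (A + B) = mat3_scale c A + mat3_scale c B" for c A B
    by (cases A; cases B) (simp add: mat2_eq_iff algebra_simps)
  have tensor_diff: "tensor_scale c (t - u) = tensor_scale c t - tensor_scale c u" for c t u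
    by (simp add: tensor_eq_iff algebra_simps)
  have r: "gamma_odd s1 s2 s3 v (t + u) = gamma_odd s1 s2 s3 v t + gamma_odd s1 s2 s3 v u"
    "gamma_odd s1 s2 s3 v (tensor_scale c t) = mat3_scale c (gamma_odd s1 s2 s3 v t)" for v t u
    by (simp_all add: gamma_odd_commute[of _ _ _ v] gamma_odd_linear)
  have act: "sl2_act (A + A', B + B', C + C') t = sl2_act (A,B,C) t + sl2_act (A',B',C') t"
    "sl2_act (mat_scale c A, mat_scale c B, mat_scale c C) t = tensor_scale c (sl2_act (A,B,C) t)"
      for A B C A' B' C' t
    using sl2_act_linear(1)[of "(A,B,C)" "(A',B',C')" t] sl2_act_linear(3)[of c "(A,B,C)" t] by simp_all
  show "gamma_bracket s1 s2 s3 (x + y) z = gamma_bracket s1 s2 s3 x z + gamma_bracket s1 s2 s3 y z"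
    by (cases x; cases y; cases z; cases "fst x"; cases "fst y"; cases "fst z";
        clarsimp simp: commutator_linear gamma_odd_linear act sl2_act_linear(2) algebra_simps simp del: sl2_act.simps)
  show "gamma_bracket s1 s2 s3 z (x + y) = gamma_bracket s1 s2 s3 z x + gamma_bracket s1 s2 s3 z y"
    by (cases x; cases y; cases z; cases "fst x"; cases "fst y"; cases "fst z";
        clarsimp simp: commutator_linear r act sl2_act_linear(2) algebra_simps simp del: sl2_act.simps)
  show "gamma_bracket s1 s2 s3 (gamma_scale c x) y = gamma_scale c (gamma_bracket s1 s2 s3 x y)"
    by (cases x; cases y; cases "fst x"; cases "fst y";
        clarsimp simp: commutator_linear gamma_odd_linear act sl2_act_linear(4) tensor_diff mat3_add
          simp del: sl2_act.simps)
  show "gamma_bracket s1 s2 s3 x (gamma_scale c y) = gamma_scale c (gamma_bracket s1 s2 s3 x y)"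
    by (cases x; cases y; cases "fst x"; cases "fst y";
        clarsimp simp: commutator_linear r act sl2_act_linear(4) tensor_diff mat3_add
          simp del: sl2_act.simps)
qed

lemma scale_one [simp]: "gamma_scale 1 x = x" "gamma_scale (-1) x = - x"
  by (cases x; cases "fst x"; clarsimp simp: mat2_eq_iff tensor_eq_iff)+

lemma even_cases:
  assumes "x \<in> part (Gamma_superalgebra s1 s2 s3) p" "even p"
  obtains A1 A2 A3 where "x = ((A1, A2, A3), 0)" "trace A1 = 0" "trace A2 = 0" "trace A3 = 0"
  using assms by (auto simp: part_def Gamma_superalgebra_def)

lemma odd_cases:
  assumes "x \<in> part (Gamma_superalgebra s1 s2 s3) p" "odd p"
  obtains t where "x = (0, t)"
  using assms by (auto simp: part_def Gamma_superalgebra_def)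

lemma gamma_bracket_homogeneous:
  "gamma_bracket s1 s2 s3 ((A1, A2, A3), 0) ((B1, B2, B3), 0) =
     ((commutator A1 B1, commutator A2 B2, commutator A3 B3), 0)"
  "gamma_bracket s1 s2 s3 ((A1, A2, A3), 0) (0, t) = (0, sl2_act (A1, A2, A3) t)"
  "gamma_bracket s1 s2 s3 (0, t) ((A1, A2, A3), 0) = (0, - sl2_act (A1, A2, A3) t)"
  "gamma_bracket s1 s2 s3 (0, t) (0, u) = (gamma_odd s1 s2 s3 t u, 0)"
  using sl2_act_linear(5) gamma_odd_linear(3)[of s1 s2 s3] gamma_odd_linear(3)[of s1 s2 s3 t, unfolded gamma_odd_commute[of _ _ _ 0]]
  by (auto simp: zero_prod_def commutator_linear sl2_act_linear simp del: sl2_act.simps)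

lemma trace_odd_mat: "trace (odd_mat s c) = 0"
  by (simp add: trace_mat2)

declare gamma_bracket.simps [simp del] gamma_scale.simps [simp del] sl2_act.simps [simp del]

lemma commutator_jacobi:
  "commutator A (commutator B C) = commutator (commutator A B) C + commutator B (commutator A C)"
  by (simp add: mat2_eq_iff commutator_component algebra_simps)

lemma commutator_skew: "commutator A B = - commutator B A"
  by (simp add: mat2_eq_iff commutator_component)

text \<open>The eight parity cases of the Jacobi identity reduce to four facts: the identity for
  commutators, the action being a representation (one odd element), equivariance of the odd bracket
  (two odd elements), and the cyclic identity (three odd elements), where the assumption on the sum
  is used.\<close>

theorem lie_superalgebra_Gamma:
  assumes s: "s1 + s2 + s3 = 0"
  shows "lie_superalgebra (Gamma_superalgebra s1 s2 s3)"
proof -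
  let ?L = "Gamma_superalgebra s1 s2 s3" and ?b = "gamma_bracket s1 s2 s3"
  have sel [simp]: "sscale ?L = gamma_scale" "sbracket ?L = ?b"
    by (simp_all add: Gamma_superalgebra_def)
  interpret vector_space gamma_scale by (rule vector_space_gamma_scale)
  have ev: "subspace (ev_part ?L)"
    by (rule subspaceI)
       (auto simp: Gamma_superalgebra_def gamma_scale.simps trace_add trace_mat_scale zero_prod_def tensor_eq_iff trace_0[unfolded mat_0])
  have od: "subspace (od_part ?L)"
    by (rule subspaceI)
       (auto simp: Gamma_superalgebra_def gamma_scale.simps mat2_eq_iff zero_prod_def)
  have int: "ev_part ?L \<inter> od_part ?L = {0}"
    by (auto simp: Gamma_superalgebra_def zero_prod_def trace_mat2)
  have closed: "?b x y \<in> part ?L (p + q) \<and> ?b x y = - gamma_scale ((-1) ^ (p * q)) (?b y x)"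
    if x: "x \<in> part ?L p" and y: "y \<in> part ?L q" for p q x y
  proof (cases "even p"; cases "even q")
    assume "even p" "even q"
    with x y show ?thesis
      by (elim even_cases)
         (auto simp: gamma_bracket_homogeneous part_def Gamma_superalgebra_def trace_commutator
           intro: commutator_skew)
  next
    assume "even p" "odd q"
    with x y show ?thesis
      by (elim even_cases odd_cases)
         (auto simp: gamma_bracket_homogeneous part_def Gamma_superalgebra_def simp del: sl2_act.simps)
  next
    assume "odd p" "even q"
    with x y show ?thesis
      by (elim even_cases odd_cases)
         (auto simp: gamma_bracket_homogeneous part_def Gamma_superalgebra_def simp del: sl2_act.simps)
  next
    assume "odd p" "odd q"
    with x y show ?thesis
      by (elim odd_cases)
         (auto simp: gamma_bracket_homogeneous part_def Gamma_superalgebra_def gamma_odd_eq trace_odd_mat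
            gamma_odd_commute[unfolded gamma_odd_eq])
  qed
  have jacobi: "?b x (?b y z) = ?b (?b x y) z + gamma_scale ((-1) ^ (p * q)) (?b y (?b x z))"
    if x: "x \<in> part ?L p" and y: "y \<in> part ?L q" and z: "z \<in> part ?L r" for p q r x y z
  proof -
    have odd_split: "\<exists>C1 C2 C3. gamma_odd s1 s2 s3 t u = (C1, C2, C3)" for t u
      by (simp add: gamma_odd_eq)
    consider "even p" "even q" "even r" | "even p" "even q" "odd r"
      | "even p" "odd q" "even r" | "even p" "odd q" "odd r"
      | "odd p" "even q" "even r" | "odd p" "even q" "odd r"
      | "odd p" "odd q" "even r" | "odd p" "odd q" "odd r" by blast
    then show ?thesis
    proof cases
      case 1
      with x y z show ?thesis
        by (elim even_cases) (auto simp: gamma_bracket_homogeneous intro: commutator_jacobi)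
    next
      case 2
      show ?thesis
        by (insert 2, rule even_cases[OF x \<open>even p\<close>], rule even_cases[OF y \<open>even q\<close>], rule odd_cases[OF z \<open>odd r\<close>])
           (simp add: gamma_bracket_homogeneous sl2_act_commutator )
    next
      case 3
      show ?thesis
        by (insert 3, rule even_cases[OF x \<open>even p\<close>], rule odd_cases[OF y \<open>odd q\<close>], rule even_cases[OF z \<open>even r\<close>])
           (simp add: gamma_bracket_homogeneous sl2_act_commutator sl2_act_neg )
    next
      case 4
      with x y z obtain A1 A2 A3 t u where x: "x = ((A1, A2, A3), 0)" and y: "y = (0, t)" and z: "z = (0, u)"
        and tr: "trace A1 = 0" "trace A2 = 0" "trace A3 = 0"
        by (metis even_cases odd_cases)
      obtain C1 C2 C3 where C: "gamma_odd s1 s2 s3 t u = (C1, C2, C3)" using odd_split by blast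
      show ?thesis
        using gamma_odd_invariant[OF tr, of s1 s2 s3 t u] \<open>even p\<close>
        by (simp add: x y z gamma_bracket_homogeneous C )
    next
      case 5
      show ?thesis
        by (insert 5, rule odd_cases[OF x \<open>odd p\<close>], rule even_cases[OF y \<open>even q\<close>], rule even_cases[OF z \<open>even r\<close>])
           (simp add: gamma_bracket_homogeneous sl2_act_commutator sl2_act_neg )
    next
      case 6
      with x y z obtain A1 A2 A3 t u where y: "y = ((A1, A2, A3), 0)" and x: "x = (0, t)" and z: "z = (0, u)"
        and tr: "trace A1 = 0" "trace A2 = 0" "trace A3 = 0"
        by (metis even_cases odd_cases)
      obtain C1 C2 C3 where C: "gamma_odd s1 s2 s3 t u = (C1, C2, C3)" using odd_split by blast
      show ?thesis
        using gamma_odd_invariant[OF tr, of s1 s2 s3 t u] \<open>even q\<close>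
        by (simp add: x y z gamma_bracket_homogeneous C gamma_odd_neg algebra_simps )
    next
      case 7
      with x y z obtain A1 A2 A3 t u where z: "z = ((A1, A2, A3), 0)" and x: "x = (0, t)" and y: "y = (0, u)"
        and tr: "trace A1 = 0" "trace A2 = 0" "trace A3 = 0"
        by (metis even_cases odd_cases)
      obtain C1 C2 C3 where C: "gamma_odd s1 s2 s3 t u = (C1, C2, C3)" using odd_split by blast
      have "gamma_odd s1 s2 s3 (sl2_act (A1, A2, A3) t) u + gamma_odd s1 s2 s3 t (sl2_act (A1, A2, A3) u)
        = - (commutator C1 A1, commutator C2 A2, commutator C3 A3)"
        using gamma_odd_invariant[OF tr, of s1 s2 s3 t u] commutator_skew[of A1 C1]
          commutator_skew[of A2 C2] commutator_skew[of A3 C3]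
        by (simp add: C del: sl2_act.simps)
      then show ?thesis
        using \<open>odd p\<close> \<open>odd q\<close>
        by (simp add: x y z gamma_bracket_homogeneous C gamma_odd_neg
            gamma_odd_commute[of s1 s2 s3 u] eq_neg_iff_add_eq_0 neg_eq_iff_add_eq_0)
           (simp add: add_ac zero_prod_def)
    next
      case 8
      with x y z obtain t u v where x: "x = (0, t)" and y: "y = (0, u)" and z: "z = (0, v)"
        by (metis odd_cases)
      obtain C1 C2 C3 where C: "gamma_odd s1 s2 s3 t u = (C1, C2, C3)" using odd_split by blast
      obtain D1 D2 D3 where D: "gamma_odd s1 s2 s3 u v = (D1, D2, D3)" using odd_split by blast
      obtain E1 E2 E3 where E: "gamma_odd s1 s2 s3 t v = (E1, E2, E3)" using odd_split by blast
      have "sl2_act (C1, C2, C3) v + sl2_act (D1, D2, D3) t + sl2_act (E1, E2, E3) u = 0"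
        using gamma_odd_jacobi[OF s, of t u v] unfolding gamma_odd_commute[of s1 s2 s3 v t] C D E .
      then have "sl2_act (D1, D2, D3) t + (sl2_act (C1, C2, C3) v + sl2_act (E1, E2, E3) u) = 0"
        by (simp only: add_ac)
      then have "- sl2_act (D1, D2, D3) t = sl2_act (C1, C2, C3) v + sl2_act (E1, E2, E3) u"
        by (rule neg_eq_iff_add_eq_0[THEN iffD2])
      then show ?thesis
        using \<open>odd p\<close> \<open>odd q\<close> by (simp add: x y z gamma_bracket_homogeneous C D E)
    qed
  qed
  show ?thesis
    unfolding lie_superalgebra_def sel
    by (intro conjI ballI allI vector_space_gamma_scale ev od int gamma_bracket_linear;
        (rule closed[THEN conjunct1] closed[THEN conjunct2] jacobi; assumption))
qed

section \<open>The algebra of superfunctions\<close>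

lemma smul_eq:
  "(f \<odot> g) x (k, l, S) = (\<Sum>(i, j, T)\<in>{..k} \<times> {..l} \<times> Pow S.
      koszul T (S - T) * f x (i, j, T) * g x (k - i, l - j, S - T))"
  by (simp add: smul_def sum.cartesian_product)

text \<open>A sum over the infinite set \<open>Pow S\<close> is 0 by convention, so infinite index
  sets are settled at once in every identity between products.\<close>

lemma smul_infinite: "infinite S \<Longrightarrow> (f \<odot> g) x (k, l, S) = 0"
  by (simp add: smul_def finite_Pow_iff)

lemma koszul_empty [simp]: "koszul {} T = 1" "koszul T {} = 1"
  by (simp_all add: koszul_def)

lemma koszul_Un_left:
  assumes "finite T" "finite U" "finite W" "T \<inter> U = {}"
  shows "koszul (T \<union> U) W = koszul T W * koszul U W"
proof -
  have "{(t, w). t \<in> T \<union> U \<and> w \<in> W \<and> w < t} =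
      {(t, w). t \<in> T \<and> w \<in> W \<and> w < t} \<union> {(t, w). t \<in> U \<and> w \<in> W \<and> w < t}" by auto
  moreover have "finite {(t, w). t \<in> T \<and> w \<in> W \<and> w < t}" "finite {(t, w). t \<in> U \<and> w \<in> W \<and> w < t}"
    using assms by (auto intro: finite_subset[of _ "T \<times> W"] finite_subset[of _ "U \<times> W"])
  ultimately show ?thesis
    using assms(4) by (simp add: koszul_def flip: power_add) (subst card_Un_disjoint; auto)
qed

lemma koszul_Un_right:
  assumes "finite T" "finite U" "finite W" "T \<inter> U = {}"
  shows "koszul W (T \<union> U) = koszul W T * koszul W U"
proof -
  have "{(w, t). w \<in> W \<and> t \<in> T \<union> U \<and> t < w} =
      {(w, t). w \<in> W \<and> t \<in> T \<and> t < w} \<union> {(w, t). w \<in> W \<and> t \<in> U \<and> t < w}" by auto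
  moreover have "finite {(w, t). w \<in> W \<and> t \<in> T \<and> t < w}" "finite {(w, t). w \<in> W \<and> t \<in> U \<and> t < w}"
    using assms by (auto intro: finite_subset[of _ "W \<times> T"] finite_subset[of _ "W \<times> U"])
  ultimately show ?thesis
    using assms(4) by (simp add: koszul_def flip: power_add) (subst card_Un_disjoint; auto)
qed

lemma koszul_eq_1:
  assumes "\<And>t u. t \<in> T \<Longrightarrow> u \<in> U \<Longrightarrow> t < u"
  shows "koszul T U = 1"
proof -
  have "{(t, u). t \<in> T \<and> u \<in> U \<and> u < t} = {}" using assms by fastforce
  then show ?thesis unfolding koszul_def by (metis card.empty power_0)
qed

text \<open>Both sides count the inversions between the three blocks \<open>U\<close>,
  \<open>T - U\<close> and \<open>S - T\<close>.\<close>

lemma koszul_assoc: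
  assumes "finite S" "T \<subseteq> S" "U \<subseteq> T"
  shows "koszul T (S - T) * koszul U (T - U) = koszul U (S - U) * koszul (T - U) (S - T)"
proof -
  have "koszul (U \<union> (T - U)) (S - T) = koszul U (S - T) * koszul (T - U) (S - T)"
    using assms by (intro koszul_Un_left) (auto intro: finite_subset)
  moreover have "koszul U ((T - U) \<union> (S - T)) = koszul U (T - U) * koszul U (S - T)"
    using assms by (intro koszul_Un_right) (auto intro: finite_subset)
  moreover have "U \<union> (T - U) = T" "(T - U) \<union> (S - T) = S - U" using assms by auto
  ultimately show ?thesis by simp
qed

lemma smul_assoc: "(f \<odot> g) \<odot> h = f \<odot> (g \<odot> h)"
proof (intro ext)
  fix x and m :: smono
  obtain k l S where m: "m = (k, l, S)" by (cases m)
  show "((f \<odot> g) \<odot> h) x m = (f \<odot> (g \<odot> h)) x m"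
  proof (cases "finite S")
    case False
    then show ?thesis by (simp add: m smul_infinite)
  next
    case True
    let ?D = "\<lambda>k l S. {..k::nat} \<times> {..l::nat} \<times> Pow (S::nat set)"
    \<comment> \<open>Both iterated sums run over the ordered splittings of a monomial into three
      factors: \<open>?L\<close> records the product of the first two and then the first,
      \<open>?R\<close> records the first and then the second. The maps \<open>?i\<close> and
      \<open>?j\<close> translate between the two records.\<close>
    let ?L = "\<lambda>(i, j, T) (i', j', U). koszul T (S - T) * koszul U (T - U) * f x (i', j', U) *
        g x (i - i', j - j', T - U) * h x (k - i, l - j, S - T)"
    let ?R = "\<lambda>(i, j, T) (i', j', U). koszul T (S - T) * koszul U (S - T - U) * f x (i, j, T) *
        g x (i', j', U) * h x (k - i - i', l - j - j', S - T - U)"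
    let ?i = "\<lambda>((i, j, T), (i', j', U)). ((i + i', j + j', T \<union> U), (i, j, T))"
    let ?j = "\<lambda>((i, j, T), (i', j', U)). ((i', j', U), (i - i', j - j', T - U))"
    have "((f \<odot> g) \<odot> h) x m = (\<Sum>a\<in>?D k l S. \<Sum>b\<in>(case a of (i, j, T) \<Rightarrow> ?D i j T). ?L a b)"
      unfolding m smul_eq[of "f \<odot> g"]
    proof (rule sum.cong[OF refl])
      fix a assume "a \<in> ?D k l S"
      obtain i j T where a: "a = (i, j, T)" by (cases a)
      show "(case a of (i, j, T) \<Rightarrow> koszul T (S - T) * (f \<odot> g) x (i, j, T) * h x (k - i, l - j, S - T)) =
          (\<Sum>b\<in>(case a of (i, j, T) \<Rightarrow> ?D i j T). ?L a b)"
        unfolding a prod.case smul_eq sum_distrib_left sum_distrib_right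
        by (rule sum.cong[OF refl]) (simp add: split_beta)
    qed
    also have "\<dots> = (\<Sum>(a, b)\<in>Sigma (?D k l S) (\<lambda>(i, j, T). ?D i j T). ?L a b)"
      using True by (subst sum.Sigma) (auto intro: finite_subset simp: split_beta)
    also have "\<dots> = (\<Sum>(a, b)\<in>Sigma (?D k l S) (\<lambda>(i, j, T). ?D (k - i) (l - j) (S - T)). ?R a b)"
    proof (rule sum.reindex_bij_witness[where i = ?i and j = ?j])
      fix a assume "a \<in> Sigma (?D k l S) (\<lambda>(i, j, T). ?D i j T)"
      then obtain i j T i' j' U where a: "a = ((i, j, T), (i', j', U))"
        and le: "i \<le> k" "j \<le> l" "T \<subseteq> S" "i' \<le> i" "j' \<le> j" "U \<subseteq> T" by auto
      have T: "U \<union> (T - U) = T" "S - U - (T - U) = S - T" "U \<subseteq> S" "T - U \<subseteq> S - U" using le by auto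
      show "?i (?j a) = a" using le T by (simp add: a)
      show "?j a \<in> Sigma (?D k l S) (\<lambda>(i, j, T). ?D (k - i) (l - j) (S - T))"
        using le T by (auto simp: a)
      show "(case ?j a of (a, b) \<Rightarrow> ?R a b) = (case a of (a, b) \<Rightarrow> ?L a b)"
        using koszul_assoc[OF True \<open>T \<subseteq> S\<close> \<open>U \<subseteq> T\<close>] le by (simp add: a T)
    next
      fix a assume "a \<in> Sigma (?D k l S) (\<lambda>(i, j, T). ?D (k - i) (l - j) (S - T))"
      then obtain i j T i' j' U where a: "a = ((i, j, T), (i', j', U))"
        and le: "i \<le> k" "j \<le> l" "T \<subseteq> S" "i' \<le> k - i" "j' \<le> l - j" "U \<subseteq> S - T" by auto
      have T: "T \<union> U - T = U" "T \<union> U \<subseteq> S" using le by auto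
      show "?j (?i a) = a" using le T by (simp add: a)
      show "?i a \<in> Sigma (?D k l S) (\<lambda>(i, j, T). ?D i j T)" using le T by (auto simp: a)
    qed
    also have "\<dots> = (\<Sum>a\<in>?D k l S. \<Sum>b\<in>(case a of (i, j, T) \<Rightarrow> ?D (k - i) (l - j) (S - T)). ?R a b)"
      using True by (subst sum.Sigma) (auto intro: finite_subset simp: split_beta)
    also have "\<dots> = (f \<odot> (g \<odot> h)) x m"
      unfolding m smul_eq[of f]
    proof (rule sum.cong[OF refl])
      fix a assume "a \<in> ?D k l S"
      obtain i j T where a: "a = (i, j, T)" by (cases a)
      show "(\<Sum>b\<in>(case a of (i, j, T) \<Rightarrow> ?D (k - i) (l - j) (S - T)). ?R a b) =
          (case a of (i, j, T) \<Rightarrow> koszul T (S - T) * f x (i, j, T) * (g \<odot> h) x (k - i, l - j, S - T))"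
        unfolding a prod.case smul_eq sum_distrib_left sum_distrib_right
        by (rule sum.cong[OF refl]) (simp add: split_beta)
    qed
    finally show ?thesis .
  qed
qed

lemma smul_add_left: "(f + g) \<odot> h = f \<odot> h + g \<odot> h"
  by (intro ext) (auto simp: smul_def sum.distrib algebra_simps)
lemma smul_add_right: "h \<odot> (f + g) = h \<odot> f + h \<odot> g"
  by (intro ext) (auto simp: smul_def sum.distrib algebra_simps)
lemma smul_cmul_left: "cmul c f \<odot> g = cmul c (f \<odot> g)"
  by (intro ext) (auto simp: smul_def cmul_def sum_distrib_left algebra_simps)
lemma smul_cmul_right: "f \<odot> cmul c g = cmul c (f \<odot> g)"
  by (intro ext) (auto simp: smul_def cmul_def sum_distrib_left algebra_simps)
lemma smul_zero [simp]: "0 \<odot> f = 0" "f \<odot> 0 = 0"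
  by (intro ext; auto simp: smul_def)+
lemma smul_sum_left: "sum f A \<odot> g = (\<Sum>i\<in>A. f i \<odot> g)"
  by (induction A rule: infinite_finite_induct)
     (simp_all only: sum.infinite sum.empty smul_zero sum.insert smul_add_left not_False_eq_True)

lemma monomial_smul:
  assumes "finite S"
  shows "(monomial (i, j, T) \<odot> G) x (k, l, S) =
    (if i \<le> k \<and> j \<le> l \<and> T \<subseteq> S then koszul T (S - T) * G x (k - i, l - j, S - T) else 0)"
proof -
  have "(monomial (i, j, T) \<odot> G) x (k, l, S) = (\<Sum>m\<in>{..k} \<times> {..l} \<times> Pow S.
      if m = (i, j, T) then koszul T (S - T) * G x (k - i, l - j, S - T) else 0)"
    unfolding smul_eq by (rule sum.cong) (auto simp: monomial_def split: if_splits)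
  also have "\<dots> = (if i \<le> k \<and> j \<le> l \<and> T \<subseteq> S then koszul T (S - T) * G x (k - i, l - j, S - T) else 0)"
    using assms by (subst sum.delta) auto
  finally show ?thesis .
qed

lemma monomial_mult:
  assumes "finite S" "finite T"
  shows "monomial (i, j, S) \<odot> monomial (i', j', T) =
    (if S \<inter> T = {} then cmul (koszul S T) (monomial (i + i', j + j', S \<union> T)) else 0)"
proof (intro ext)
  fix x and m :: smono
  obtain k l U where m: "m = (k, l, U)" by (cases m)
  show "(monomial (i, j, S) \<odot> monomial (i', j', T)) x m =
    (if S \<inter> T = {} then cmul (koszul S T) (monomial (i + i', j + j', S \<union> T)) else 0) x m"
  proof (cases "finite U")
    case True
    show ?thesis
    proof (cases "k = i + i' \<and> l = j + j' \<and> S \<inter> T = {} \<and> U = S \<union> T")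
      case eq: True
      then have "U - S = T" by blast
      with eq True show ?thesis by (simp add: m monomial_smul cmul_def) (simp add: monomial_def)
    next
      case neq: False
      then have "\<not> (i \<le> k \<and> j \<le> l \<and> S \<subseteq> U \<and> (k - i, l - j, U - S) = (i', j', T))" by auto
      then have "(monomial (i, j, S) \<odot> monomial (i', j', T)) x m = 0"
        unfolding m monomial_smul[OF True] monomial_def[of "(i', j', T)"] by (metis mult_zero_right)
      moreover have "S \<inter> T = {} \<Longrightarrow> m \<noteq> (i + i', j + j', S \<union> T)" using neq m by blast
      ultimately show ?thesis by (simp add: cmul_def) (simp add: monomial_def)
    qed
  next
    case False
    then show ?thesis using assms by (auto simp: m smul_infinite monomial_def cmul_def)
  qed
qed

text \<open>
  Vanishing on the cone only depends on this part of \<^const>\<open>fibre_form\<close>; so one never needs that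
  partial derivatives, which occur in the lift, are again holomorphic.
\<close>

definition fibre_degree :: "nat \<Rightarrow> sfun \<Rightarrow> bool" where
  "fibre_degree d F \<longleftrightarrow>
     (\<forall>x k l S. F x (k, l, S) \<noteq> 0 \<longrightarrow> S \<subseteq> {0,1,2,3} \<and> k + l + card (S \<inter> {2,3}) = d)"

lemma fibre_form_iff: "fibre_form d F \<longleftrightarrow> (\<forall>m. holomorphic2 (\<lambda>x. F x m)) \<and> fibre_degree d F"
  by (simp add: fibre_form_def fibre_degree_def)

lemma fibre_degreeD:
  assumes "fibre_degree d F" "F x (k, l, S) \<noteq> 0"
  shows "S \<subseteq> {0,1,2,3}" "k + l + card (S \<inter> {2,3}) = d"
  using assms unfolding fibre_degree_def by blast+

lemma fibre_degreeI:
  assumes "\<And>x k l S. F x (k, l, S) \<noteq> 0 \<Longrightarrow> S \<subseteq> {0,1,2,3} \<and> k + l + card (S \<inter> {2,3}) = d"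
  shows "fibre_degree d F"
  unfolding fibre_degree_def by (intro allI impI assms)

lemma fibre_degree_add:
  assumes "fibre_degree d F" "fibre_degree d G"
  shows "fibre_degree d (F + G)"
proof (rule fibre_degreeI)
  fix x k l S assume "(F + G) x (k, l, S) \<noteq> 0"
  then have "F x (k, l, S) \<noteq> 0 \<or> G x (k, l, S) \<noteq> 0" by auto
  then show "S \<subseteq> {0,1,2,3} \<and> k + l + card (S \<inter> {2,3}) = d"
    using fibre_degreeD[OF assms(1), of x k l S] fibre_degreeD[OF assms(2), of x k l S] by blast
qed
lemma fibre_degree_0 [simp]: "fibre_degree d 0"
  by (simp add: fibre_degree_def)
lemma fibre_degree_sum: "(\<And>i. i \<in> A \<Longrightarrow> fibre_degree d (F i)) \<Longrightarrow> fibre_degree d (sum F A)"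
  by (induction A rule: infinite_finite_induct) (auto intro: fibre_degree_add)
lemma fibre_degree_cmul:
  assumes "fibre_degree d F" shows "fibre_degree d (cmul c F)"
proof (rule fibre_degreeI)
  fix x k l S assume "cmul c F x (k, l, S) \<noteq> 0"
  then have "F x (k, l, S) \<noteq> 0" unfolding cmul_def by auto
  then show "S \<subseteq> {0,1,2,3} \<and> k + l + card (S \<inter> {2,3}) = d"
    using fibre_degreeD[OF assms, of x k l S] by blast
qed

lemma fibre_degree_smul:
  assumes "fibre_degree d F" "fibre_degree e G"
  shows "fibre_degree (d + e) (F \<odot> G)"
  unfolding fibre_degree_def
proof (intro allI impI)
  fix x k l S assume "(F \<odot> G) x (k, l, S) \<noteq> 0"
  then obtain i j T where ij: "i \<le> k" "j \<le> l" "T \<subseteq> S" "F x (i, j, T) \<noteq> 0" "G x (k - i, l - j, S - T) \<noteq> 0"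
    unfolding smul_eq by (elim sum.not_neutral_contains_not_neutral) auto
  have eq: "S \<inter> {2,3} = (T \<inter> {2,3}) \<union> ((S - T) \<inter> {2,3})" using ij by blast
  have "card (S \<inter> {2,3}) = card (T \<inter> {2,3}) + card ((S - T) \<inter> {2,3})"
    unfolding eq by (rule card_Un_disjoint) auto
  moreover have "S \<subseteq> {0,1,2,3}"
    using fibre_degreeD(1)[OF assms(1) ij(4)] fibre_degreeD(1)[OF assms(2) ij(5)] by blast
  ultimately show "S \<subseteq> {0,1,2,3} \<and> k + l + card (S \<inter> {2,3}) = d + e"
    using fibre_degreeD(2)[OF assms(1) ij(4)] fibre_degreeD(2)[OF assms(2) ij(5)] ij by linarith
qed

section \<open>Products with superfunctions on the base\<close>

lemma base_smul:
  assumes f: "fibre_degree 0 f" and S: "finite S"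
  shows "(f \<odot> G) x (k, l, S) = (\<Sum>T\<in>Pow (S \<inter> {0,1}). koszul T (S - T) * f x (0, 0, T) * G x (k, l, S - T))"
proof -
  let ?h = "\<lambda>(i, j, T). koszul T (S - T) * f x (i, j, T) * G x (k - i, l - j, S - T)"
  have "f x (i, j, T) = 0" if "i \<noteq> 0 \<or> j \<noteq> 0 \<or> \<not> T \<subseteq> {0,1}" for i j T
  proof (rule ccontr)
    assume "f x (i, j, T) \<noteq> 0"
    note fibre_degreeD[OF f this]
    with that show False by auto
  qed
  then have "?h a = 0" if "a \<in> {..k} \<times> {..l} \<times> Pow S - {0} \<times> {0} \<times> Pow (S \<inter> {0,1})" for a
    using that by (cases a) auto
  then have "(f \<odot> G) x (k, l, S) = sum ?h ({0} \<times> {0} \<times> Pow (S \<inter> {0,1}))"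
    unfolding smul_eq using S by (intro sum.mono_neutral_right ballI) auto
  also have "\<dots> = (\<Sum>T\<in>Pow (S \<inter> {0,1}). koszul T (S - T) * f x (0, 0, T) * G x (k, l, S - T))"
    by (rule sum.reindex_bij_witness[where i = "\<lambda>T. (0, 0, T)" and j = "\<lambda>(i, j, T). T"]) auto
  finally show ?thesis .
qed

text \<open>The base indices 0, 1 precede the fibre indices 2, 3, so no sign arises from
  \<open>P\<close>, and multiplication by f acts on the base part of the index set alone.\<close>

lemma base_smul_Un:
  assumes f: "fibre_degree 0 f" and "B \<subseteq> {0,1}" "P \<subseteq> {2,3}"
  shows "(f \<odot> G) x (k, l, B \<union> P) =
    (\<Sum>T\<in>Pow B. koszul T (B - T) * f x (0, 0, T) * G x (k, l, (B - T) \<union> P))"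
proof -
  have fin: "finite B" "finite P" using assms by (auto intro: finite_subset)
  have "P \<inter> {0,1} = {}" using assms(3) by auto
  then have B: "(B \<union> P) \<inter> {0,1} = B" using assms(2) by blast
  have "{0, 1} \<inter> {2, 3::nat} = {}" by simp
  then have disj: "B \<inter> P = {}" using assms(2,3) by blast
  have lt: "t < u" if "t \<in> B" "u \<in> P" for t u
  proof -
    have "t < 2" "2 \<le> u" using that assms(2,3) by auto
    then show ?thesis by simp
  qed
  have "koszul T (B \<union> P - T) = koszul T (B - T)" "B \<union> P - T = (B - T) \<union> P" if T: "T \<subseteq> B" for T
  proof -
    show eq: "B \<union> P - T = (B - T) \<union> P" using disj T by blast
    have "koszul T P = 1" using T by (intro koszul_eq_1 lt) auto
    moreover have "finite T" "finite (B - T)" "(B - T) \<inter> P = {}"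
      using T fin disj finite_subset[OF T] by auto
    ultimately show "koszul T (B \<union> P - T) = koszul T (B - T)"
      unfolding eq using fin by (simp add: koszul_Un_right)
  qed
  then show ?thesis
    unfolding base_smul[OF f finite_UnI[OF fin]] B by (intro sum.cong refl) auto
qed

text \<open>If G is free of the odd base coordinates, f has to supply all of \<open>B\<close>, and
  only the term \<open>T = B\<close> survives.\<close>

lemma base_smul_const:
  assumes f: "fibre_degree 0 f" and "B \<subseteq> {0,1}" "P \<subseteq> {2,3}"
    and G: "\<And>k l S. G x (k, l, S) \<noteq> 0 \<Longrightarrow> S \<subseteq> {2,3}"
  shows "(f \<odot> G) x (k, l, B \<union> P) = f x (0, 0, B) * G x (k, l, P)"
proof -
  have "G x (k, l, (B - T) \<union> P) = 0" if "T \<subseteq> B" "T \<noteq> B" for T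
    using that assms(2) G[of k l "(B - T) \<union> P"] by fastforce
  then have "(f \<odot> G) x (k, l, B \<union> P) =
      (\<Sum>T\<in>{B}. koszul T (B - T) * f x (0, 0, T) * G x (k, l, (B - T) \<union> P))"
    unfolding base_smul_Un[OF assms(1-3)] using assms(2) finite_subset[OF assms(2)]
    by (intro sum.mono_neutral_right) auto
  then show ?thesis by simp
qed

section \<open>Forms vanishing on the cone\<close>

abbreviation odd_mono :: "nat set \<Rightarrow> sfun" where "odd_mono S \<equiv> monomial (0, 0, S)"

lemma cmul_cmul [simp]: "cmul b (cmul c f) = cmul (b * c) f"
  by (simp add: cmul_def mult.assoc)
lemma cmul_1 [simp]: "cmul 1 f = f"
  by (simp add: cmul_def)
lemma cmul_0 [simp]: "cmul 0 f = 0" "cmul c 0 = 0"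
  by (auto simp: cmul_def fun_eq_iff)

lemma odd_mono_mult:
  assumes "finite S" "finite T" "\<forall>s\<in>S. \<forall>t\<in>T. s < t"
  shows "odd_mono S \<odot> odd_mono T = odd_mono (S \<union> T)"
proof -
  have "S \<inter> T = {}" using assms(3) by blast
  with assms show ?thesis by (simp add: monomial_mult koszul_eq_1)
qed

lemma odd_mono_overlap:
  assumes "finite S" "finite T" "S \<inter> T \<noteq> {}"
  shows "odd_mono S \<odot> odd_mono T = 0"
  using assms by (simp add: monomial_mult)

lemma odd_mono_one [simp]:
  "finite S \<Longrightarrow> odd_mono S \<odot> odd_mono {} = odd_mono S"
  "finite S \<Longrightarrow> odd_mono {} \<odot> odd_mono S = odd_mono S"
  by (simp_all add: monomial_mult)

lemma spow_cmul: "spow (cmul c f) n = cmul (c ^ n) (spow f n)"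
  by (induction n) (simp_all add: smul_cmul_left smul_cmul_right mult.commute)

lemma spow_one: "spow (odd_mono {}) n = odd_mono {}"
  by (induction n) simp_all

lemma spow_nilpotent: "spow (odd_mono {2,3}) n = (if n = 0 then odd_mono {} else if n = 1 then odd_mono {2,3} else 0)"
proof (cases n)
  case (Suc m)
  then show ?thesis by (cases m) (simp_all add: odd_mono_overlap smul_assoc[symmetric])
qed simp

lemma theta_phi: "odd_mono {2} \<odot> odd_mono {3} = odd_mono {2,3}"
  by (simp add: odd_mono_mult insert_commute)

lemma odd_mono_base:
  assumes B: "B \<subseteq> {0,1}"
  shows "T \<subseteq> {2,3} \<Longrightarrow> odd_mono B \<odot> odd_mono T = odd_mono (B \<union> T)"
    "odd_mono (insert 2 B) \<odot> odd_mono {3} = odd_mono (insert 2 (insert 3 B))"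
    "T \<subseteq> {2,3} \<Longrightarrow> T \<noteq> {} \<Longrightarrow> odd_mono (insert 2 (insert 3 B)) \<odot> odd_mono T = 0"
proof -
  have fin: "finite B" using B by (auto intro: finite_subset)
  have ord: "odd_mono B \<odot> odd_mono T = odd_mono (B \<union> T)" if "T \<subseteq> {2,3}" for T
  proof (rule odd_mono_mult)
    have "s < t" if "s \<in> B" "t \<in> T" for s t
    proof -
      have "s < 2" "2 \<le> t" using that B \<open>T \<subseteq> {2,3}\<close> by auto
      then show ?thesis by simp
    qed
    then show "\<forall>s\<in>B. \<forall>t\<in>T. s < t" by blast
  qed (use fin finite_subset[OF that] in auto)
  have ord3: "odd_mono (insert 2 B) \<odot> odd_mono {3} = odd_mono (insert 2 (insert 3 B))"
  proof -
    have "odd_mono (insert 2 B) \<odot> odd_mono {3} = odd_mono B \<odot> odd_mono {2} \<odot> odd_mono {3}"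
      using ord[of "{2}"] by simp
    also have "\<dots> = odd_mono B \<odot> odd_mono {2,3}" by (simp only: smul_assoc theta_phi)
    finally show ?thesis using ord[of "{2,3}"] by simp
  qed
  have ov: "odd_mono (insert 2 (insert 3 B)) \<odot> odd_mono T = 0" if "T \<subseteq> {2,3}" "T \<noteq> {}" for T
    using that fin by (intro odd_mono_overlap) (auto intro: finite_subset)
  show "T \<subseteq> {2,3} \<Longrightarrow> odd_mono B \<odot> odd_mono T = odd_mono (B \<union> T)"
    "odd_mono (insert 2 B) \<odot> odd_mono {3} = odd_mono (insert 2 (insert 3 B))"
    "T \<subseteq> {2,3} \<Longrightarrow> T \<noteq> {} \<Longrightarrow> odd_mono (insert 2 (insert 3 B)) \<odot> odd_mono T = 0"
    by (fact ord ord3 ov)+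
qed

text \<open>The image of \<open>y2\<close> is a multiple of \<theta>\<phi>, which squares to zero
  and is killed by \<theta> and \<phi>. Hence a monomial containing \<open>y2\<close> survives only
  if it contains it once and no odd fibre coordinate.\<close>

lemma subst_component1:
  assumes "B \<subseteq> {0,1}" "P \<subseteq> {2,3}"
  shows "subst_monomial (component1 a) (k, l, B \<union> P) =
    (if l = 0 then odd_mono (B \<union> P) else if l = 1 \<and> P = {} then cmul (1 + a) (odd_mono (B \<union> {2,3})) else 0)"
proof -
  have fin: "finite B" using assms(1) by (auto intro: finite_subset)
  have B: "(B \<union> P) \<inter> {0,1} = B" using assms by fastforce
  have nB: "2 \<notin> B" "3 \<notin> B" using assms(1) by auto
  note ord = odd_mono_base[OF assms(1)]
  have "P = {} \<or> P = {2} \<or> P = {3} \<or> P = {2,3}" using assms(2) by auto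
  then show ?thesis
    unfolding subst_monomial.simps B
    by (elim disjE) (simp_all add: nB fin spow_one spow_cmul theta_phi spow_nilpotent smul_cmul_left smul_cmul_right
        ord)
qed

lemma subst_component2:
  assumes "B \<subseteq> {0,1}" "P \<subseteq> {2,3}"
  shows "subst_monomial (component2 a) (k, l, B \<union> P) =
    (if k = 0 then cmul (a ^ (2 * l + card P)) (odd_mono (B \<union> P))
     else if k = 1 \<and> P = {} then cmul (- (a ^ (2 * l))) (odd_mono (B \<union> {2,3})) else 0)"
proof -
  have fin: "finite B" using assms(1) by (auto intro: finite_subset)
  have B: "(B \<union> P) \<inter> {0,1} = B" using assms by fastforce
  have nB: "2 \<notin> B" "3 \<notin> B" using assms(1) by auto
  note ord = odd_mono_base[OF assms(1)]
  have "P = {} \<or> P = {2} \<or> P = {3} \<or> P = {2,3}" using assms(2) by auto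
  then show ?thesis
    unfolding subst_monomial.simps B
    by (elim disjE) (simp_all add: nB fin spow_one spow_cmul theta_phi spow_nilpotent smul_cmul_left smul_cmul_right
        ord power_mult power2_eq_square power_mult_distrib mult_ac)
qed

section \<open>Coefficients of the pullbacks to the two components\<close>

lemma finite_support:
  assumes "fibre_degree d F"
  shows "finite {m. F x m \<noteq> 0}"
proof (rule finite_subset)
  show "{m. F x m \<noteq> 0} \<subseteq> {..d} \<times> {..d} \<times> Pow {0,1,2,3}"
  proof
    fix m assume "m \<in> {m. F x m \<noteq> 0}"
    then show "m \<in> {..d} \<times> {..d} \<times> Pow {0,1,2,3}"
      using fibre_degreeD[OF assms, of x "fst m" "fst (snd m)" "snd (snd m)"] by (cases m) auto
  qed
qed simp

lemma Un_Int_base_fibre: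
  assumes "B \<subseteq> {0,1::nat}" "P \<subseteq> {2,3}"
  shows "(B \<union> P) \<inter> {0,1} = B" "(B \<union> P) \<inter> {2,3} = P"
proof -
  have "P \<inter> {0,1} = {}" using assms(2) by auto
  then show "(B \<union> P) \<inter> {0,1} = B" using assms(1) by blast
  have "B \<inter> {2,3} = {}" using assms(1) by auto
  then show "(B \<union> P) \<inter> {2,3} = P" using assms(2) by blast
qed

lemma Un_base_fibre_inj:
  assumes "B \<subseteq> {0,1::nat}" "P \<subseteq> {2,3}" "B' \<subseteq> {0,1}" "P' \<subseteq> {2,3}"
  shows "B \<union> P = B' \<union> P' \<longleftrightarrow> B = B' \<and> P = P'"
  by (metis Un_Int_base_fibre assms)

lemma split_base_fibre:
  assumes "S \<subseteq> {0,1,2,3::nat}"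
  obtains B P where "B \<subseteq> {0,1}" "P \<subseteq> {2,3}" "S = B \<union> P"
  using assms by (intro that[of "S \<inter> {0,1}" "S \<inter> {2,3}"]) auto

lemma pullback_outside:
  assumes "fibre_degree d F" "c = component1 a \<or> c = component2 a"
    and "\<not> (\<exists>S\<subseteq>{0,1,2,3}. m' = (0, 0, S))"
  shows "pullback c F x m' = 0"
  unfolding pullback_def
proof (rule sum.neutral, rule ballI)
  fix m assume m: "m \<in> {m. F x m \<noteq> 0}"
  obtain k l S where klS: "m = (k, l, S)" by (cases m)
  have "S \<subseteq> {0,1,2,3}" using m klS fibre_degreeD(1)[OF assms(1), of x k l S] by simp
  then obtain B P where BP: "B \<subseteq> {0,1}" "P \<subseteq> {2,3}" "S = B \<union> P" by (rule split_base_fibre)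
  have "B \<union> P \<subseteq> {0,1,2,3}" "B \<union> {2,3} \<subseteq> {0,1,2,3}" using BP by auto
  with assms(3) have "m' \<noteq> (0, 0, B \<union> P)" "m' \<noteq> (0, 0, B \<union> {2,3})" by blast+
  then have "subst_monomial c m x m' = 0"
    using assms(2) unfolding klS BP(3)
    by (elim disjE; simp only: subst_component1[OF BP(1,2)] subst_component2[OF BP(1,2)])
       (auto simp: monomial_def cmul_def)
  then show "F x m * subst_monomial c m x m' = 0" by simp
qed

text \<open>At most two monomials of fibre degree d map to the given one: the monomial without
  \<open>y2\<close>, and, for \<open>P = {2,3}\<close>, the one in which a single \<open>y2\<close>
  supplies \<theta>\<phi>. If \<open>card P > d\<close>, the truncated index
  \<open>d - card P\<close> is 0 and the coefficient there vanishes for reasons of degree.\<close>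

lemma pullback1_value:
  assumes F: "fibre_degree d F" and B: "B \<subseteq> {0,1}" and P: "P \<subseteq> {2,3}"
  shows "pullback (component1 a) F x (0, 0, B \<union> P) = F x (d - card P, 0, B \<union> P) +
    (if P = {2,3} \<and> d \<ge> 1 then (1 + a) * F x (d - 1, 1, B) else 0)"
proof -
  let ?M = "insert (d - card P, 0, B \<union> P) (if P = {2,3} \<and> d \<ge> 1 then {(d - 1, 1, B)} else {})"
  let ?g = "\<lambda>m. F x m * subst_monomial (component1 a) m x (0, 0, B \<union> P)"
  have "pullback (component1 a) F x (0, 0, B \<union> P) = sum ?g ?M"
    unfolding pullback_def
  proof (rule sum.mono_neutral_cong)
    show "finite {m. F x m \<noteq> 0}" by (rule finite_support[OF F])
    fix m assume m: "m \<in> {m. F x m \<noteq> 0} - ?M"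
    obtain k l S where klS: "m = (k, l, S)" by (cases m)
    have "S \<subseteq> {0,1,2,3}" using m klS fibre_degreeD(1)[OF F, of x k l S] by simp
    then obtain B' P' where BP: "B' \<subseteq> {0,1}" "P' \<subseteq> {2,3}" "S = B' \<union> P'" by (rule split_base_fibre)
    have d: "k + l + card P' = d"
      using m klS fibre_degreeD(2)[OF F, of x k l S] by (simp add: BP(3) Un_Int_base_fibre[OF BP(1,2)])
    have "subst_monomial (component1 a) m x (0, 0, B \<union> P) = 0"
    proof (cases "l = 0")
      case True
      have "B' \<union> P' \<noteq> B \<union> P"
      proof
        assume "B' \<union> P' = B \<union> P"
        moreover from this have "P' = P" using Un_base_fibre_inj[OF BP(1,2) B P] by simp
        ultimately have "m = (d - card P, 0, B \<union> P)" using d True klS BP(3) by simp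
        then show False using m by simp
      qed
      then show ?thesis unfolding klS BP(3) subst_component1[OF BP(1,2)] using True
        by (simp add: monomial_def)
    next
      case l: False
      show ?thesis
      proof (cases "l = 1 \<and> P' = {}")
        case True
        have "B' \<union> {2,3} \<noteq> B \<union> P"
        proof
          assume "B' \<union> {2,3} = B \<union> P"
          then have "B' = B" "P = {2,3}" using Un_base_fibre_inj[OF BP(1) subset_refl B P] by simp_all
          then have "m = (d - 1, 1, B)" "d \<ge> 1" "P = {2,3}" using d True klS BP(3) by auto
          then show False using m by simp
        qed
        then show ?thesis unfolding klS BP(3) subst_component1[OF BP(1,2)] using True
          by (simp add: monomial_def cmul_def)
      next
        case False
        then show ?thesis unfolding klS BP(3) subst_component1[OF BP(1,2)] using l by auto
      qed
    qed
    then show "?g m = 0" by simp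
  qed auto
  also have "\<dots> = F x (d - card P, 0, B \<union> P) +
    (if P = {2,3} \<and> d \<ge> 1 then (1 + a) * F x (d - 1, 1, B) else 0)"
    using subst_component1[OF B P, of a "d - card P" 0] subst_component1[OF B empty_subsetI, of a "d - 1" 1]
    by (simp add: monomial_def cmul_def)
  finally show ?thesis .
qed

text \<open>The powers of a come from \<open>y2 = a^2\<close>, \<open>\<zeta>2 = a \<tau>\<close>
  and \<open>\<zeta>3 = a \<nu>\<close>. For \<open>P = {2,3}\<close> and d at least 2 the two terms
  carry the same power \<open>a ^ (2 * (d - 1))\<close>, which is why the resulting condition does
  not contain a.\<close>

lemma pullback2_value:
  assumes F: "fibre_degree d F" and B: "B \<subseteq> {0,1}" and P: "P \<subseteq> {2,3}"
  shows "pullback (component2 a) F x (0, 0, B \<union> P) =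
    a ^ (2 * (d - card P) + card P) * F x (0, d - card P, B \<union> P) -
    (if P = {2,3} \<and> d \<ge> 1 then a ^ (2 * (d - 1)) * F x (1, d - 1, B) else 0)"
proof -
  let ?M = "insert (0, d - card P, B \<union> P) (if P = {2,3} \<and> d \<ge> 1 then {(1, d - 1, B)} else {})"
  let ?g = "\<lambda>m. F x m * subst_monomial (component2 a) m x (0, 0, B \<union> P)"
  have "pullback (component2 a) F x (0, 0, B \<union> P) = sum ?g ?M"
    unfolding pullback_def
  proof (rule sum.mono_neutral_cong)
    show "finite {m. F x m \<noteq> 0}" by (rule finite_support[OF F])
    fix m assume m: "m \<in> {m. F x m \<noteq> 0} - ?M"
    obtain k l S where klS: "m = (k, l, S)" by (cases m)
    have "S \<subseteq> {0,1,2,3}" using m klS fibre_degreeD(1)[OF F, of x k l S] by simp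
    then obtain B' P' where BP: "B' \<subseteq> {0,1}" "P' \<subseteq> {2,3}" "S = B' \<union> P'" by (rule split_base_fibre)
    have d: "k + l + card P' = d"
      using m klS fibre_degreeD(2)[OF F, of x k l S] by (simp add: BP(3) Un_Int_base_fibre[OF BP(1,2)])
    have "subst_monomial (component2 a) m x (0, 0, B \<union> P) = 0"
    proof (cases "k = 0")
      case True
      have "B' \<union> P' \<noteq> B \<union> P"
      proof
        assume "B' \<union> P' = B \<union> P"
        moreover from this have "P' = P" using Un_base_fibre_inj[OF BP(1,2) B P] by simp
        ultimately have "m = (0, d - card P, B \<union> P)" using d True klS BP(3) by simp
        then show False using m by simp
      qed
      then show ?thesis unfolding klS BP(3) subst_component2[OF BP(1,2)] using True
        by (simp add: monomial_def cmul_def)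
    next
      case k: False
      show ?thesis
      proof (cases "k = 1 \<and> P' = {}")
        case True
        have "B' \<union> {2,3} \<noteq> B \<union> P"
        proof
          assume "B' \<union> {2,3} = B \<union> P"
          then have "B' = B" "P = {2,3}" using Un_base_fibre_inj[OF BP(1) subset_refl B P] by simp_all
          then have "m = (1, d - 1, B)" "d \<ge> 1" "P = {2,3}" using d True klS BP(3) by auto
          then show False using m by simp
        qed
        then show ?thesis unfolding klS BP(3) subst_component2[OF BP(1,2)] using True
          by (simp add: monomial_def cmul_def)
      next
        case False
        then show ?thesis unfolding klS BP(3) subst_component2[OF BP(1,2)] using k by auto
      qed
    qed
    then show "?g m = 0" by simp
  qed auto
  also have "\<dots> = a ^ (2 * (d - card P) + card P) * F x (0, d - card P, B \<union> P) -
    (if P = {2,3} \<and> d \<ge> 1 then a ^ (2 * (d - 1)) * F x (1, d - 1, B) else 0)"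
    using subst_component2[OF B P, of a 0 "d - card P"] subst_component2[OF B empty_subsetI, of a 1 "d - 1"]
    by (simp add: monomial_def cmul_def mult.commute)
  finally show ?thesis .
qed

text \<open>
  The conditions found by substituting the two parametrizations.  The indices are shifted so that no
  truncated subtraction occurs; in degree 1 the last two conditions are void and the coefficient of
  \<open>y\<^sub>2\<close> is killed by the second one.
\<close>

definition cone_coeffs :: "complex \<Rightarrow> sfun \<Rightarrow> bool" where
  "cone_coeffs a F \<longleftrightarrow> (\<forall>x k l. \<forall>B\<subseteq>{0,1}.
     F x (k, 0, B) = 0 \<and> F x (0, l, B) = 0 \<and>
     F x (k, 0, B \<union> {2}) = 0 \<and> F x (k, 0, B \<union> {3}) = 0 \<and>
     F x (0, l, B \<union> {2}) = 0 \<and> F x (0, l, B \<union> {3}) = 0 \<and>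
     (1 + a) * F x (Suc k, 1, B) + F x (k, 0, B \<union> {2,3}) = 0 \<and>
     F x (1, Suc l, B) - F x (0, l, B \<union> {2,3}) = 0)"

text \<open>Coefficients of the wrong degree are zero, so the conditions may range over all k and l
  without reference to d. Since a \<noteq> 0, the powers of a from the second component
  cancel.\<close>

lemma vanishes_iff_cone_coeffs:
  assumes F: "fibre_degree d F" and a: "a \<noteq> 0"
  shows "vanishes_on_cone a F \<longleftrightarrow> cone_coeffs a F"
proof -
  have deg: "F x (k, l, B \<union> P) = 0" if "k + l + card P \<noteq> d" "B \<subseteq> {0,1}" "P \<subseteq> {2,3}" for x k l B P
    using fibre_degreeD(2)[OF F, of x k l "B \<union> P"] that by (auto simp: Un_Int_base_fibre)
  note deg0 = deg[where P = "{}", simplified] and deg2 = deg[where P = "{2,3}", simplified]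
  have van: "vanishes_on_cone a F \<longleftrightarrow> (\<forall>x B P. B \<subseteq> {0,1} \<longrightarrow> P \<subseteq> {2,3} \<longrightarrow>
      pullback (component1 a) F x (0, 0, B \<union> P) = 0 \<and> pullback (component2 a) F x (0, 0, B \<union> P) = 0)"
    (is "_ \<longleftrightarrow> ?R")
  proof
    assume "vanishes_on_cone a F"
    then show ?R by (simp add: vanishes_on_cone_def)
  next
    assume R: ?R
    have "pullback c F x m = 0" if "c = component1 a \<or> c = component2 a" for c x m
    proof (cases "\<exists>S\<subseteq>{0,1,2,3}. m = (0, 0, S)")
      case True
      then obtain B P where "B \<subseteq> {0,1}" "P \<subseteq> {2,3}" "m = (0, 0, B \<union> P)"
        using split_base_fibre by metis
      with R that show ?thesis by blast
    next
      case False
      then show ?thesis by (rule pullback_outside[OF F that])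
    qed
    then show "vanishes_on_cone a F" unfolding vanishes_on_cone_def by (intro conjI ext) auto
  qed
  show ?thesis
  proof
    assume "vanishes_on_cone a F"
    then have v: "pullback (component1 a) F x (0, 0, B \<union> P) = 0" "pullback (component2 a) F x (0, 0, B \<union> P) = 0"
      if "B \<subseteq> {0,1}" "P \<subseteq> {2,3}" for x B P
      using van that by blast+
    have c1: "F x (k, 0, B \<union> P) = 0" if "B \<subseteq> {0,1}" "P \<subseteq> {2,3}" "P \<noteq> {2,3}" for x k B P
    proof (cases "k + card P = d")
      case True
      then have "d - card P = k" by auto
      then show ?thesis using v(1)[OF that(1,2), of x] that(3)
        by (simp only: pullback1_value[OF F that(1,2)]) simp
    next
      case False
      then show ?thesis using deg[of k 0 P B x] that by simp
    qed
    have c2: "F x (0, l, B \<union> P) = 0" if "B \<subseteq> {0,1}" "P \<subseteq> {2,3}" "P \<noteq> {2,3}" for x l B P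
    proof (cases "l + card P = d")
      case True
      then have "d - card P = l" by auto
      then show ?thesis using v(2)[OF that(1,2), of x] that(3) a
        by (simp only: pullback2_value[OF F that(1,2)]) simp
    next
      case False
      then show ?thesis using deg[of 0 l P B x] that by simp
    qed
    have c3: "(1 + a) * F x (Suc k, 1, B) + F x (k, 0, B \<union> {2,3}) = 0" if B: "B \<subseteq> {0,1}" for x k B
    proof (cases "k + 2 = d")
      case True
      then have d: "d = Suc (Suc k)" by simp
      then show ?thesis using v(1)[OF B subset_refl, of x, unfolded pullback1_value[OF F B subset_refl]]
        by (simp add: d add.commute)
    next
      case False
      then show ?thesis using deg0[of "Suc k" 1 B x] deg2[of k 0 B x] B by simp
    qed
    have c4: "F x (1, Suc l, B) - F x (0, l, B \<union> {2,3}) = 0" if B: "B \<subseteq> {0,1}" for x l B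
    proof (cases "l + 2 = d")
      case True
      then have d: "d = Suc (Suc l)" by simp
      then show ?thesis using v(2)[OF B subset_refl, of x, unfolded pullback2_value[OF F B subset_refl]] a
        by (simp add: d)
    next
      case False
      then show ?thesis using deg0[of 1 "Suc l" B x] deg2[of 0 l B x] B by simp
    qed
    show "cone_coeffs a F"
      unfolding cone_coeffs_def
      using c1[where P = "{}"] c1[where P = "{2}"] c1[where P = "{3}"]
        c2[where P = "{}"] c2[where P = "{2}"] c2[where P = "{3}"] c3 c4
      by simp
  next
    assume "cone_coeffs a F"
    then have c: "F x (k, 0, B) = 0" "F x (0, l, B) = 0"
      "F x (k, 0, B \<union> {2}) = 0" "F x (k, 0, B \<union> {3}) = 0"
      "F x (0, l, B \<union> {2}) = 0" "F x (0, l, B \<union> {3}) = 0"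
      "(1 + a) * F x (Suc k, 1, B) + F x (k, 0, B \<union> {2,3}) = 0"
      "F x (1, Suc l, B) - F x (0, l, B \<union> {2,3}) = 0" if "B \<subseteq> {0,1}" for x k l B
      using that unfolding cone_coeffs_def by blast+
    have "pullback (component1 a) F x (0, 0, B \<union> P) = 0 \<and> pullback (component2 a) F x (0, 0, B \<union> P) = 0"
      if B: "B \<subseteq> {0,1}" and P: "P \<subseteq> {2,3}" for x B P
    proof (cases "P = {2,3}")
      case False
      then have "P = {} \<or> P = {2} \<or> P = {3}" using P by auto
      then show ?thesis using False c[OF B]
        unfolding pullback1_value[OF F B P] pullback2_value[OF F B P] by (elim disjE) simp_all
    next
      case True
      show ?thesis
      proof (cases "d \<ge> 2")
        case d: True
        define k where "k = d - 2"
        have k: "d = Suc (Suc k)" using d by (simp add: k_def)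
        show ?thesis using True c(7,8)[OF B, of x k]
          unfolding pullback1_value[OF F B P] pullback2_value[OF F B P] by (simp add: k add.commute)
      next
        case False
        then have "F x (k, l, B \<union> {2,3}) = 0" for k l using deg2[of k l B x] B by auto
        moreover have "d - 1 = 0" "d \<ge> 1 \<Longrightarrow> d = 1" using False by auto
        ultimately show ?thesis using True c(1,2)[OF B, of x d]
          unfolding pullback1_value[OF F B P] pullback2_value[OF F B P] by auto
      qed
    qed
    then show "vanishes_on_cone a F" by (intro van[THEN iffD2] allI impI)
  qed
qed

section \<open>The lift as a first-order operator on fibres\<close>

text \<open>
  Moving the fibre coordinate \<open>y\<^sub>i\<close> to the right of \<open>\<partial>\<^sub>i(X j)\<close> in \<^const>\<open>lift_coord\<close> produces the sign
  \<open>(-1)\<^sup>|\<^sup>i\<^sup>|\<^sup>|\<^sup>S\<^sup>|\<close>.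
\<close>

definition lift_matrix :: "vfield \<Rightarrow> coord \<Rightarrow> coord \<Rightarrow> sfun" where
  "lift_matrix X i j = (\<lambda>x (k, l, S). (-1) ^ (par i + par j + par i * card S) * d_base i (X j) x (k, l, S))"

definition fibre_op :: "coord \<Rightarrow> coord \<Rightarrow> sfun \<Rightarrow> sfun" where
  "fibre_op i j F = fibre_coord i \<odot> d_fibre j F"

lemma koszul_full:
  assumes "\<And>t u. t \<in> T \<Longrightarrow> u \<in> U \<Longrightarrow> u < t"
  shows "koszul T U = (-1) ^ (card T * card U)"
proof -
  have "{(t, u). t \<in> T \<and> u \<in> U \<and> u < t} = T \<times> U" using assms by blast
  then show ?thesis unfolding koszul_def by (simp only: card_cartesian_product)
qed

lemma base_lt_fibre: "t \<in> {0,1} \<Longrightarrow> u \<in> {2,3} \<Longrightarrow> t < (u::nat)"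
  by auto

text \<open>Brings base coefficients to the left of fibre monomials, the position in which
  \<open>base_smul_Un\<close> describes the product; the sign is that of moving
  \<open>card E\<close> odd factors past \<open>card S\<close> others.\<close>

lemma fibre_monomial_commute:
  assumes b: "fibre_degree 0 b" and E: "E \<subseteq> {2,3}"
  shows "monomial (p, q, E) \<odot> b =
    (\<lambda>x (k, l, S). (-1) ^ (card E * card S) * b x (k, l, S)) \<odot> monomial (p, q, E)"
proof (intro ext)
  fix x and m :: smono
  obtain k l S where m: "m = (k, l, S)" by (cases m)
  let ?b = "\<lambda>x (k, l, S). (-1) ^ (card E * card S) * b x (k, l, S)"
  have b': "fibre_degree 0 ?b"
  proof (rule fibre_degreeI)
    fix x k l S assume "?b x (k, l, S) \<noteq> 0"
    then have "b x (k, l, S) \<noteq> 0" by auto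
    then show "S \<subseteq> {0,1,2,3} \<and> k + l + card (S \<inter> {2,3}) = 0"
      using fibre_degreeD[OF b, of x k l S] by blast
  qed
  show "(monomial (p, q, E) \<odot> b) x m = (?b \<odot> monomial (p, q, E)) x m"
  proof (cases "finite S")
    case False
    then show ?thesis by (simp add: m smul_infinite)
  next
    case True
    show ?thesis
    proof (cases "k = p \<and> l = q \<and> E \<subseteq> S \<and> S - E \<subseteq> {0,1}")
      case eq: True
      define B where "B = S - E"
      have B: "B \<subseteq> {0,1}" "S = B \<union> E" using eq by (auto simp: B_def)
      have EB: "S - E = B" by (simp add: B_def)
      have lt: "t < u" if "t \<in> B" "u \<in> E" for t u
        using base_lt_fibre[of t u] that B(1) E by blast
      have "(?b \<odot> monomial (p, q, E)) x m = (\<Sum>T\<in>Pow B. if T = B then koszul B E * ?b x (0, 0, B) else 0)"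
        unfolding m B(2) base_smul_Un[OF b' B(1) E]
      proof (rule sum.cong[OF refl])
        fix T assume T: "T \<in> Pow B"
        have "B - T \<union> E = E \<longleftrightarrow> T = B"
          using T Un_base_fibre_inj[of "B - T" E "{}" E] B(1) E by auto
        then show "koszul T (B - T) * ?b x (0, 0, T) * monomial (p, q, E) x (k, l, B - T \<union> E) =
            (if T = B then koszul B E * ?b x (0, 0, B) else 0)"
          using eq by (auto simp: monomial_def koszul_eq_1[of B E, OF lt])
      qed
      also have "\<dots> = koszul B E * ?b x (0, 0, B)"
        using B(1) finite_subset[OF B(1)] by (simp add: sum.delta)
      also have "\<dots> = koszul E B * b x (0, 0, B)"
        by (simp add: koszul_eq_1[of B E, OF lt] koszul_full[of E B, OF lt])
      also have "\<dots> = (monomial (p, q, E) \<odot> b) x m"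
        unfolding m monomial_smul[OF True] using eq EB by simp
      finally show ?thesis by simp
    next
      case neq: False
      have "(monomial (p, q, E) \<odot> b) x m = 0"
      proof (rule ccontr)
        assume "(monomial (p, q, E) \<odot> b) x m \<noteq> 0"
        then have le: "p \<le> k" "q \<le> l" "E \<subseteq> S" and nz: "b x (k - p, l - q, S - E) \<noteq> 0"
          unfolding m monomial_smul[OF True] by (auto split: if_splits)
        have "k - p + (l - q) + card ((S - E) \<inter> {2,3}) = 0" "S - E \<subseteq> {0,1,2,3}"
          using fibre_degreeD[OF b nz] by blast+
        moreover from this have "(S - E) \<inter> {2,3} = {}" by (auto simp: card_eq_0_iff)
        ultimately have "k = p" "l = q" "S - E \<subseteq> {0,1}" using le by auto
        with le neq show False by blast
      qed
      moreover have "(?b \<odot> monomial (p, q, E)) x m = 0"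
        unfolding m base_smul[OF b' True]
      proof (rule sum.neutral, rule ballI)
        fix T assume "T \<in> Pow (S \<inter> {0,1})"
        then have "\<not> ((k, l, S - T) = (p, q, E))" using neq by auto
        then have "monomial (p, q, E) x (k, l, S - T) = 0" unfolding monomial_def by (rule if_not_P)
        then show "koszul T (S - T) * ?b x (0, 0, T) * monomial (p, q, E) x (k, l, S - T) = 0"
          by (simp only: mult_zero_right)
      qed
      ultimately show ?thesis by simp
    qed
  qed
qed

lemma fibre_degree_d_base:
  assumes "fibre_degree d F" shows "fibre_degree d (d_base i F)"
proof (rule fibre_degreeI)
  fix x k l S assume nz: "d_base i F x (k, l, S) \<noteq> 0"
  have ev: "S \<subseteq> {0,1,2,3} \<and> k + l + card (S \<inter> {2,3}) = d" if "\<exists>x. F x (k, l, S) \<noteq> 0"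
    using that fibre_degreeD[OF assms, of _ k l S] by blast
  have od: "S \<subseteq> {0,1,2,3} \<and> k + l + card (S \<inter> {2,3}) = d" if "n \<in> {0,1}" "F x (k, l, insert n S) \<noteq> 0" for n
  proof -
    have "insert n S \<inter> {2,3} = S \<inter> {2,3}" using that(1) by auto
    then show ?thesis using fibre_degreeD[OF assms that(2)] by simp
  qed
  show "S \<subseteq> {0,1,2,3} \<and> k + l + card (S \<inter> {2,3}) = d"
  proof (cases i)
    case Ev1
    have "\<exists>x. F x (k, l, S) \<noteq> 0"
    proof (rule ccontr)
      assume "\<not> ?thesis" then have "F y (k, l, S) = 0" for y by blast
      with nz Ev1 show False by simp
    qed
    then show ?thesis by (rule ev)
  next
    case Ev2
    have "\<exists>x. F x (k, l, S) \<noteq> 0"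
    proof (rule ccontr)
      assume "\<not> ?thesis" then have "F y (k, l, S) = 0" for y by blast
      with nz Ev2 show False by simp
    qed
    then show ?thesis by (rule ev)
  next
    case Od1
    then show ?thesis using nz od[of 0] by (auto simp: d_odd_def split: if_splits)
  next
    case Od2
    then show ?thesis using nz od[of 1] by (auto simp: d_odd_def split: if_splits)
  qed
qed

lemma fibre_degree_lift_matrix:
  assumes "vector_field X" shows "fibre_degree 0 (lift_matrix X i j)"
proof (rule fibre_degreeI)
  fix x k l S assume "lift_matrix X i j x (k, l, S) \<noteq> 0"
  then have "d_base i (X j) x (k, l, S) \<noteq> 0" by (simp add: lift_matrix_def)
  moreover have "fibre_degree 0 (d_base i (X j))"
    using assms by (intro fibre_degree_d_base) (simp add: vector_field_def fibre_form_iff)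
  ultimately show "S \<subseteq> {0,1,2,3} \<and> k + l + card (S \<inter> {2,3}) = 0"
    using fibre_degreeD[of 0 "d_base i (X j)" x k l S] by blast
qed

lemma lift_eq:
  assumes "vector_field X"
  shows "lift X F = vf_apply X F + (\<Sum>j\<in>UNIV. \<Sum>i\<in>UNIV. lift_matrix X i j \<odot> fibre_op i j F)"
proof -
  have "cmul ((-1) ^ (par i + par j)) (fibre_coord i \<odot> d_base i (X j)) = lift_matrix X i j \<odot> fibre_coord i" for i j
  proof -
    have b: "fibre_degree 0 (d_base i (X j))"
      using assms by (intro fibre_degree_d_base) (simp add: vector_field_def fibre_form_iff)
    have m: "lift_matrix X i j = cmul ((-1) ^ (par i + par j))
        (\<lambda>x (k, l, S). (-1) ^ (par i * card S) * d_base i (X j) x (k, l, S))"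
      by (auto simp: lift_matrix_def cmul_def power_add fun_eq_iff)
    obtain p q E where e: "fibre_coord i = monomial (p, q, E)" "E \<subseteq> {2,3}" "card E = par i"
    proof (cases i)
      case Ev1 then show ?thesis by (intro that[of 1 0 "{}"]) simp_all
    next
      case Ev2 then show ?thesis by (intro that[of 0 1 "{}"]) simp_all
    next
      case Od1 then show ?thesis by (intro that[of 0 0 "{2}"]) simp_all
    next
      case Od2 then show ?thesis by (intro that[of 0 0 "{3}"]) simp_all
    qed
    show ?thesis
      unfolding m e(1) smul_cmul_left fibre_monomial_commute[OF b e(2)] e(3) ..
  qed
  then show ?thesis
    unfolding lift_def lift_coord_def fibre_op_def smul_sum_left by (simp only: smul_assoc)
qed

lemma holomorphic2_partial:
  assumes "holomorphic2 f"
  shows "(\<lambda>t. f (t, y)) field_differentiable (at z)" "(\<lambda>t. f (y, t)) field_differentiable (at z)"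
proof -
  obtain A B where 1: "(f has_derivative (\<lambda>h. A * fst h + B * snd h)) (at (z, y))"
    using assms unfolding holomorphic2_def by blast
  have "((\<lambda>t. (t, y)) has_derivative (\<lambda>t. (t, 0))) (at z)" by (auto intro!: derivative_eq_intros)
  from has_derivative_compose[OF this 1] have "((\<lambda>t. f (t, y)) has_derivative (\<lambda>t. A * t)) (at z)"
    by simp
  then show "(\<lambda>t. f (t, y)) field_differentiable (at z)"
    unfolding field_differentiable_def has_field_derivative_def by (rule exI[of _ A])
  obtain A B where 2: "(f has_derivative (\<lambda>h. A * fst h + B * snd h)) (at (y, z))"
    using assms unfolding holomorphic2_def by blast
  have "((\<lambda>t. (y, t)) has_derivative (\<lambda>t. (0, t))) (at z)" by (auto intro!: derivative_eq_intros)
  from has_derivative_compose[OF this 2] have "((\<lambda>t. f (y, t)) has_derivative (\<lambda>t. B * t)) (at z)"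
    by simp
  then show "(\<lambda>t. f (y, t)) field_differentiable (at z)"
    unfolding field_differentiable_def has_field_derivative_def by (rule exI[of _ B])
qed

section \<open>Operations that preserve the cone conditions\<close>

lemma cone_coeffs_iff:
  "cone_coeffs a F \<longleftrightarrow> (\<forall>x B. B \<subseteq> {0,1} \<longrightarrow>
     (\<forall>k. F x (k, 0, B) = 0) \<and> (\<forall>l. F x (0, l, B) = 0) \<and>
     (\<forall>k. F x (k, 0, insert 2 B) = 0) \<and> (\<forall>k. F x (k, 0, insert 3 B) = 0) \<and>
     (\<forall>l. F x (0, l, insert 2 B) = 0) \<and> (\<forall>l. F x (0, l, insert 3 B) = 0) \<and>
     (\<forall>k. F x (k, 0, insert 2 (insert 3 B)) = - (1 + a) * F x (Suc k, 1, B)) \<and>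
     (\<forall>l. F x (0, l, insert 2 (insert 3 B)) = F x (1, Suc l, B)))"
proof -
  have e: "b + c = 0 \<longleftrightarrow> c = - b" "b - c = 0 \<longleftrightarrow> c = b" for b c :: complex
    by (auto simp: add_eq_0_iff)
  have "(\<forall>x k l B. Q B \<longrightarrow> P1 x k B \<and> P2 x l B \<and> P3 x k B \<and> P4 x k B \<and> P5 x l B \<and> P6 x l B \<and> P7 x k B \<and> P8 x l B)
    \<longleftrightarrow> (\<forall>x B. Q B \<longrightarrow> (\<forall>k. P1 x k B) \<and> (\<forall>l. P2 x l B) \<and> (\<forall>k. P3 x k B) \<and> (\<forall>k. P4 x k B) \<and>
      (\<forall>l. P5 x l B) \<and> (\<forall>l. P6 x l B) \<and> (\<forall>k. P7 x k B) \<and> (\<forall>l. P8 x l B))" for Q P1 P2 P3 P4 P5 P6 P7 P8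
    by blast
  then show ?thesis
    unfolding cone_coeffs_def Un_insert_right Un_empty_right e mult_minus_left .
qed

lemma cone_coeffsD:
  assumes "cone_coeffs a F" "B \<subseteq> {0,1}"
  shows "F x (k, 0, B) = 0" "F x (0, l, B) = 0" "F x (k, 0, insert 2 B) = 0" "F x (k, 0, insert 3 B) = 0"
    "F x (0, l, insert 2 B) = 0" "F x (0, l, insert 3 B) = 0"
    "F x (k, 0, insert 2 (insert 3 B)) = - (1 + a) * F x (Suc k, 1, B)"
    "F x (0, l, insert 2 (insert 3 B)) = F x (1, Suc l, B)"
  using assms(1)[unfolded cone_coeffs_iff, THEN spec, THEN spec, THEN mp, OF assms(2), of x] by simp_all

lemma cone_coeffsI:
  assumes "\<And>x k B. B \<subseteq> {0,1} \<Longrightarrow> F x (k, 0, B) = 0" "\<And>x l B. B \<subseteq> {0,1} \<Longrightarrow> F x (0, l, B) = 0"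
    "\<And>x k B. B \<subseteq> {0,1} \<Longrightarrow> F x (k, 0, insert 2 B) = 0" "\<And>x k B. B \<subseteq> {0,1} \<Longrightarrow> F x (k, 0, insert 3 B) = 0"
    "\<And>x l B. B \<subseteq> {0,1} \<Longrightarrow> F x (0, l, insert 2 B) = 0" "\<And>x l B. B \<subseteq> {0,1} \<Longrightarrow> F x (0, l, insert 3 B) = 0"
    "\<And>x k B. B \<subseteq> {0,1} \<Longrightarrow> F x (k, 0, insert 2 (insert 3 B)) = - (1 + a) * F x (Suc k, 1, B)"
    "\<And>x l B. B \<subseteq> {0,1} \<Longrightarrow> F x (0, l, insert 2 (insert 3 B)) = F x (1, Suc l, B)"
  shows "cone_coeffs a F"
  unfolding cone_coeffs_iff by (intro allI impI conjI; rule assms; assumption)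

lemma fibre_mult_values:
  assumes B: "B \<subseteq> {0,1}"
  shows "(odd_mono {2} \<odot> G) x (k, l, B) = 0" "(odd_mono {3} \<odot> G) x (k, l, B) = 0"
    "(odd_mono {2} \<odot> G) x (k, l, insert 2 B) = (-1) ^ card B * G x (k, l, B)"
    "(odd_mono {3} \<odot> G) x (k, l, insert 2 B) = 0"
    "(odd_mono {2} \<odot> G) x (k, l, insert 3 B) = 0"
    "(odd_mono {3} \<odot> G) x (k, l, insert 3 B) = (-1) ^ card B * G x (k, l, B)"
    "(odd_mono {2} \<odot> G) x (k, l, insert 2 (insert 3 B)) = (-1) ^ card B * G x (k, l, insert 3 B)"
    "(odd_mono {3} \<odot> G) x (k, l, insert 2 (insert 3 B)) = - ((-1) ^ card B) * G x (k, l, insert 2 B)"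
proof -
  have fin: "finite B" using B by (rule finite_subset) simp
  have nB: "2 \<notin> B" "3 \<notin> B" using B by auto
  have lt: "u < 2" "u < 3" if "u \<in> B" for u using that B by auto
  have k: "koszul {2} B = (-1) ^ card B" "koszul {3} B = (-1) ^ card B"
    using koszul_full[of "{2}" B] koszul_full[of "{3}" B] lt by auto
  have "koszul {3} (insert 2 B) = (-1) ^ (card {3::nat} * card (insert 2 B))"
    by (rule koszul_full) (use lt in auto)
  then have k3: "koszul {3} (insert 2 B) = - ((-1) ^ card B)" using fin nB by simp
  have "koszul {2} ({3} \<union> B) = koszul {2} {3} * koszul {2} B"
    using fin nB by (intro koszul_Un_right) auto
  moreover have "koszul {2} {3} = 1" by (rule koszul_eq_1) simp
  ultimately have k2: "koszul {2} (insert 3 B) = (-1) ^ card B" using k by simp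
  have D: "insert 2 B - {2} = B" "insert 3 B - {3} = B" "insert 2 (insert 3 B) - {2} = insert 3 B"
    "insert 2 (insert 3 B) - {3} = insert 2 B" using nB by auto
  show "(odd_mono {2} \<odot> G) x (k, l, B) = 0" "(odd_mono {3} \<odot> G) x (k, l, B) = 0"
    "(odd_mono {2} \<odot> G) x (k, l, insert 2 B) = (-1) ^ card B * G x (k, l, B)"
    "(odd_mono {3} \<odot> G) x (k, l, insert 2 B) = 0"
    "(odd_mono {2} \<odot> G) x (k, l, insert 3 B) = 0"
    "(odd_mono {3} \<odot> G) x (k, l, insert 3 B) = (-1) ^ card B * G x (k, l, B)"
    "(odd_mono {2} \<odot> G) x (k, l, insert 2 (insert 3 B)) = (-1) ^ card B * G x (k, l, insert 3 B)"
    "(odd_mono {3} \<odot> G) x (k, l, insert 2 (insert 3 B)) = - ((-1) ^ card B) * G x (k, l, insert 2 B)"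
    by (simp_all add: monomial_smul fin D k k2 k3 nB)
qed

lemma d_odd_values:
  assumes B: "B \<subseteq> {0,1}"
  shows "d_odd 2 F x (k, l, B) = (-1) ^ card B * F x (k, l, insert 2 B)"
    "d_odd 3 F x (k, l, B) = (-1) ^ card B * F x (k, l, insert 3 B)"
    "d_odd 2 F x (k, l, insert 2 B) = 0"
    "d_odd 3 F x (k, l, insert 2 B) = - ((-1) ^ card B) * F x (k, l, insert 2 (insert 3 B))"
    "d_odd 2 F x (k, l, insert 3 B) = (-1) ^ card B * F x (k, l, insert 2 (insert 3 B))"
    "d_odd 3 F x (k, l, insert 3 B) = 0"
    "d_odd 2 F x (k, l, insert 2 (insert 3 B)) = 0"
    "d_odd 3 F x (k, l, insert 2 (insert 3 B)) = 0"
proof -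
  have fin: "finite B" using B by (rule finite_subset) simp
  have nB: "2 \<notin> B" "3 \<notin> B" using B by auto
  have lt: "u < 2" "u < 3" if "u \<in> B" for u using that B by auto
  have s: "{s \<in> B. s < 2} = B" "{s \<in> B. s < 3} = B" "{s. s = 3 \<and> s < 2 \<or> s \<in> B \<and> s < 2} = B"
    "{s. (s = 2 \<or> s \<in> B) \<and> s < 3} = insert 2 B" "{s. (s = 3 \<or> s \<in> B) \<and> s < 2} = B"
    using lt by auto
  show "d_odd 2 F x (k, l, B) = (-1) ^ card B * F x (k, l, insert 2 B)"
    "d_odd 3 F x (k, l, B) = (-1) ^ card B * F x (k, l, insert 3 B)"
    "d_odd 2 F x (k, l, insert 2 B) = 0"
    "d_odd 3 F x (k, l, insert 2 B) = - ((-1) ^ card B) * F x (k, l, insert 2 (insert 3 B))"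
    "d_odd 2 F x (k, l, insert 3 B) = (-1) ^ card B * F x (k, l, insert 2 (insert 3 B))"
    "d_odd 3 F x (k, l, insert 3 B) = 0"
    "d_odd 2 F x (k, l, insert 2 (insert 3 B)) = 0"
    "d_odd 3 F x (k, l, insert 2 (insert 3 B)) = 0"
    by (simp_all add: d_odd_def nB s fin insert_commute)
qed

lemma even_mult_values:
  assumes "finite S"
  shows "(monomial (Suc 0, 0, {}) \<odot> G) x (0, l, S) = 0"
    "(monomial (Suc 0, 0, {}) \<odot> G) x (Suc k, l, S) = G x (k, l, S)"
    "(monomial (0, Suc 0, {}) \<odot> G) x (k, 0, S) = 0"
    "(monomial (0, Suc 0, {}) \<odot> G) x (k, Suc l, S) = G x (k, l, S)"
  using assms by (simp_all add: monomial_smul)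

lemma sign_square: "(-1) ^ n * ((-1) ^ n * z) = (z::complex)"
  by (simp flip: mult.assoc power_add)

text \<open>Nine generators of the stabilizer of the cone in \<open>\<gg>\<ll>(2|2)\<close>, applied to \<open>F\<close>.\<close>

definition fibre_ops :: "complex \<Rightarrow> sfun \<Rightarrow> sfun set" where
  "fibre_ops a F = {fibre_op Ev1 Ev1 F + fibre_op Od2 Od2 F, fibre_op Ev2 Ev2 F + fibre_op Od2 Od2 F,
     fibre_op Od1 Od1 F - fibre_op Od2 Od2 F, fibre_op Od1 Od2 F, fibre_op Od2 Od1 F,
     fibre_op Ev1 Od1 F + cmul (1 + a) (fibre_op Od2 Ev2 F),
     fibre_op Ev1 Od2 F - cmul (1 + a) (fibre_op Od1 Ev2 F),
     fibre_op Ev2 Od1 F - fibre_op Od2 Ev1 F, fibre_op Ev2 Od2 F + fibre_op Od1 Ev1 F}"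

text \<open>The first five generators multiply both quadrics
  \<open>y1 y2 - (1 + a) \<zeta>2 \<zeta>3\<close> and \<open>y1 y2 + \<zeta>2 \<zeta>3\<close> by
  the same scalar. The next two annihilate the first quadric and send the second to multiples of
  \<open>y1 \<zeta>2\<close> or \<open>y1 \<zeta>3\<close>, which vanish on the second component;
  for the last two the roles are exchanged. The proof checks the conditions coefficient by
  coefficient, splitting off exponent 0 because multiplication by an even coordinate shifts
  exponents.\<close>

lemma cone_coeffs_fibre_ops:
  assumes F: "cone_coeffs a F" and G: "G \<in> fibre_ops a F"
  shows "cone_coeffs a G"
proof -
  have L: "G x (k, 0, B) = 0 \<and> G x (k, 0, insert 2 B) = 0 \<and> G x (k, 0, insert 3 B) = 0 \<and>
     G x (k, 0, insert 2 (insert 3 B)) = - (1 + a) * G x (Suc k, 1, B)"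
    and R: "G x (0, l, B) = 0 \<and> G x (0, l, insert 2 B) = 0 \<and> G x (0, l, insert 3 B) = 0 \<and>
     G x (0, l, insert 2 (insert 3 B)) = G x (1, Suc l, B)"
    if B: "B \<subseteq> {0,1}" for x k l B
  proof -
    have fin: "finite B" using B by (rule finite_subset) simp
    note vals = fibre_mult_values[OF B] d_odd_values[OF B] even_mult_values fin cmul_def sign_square
    note c = cone_coeffsD(1-6)[OF F B]
    note c7 = cone_coeffsD(7)[OF F B, unfolded One_nat_def]
    note c8 = cone_coeffsD(8)[OF F B, unfolded One_nat_def]
    note G' = G[unfolded fibre_ops_def insert_iff empty_iff simp_thms fibre_op_def]
    show "G x (k, 0, B) = 0 \<and> G x (k, 0, insert 2 B) = 0 \<and> G x (k, 0, insert 3 B) = 0 \<and>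
      G x (k, 0, insert 2 (insert 3 B)) = - (1 + a) * G x (Suc k, 1, B)"
      using G' by (cases k; elim disjE; simp add: vals c c7; simp add: algebra_simps)
    show "G x (0, l, B) = 0 \<and> G x (0, l, insert 2 B) = 0 \<and> G x (0, l, insert 3 B) = 0 \<and>
      G x (0, l, insert 2 (insert 3 B)) = G x (1, Suc l, B)"
      using G' by (cases l; elim disjE; simp add: vals c c8; simp add: algebra_simps)
  qed
  show ?thesis unfolding cone_coeffs_iff
  proof (intro allI impI)
    fix x B assume B: "B \<subseteq> {0,1::nat}"
    show "(\<forall>k. G x (k, 0, B) = 0) \<and> (\<forall>l. G x (0, l, B) = 0) \<and>
     (\<forall>k. G x (k, 0, insert 2 B) = 0) \<and> (\<forall>k. G x (k, 0, insert 3 B) = 0) \<and>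
     (\<forall>l. G x (0, l, insert 2 B) = 0) \<and> (\<forall>l. G x (0, l, insert 3 B) = 0) \<and>
     (\<forall>k. G x (k, 0, insert 2 (insert 3 B)) = - (1 + a) * G x (Suc k, 1, B)) \<and>
     (\<forall>l. G x (0, l, insert 2 (insert 3 B)) = G x (1, Suc l, B))"
      using L[OF B, of x] R[OF B, of x] by simp
  qed
qed

lemma cone_coeffs_add:
  assumes "cone_coeffs a F" "cone_coeffs a G" shows "cone_coeffs a (F + G)"
  by (rule cone_coeffsI)
     (simp_all only: plus_fun_apply cone_coeffsD[OF assms(1)] cone_coeffsD[OF assms(2)] add_0 distrib_left)

lemma cone_coeffs_sum: "(\<And>i. i \<in> A \<Longrightarrow> cone_coeffs a (F i)) \<Longrightarrow> cone_coeffs a (sum F A)"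
proof (induction A rule: infinite_finite_induct)
  case (insert i A)
  then show ?case by (simp only: sum.insert[OF insert.hyps] insert_iff simp_thms) (intro cone_coeffs_add; blast)
qed (auto simp: cone_coeffs_def)

text \<open>The conditions are linear and have the same form for every base index set
  \<open>B\<close>, so each condition for the product is a combination of the same condition for G
  at the sets \<open>B - T\<close>.\<close>

lemma cone_coeffs_base_smul:
  assumes f: "fibre_degree 0 f" and G: "cone_coeffs a G"
  shows "cone_coeffs a (f \<odot> G)"
proof -
  show ?thesis unfolding cone_coeffs_def
  proof (intro allI impI)
    fix x k l B assume B: "B \<subseteq> {0,1::nat}"
    have sub: "B - T \<subseteq> {0,1}" for T using B by blast
    show "(f \<odot> G) x (k, 0, B) = 0 \<and> (f \<odot> G) x (0, l, B) = 0 \<and>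
     (f \<odot> G) x (k, 0, B \<union> {2}) = 0 \<and> (f \<odot> G) x (k, 0, B \<union> {3}) = 0 \<and>
     (f \<odot> G) x (0, l, B \<union> {2}) = 0 \<and> (f \<odot> G) x (0, l, B \<union> {3}) = 0 \<and>
     (1 + a) * (f \<odot> G) x (Suc k, 1, B) + (f \<odot> G) x (k, 0, B \<union> {2,3}) = 0 \<and>
     (f \<odot> G) x (1, Suc l, B) - (f \<odot> G) x (0, l, B \<union> {2,3}) = 0"
      using base_smul_Un[OF f B, of "{2}"] base_smul_Un[OF f B, of "{3}"] base_smul_Un[OF f B, of "{2,3}"]
        base_smul_Un[OF f B, of "{}"]
      by (simp add: cone_coeffsD[OF G sub] sum_distrib_left flip: sum.distrib sum_subtractf)
         (simp add: algebra_simps)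
  qed
qed

text \<open>The conditions have constant coefficients, because the cone is translated by the flat
  connection. Holomorphy of F is used to pull the factor \<open>- (1 + a)\<close> out of
  \<open>deriv\<close>.\<close>

lemma cone_coeffs_d_base:
  assumes F: "cone_coeffs a F" and hol: "\<And>m. holomorphic2 (\<lambda>x. F x m)"
  shows "cone_coeffs a (d_base i F)"
proof -
  note c = cone_coeffsD[OF F]
  have d1: "(\<lambda>t. F (t, y) m) field_differentiable (at z)" and d2: "(\<lambda>t. F (y, t) m) field_differentiable (at z)" for y z m
    by (rule holomorphic2_partial[OF hol])+
  have s1: "{s. s = 0 \<and> (s = 2 \<or> s = 3 \<or> s \<in> S)} = {s. s = (0::nat) \<and> s \<in> S}" for S by auto
  show ?thesis
    unfolding cone_coeffs_iff
  proof (intro allI impI)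
    fix x :: "complex \<times> complex" and B assume B: "B \<subseteq> {0,1::nat}"
    have B0: "insert 0 B \<subseteq> {0,1}" "insert 1 B \<subseteq> {0,1}" using B by auto
    have ins: "insert 0 (insert 2 B) = insert 2 (insert 0 B)" "insert 0 (insert 3 B) = insert 3 (insert 0 B)"
      "insert 1 (insert 2 B) = insert 2 (insert 1 B)" "insert 1 (insert 3 B) = insert 3 (insert 1 B)"
      "insert 0 (insert 2 (insert 3 B)) = insert 2 (insert 3 (insert 0 B))"
      "insert 1 (insert 2 (insert 3 B)) = insert 2 (insert 3 (insert 1 B))" by auto
    show "(\<forall>k. d_base i F x (k, 0, B) = 0) \<and> (\<forall>l. d_base i F x (0, l, B) = 0) \<and>
     (\<forall>k. d_base i F x (k, 0, insert 2 B) = 0) \<and> (\<forall>k. d_base i F x (k, 0, insert 3 B) = 0) \<and>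
     (\<forall>l. d_base i F x (0, l, insert 2 B) = 0) \<and> (\<forall>l. d_base i F x (0, l, insert 3 B) = 0) \<and>
     (\<forall>k. d_base i F x (k, 0, insert 2 (insert 3 B)) = - (1 + a) * d_base i F x (Suc k, 1, B)) \<and>
     (\<forall>l. d_base i F x (0, l, insert 2 (insert 3 B)) = d_base i F x (1, Suc l, B))"
    proof (cases i)
      case Ev1
      then show ?thesis by (simp add: c[OF B] deriv_cmult[OF d1] del: One_nat_def)
    next
      case Ev2
      then show ?thesis by (simp add: c[OF B] deriv_cmult[OF d2] del: One_nat_def)
    next
      case Od1
      then show ?thesis by (auto simp: d_odd_def ins c[OF B] c[OF B0(1)] simp del: One_nat_def)
    next
      case Od2
      then show ?thesis by (auto simp: d_odd_def s1 ins c[OF B] c[OF B0(2)] simp del: One_nat_def)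
    qed
  qed
qed

section \<open>The Jacobian criterion for symmetries\<close>

lemma sum_coord: "(\<Sum>i\<in>UNIV. f i) = f Ev1 + f Ev2 + f Od1 + f Od2"
  by (simp add: UNIV_coord add.assoc)

lemma smul_diff_right: "h \<odot> (f - g) = h \<odot> f - h \<odot> g"
  by (intro ext) (auto simp: smul_def sum_subtractf algebra_simps)

text \<open>Seven linear equations on the sixteen entries of an element of gl(2|2), three on the
  even and four on the odd ones, imposed on each coefficient of the entries in the odd base
  coordinates.\<close>

definition cone_jacobian :: "complex \<Rightarrow> vfield \<Rightarrow> bool" where
  "cone_jacobian a X \<longleftrightarrow> (\<forall>x B. B \<subseteq> {0,1} \<longrightarrow> (let b = (\<lambda>i j. lift_matrix X i j x (0, 0, B)) in
     b Ev1 Ev2 = 0 \<and> b Ev2 Ev1 = 0 \<and>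
     b Od2 Ev2 = (1 + a) * b Ev1 Od1 \<and> b Od1 Ev2 = - (1 + a) * b Ev1 Od2 \<and>
     b Od2 Ev1 = - b Ev2 Od1 \<and> b Od1 Ev1 = b Ev2 Od2 \<and>
     b Ev1 Ev1 + b Ev2 Ev2 = b Od1 Od1 + b Od2 Od2))"

lemma base_eqI:
  assumes "fibre_degree 0 f" "fibre_degree 0 g"
    and "\<And>x B. B \<subseteq> {0,1} \<Longrightarrow> f x (0, 0, B) = g x (0, 0, B)"
  shows "f = g"
proof (intro ext)
  fix x and m :: smono
  obtain k l S where m: "m = (k, l, S)" by (cases m)
  show "f x m = g x m"
  proof (cases "k = 0 \<and> l = 0 \<and> S \<subseteq> {0,1}")
    case True
    then show ?thesis using assms(3) m by simp
  next
    case False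
    have "h x (k, l, S) = 0" if h: "fibre_degree 0 h" for h
    proof (rule ccontr)
      assume "h x (k, l, S) \<noteq> 0"
      from fibre_degreeD[OF h this] False show False by auto
    qed
    from this[OF assms(1)] this[OF assms(2)] show ?thesis by (simp add: m)
  qed
qed

lemma fibre_degree_fibre_op:
  assumes F: "fibre_degree d F" shows "fibre_degree d (fibre_op i j F)"
proof (cases d)
  \<comment> \<open>A form of degree 0 has zero fibre derivatives, so there is no need for a degree
    below 0 in between.\<close>
  case 0
  have z: "F x (k, l, S) = 0" if "k + l + card (S \<inter> {2,3}) \<noteq> 0" for x k l S
    using fibre_degreeD(2)[OF F, of x k l S] that 0 by auto
  have "insert n S \<inter> {2,3} \<noteq> {}" if "n \<in> {2,3}" for n :: nat and S using that by blast
  then have "F x (k, l, insert n S) = 0" if "n \<in> {2,3}" for x k l n S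
    using that by (intro z) (auto simp: card_eq_0_iff)
  then have "d_fibre j F = 0" by (cases j) (auto simp: d_odd_def z fun_eq_iff)
  then show ?thesis by (simp add: fibre_op_def)
next
  case (Suc e)
  have "fibre_degree 1 (fibre_coord i)"
    by (cases i; rule fibre_degreeI) (auto simp: monomial_def split: if_splits)
  moreover have "fibre_degree e (d_fibre j F)"
  proof (rule fibre_degreeI)
    fix x k l S assume nz: "d_fibre j F x (k, l, S) \<noteq> 0"
    have od: "S \<subseteq> {0,1,2,3} \<and> k + l + card (S \<inter> {2,3}) = e"
      if n: "n \<in> {2,3}" "n \<notin> S" and "F x (k, l, insert n S) \<noteq> 0" for n
    proof -
      have "insert n S \<inter> {2,3} = insert n (S \<inter> {2,3})" "n \<notin> S \<inter> {2,3}" using n by auto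
      then show ?thesis using fibre_degreeD[OF F that(3)] Suc by simp
    qed
    show "S \<subseteq> {0,1,2,3} \<and> k + l + card (S \<inter> {2,3}) = e"
    proof (cases j)
      case Ev1
      then have "F x (Suc k, l, S) \<noteq> 0" using nz by auto
      from fibre_degreeD[OF F this] Suc show ?thesis by simp
    next
      case Ev2
      then have "F x (k, Suc l, S) \<noteq> 0" using nz by auto
      from fibre_degreeD[OF F this] Suc show ?thesis by simp
    next
      case Od1
      then show ?thesis using nz od[of 2] by (auto simp: d_odd_def split: if_splits)
    next
      case Od2
      then show ?thesis using nz od[of 3] by (auto simp: d_odd_def split: if_splits)
    qed
  qed
  ultimately show ?thesis unfolding fibre_op_def Suc using fibre_degree_smul by fastforce
qed

lemma vector_fieldD: "vector_field X \<Longrightarrow> fibre_degree 0 (X i)"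
  by (simp add: vector_field_def fibre_form_iff)

lemma fibre_degree_lift:
  assumes X: "vector_field X" and F: "fibre_degree d F"
  shows "fibre_degree d (lift X F)"
proof -
  have m: "fibre_degree 0 f \<Longrightarrow> fibre_degree d G \<Longrightarrow> fibre_degree d (f \<odot> G)" for f G
    using fibre_degree_smul[of 0 f d G] by simp
  show ?thesis
    unfolding lift_eq[OF X] vf_apply_def
    by (intro fibre_degree_add fibre_degree_sum m vector_fieldD X fibre_degree_d_base F
        fibre_degree_lift_matrix fibre_degree_fibre_op)
qed

lemma jacobian_imp_symmetry:
  assumes a: "a \<noteq> 0" and X: "vector_field X" and J: "cone_jacobian a X"
  shows "infinitesimal_symmetry a X"
  unfolding infinitesimal_symmetry_def
proof (intro conjI allI impI X)
  fix d F assume F: "fibre_form d F \<and> vanishes_on_cone a F"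
  then have Fd: "fibre_degree d F" and hol: "\<And>m. holomorphic2 (\<lambda>x. F x m)"
    by (auto simp: fibre_form_iff)
  have cF: "cone_coeffs a F" using F vanishes_iff_cone_coeffs[OF Fd a] by blast
  note M = fibre_degree_lift_matrix[OF X]
  define b where "b = lift_matrix X"
  have Jb: "b Ev1 Ev2 x (0, 0, B) = 0" "b Ev2 Ev1 x (0, 0, B) = 0"
     "b Od2 Ev2 x (0, 0, B) = (1 + a) * b Ev1 Od1 x (0, 0, B)"
     "b Od1 Ev2 x (0, 0, B) = - (1 + a) * b Ev1 Od2 x (0, 0, B)"
     "b Od2 Ev1 x (0, 0, B) = - b Ev2 Od1 x (0, 0, B)" "b Od1 Ev1 x (0, 0, B) = b Ev2 Od2 x (0, 0, B)"
     "b Ev1 Ev1 x (0, 0, B) + b Ev2 Ev2 x (0, 0, B) = b Od1 Od1 x (0, 0, B) + b Od2 Od2 x (0, 0, B)"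
    if "B \<subseteq> {0,1}" for x B
    using J[unfolded cone_jacobian_def Let_def, THEN spec, THEN spec, THEN mp, OF that, of x]
    unfolding b_def by simp_all
  have bd: "fibre_degree 0 (b i j)" for i j unfolding b_def by (rule M)
  \<comment> \<open>The entries are superfunctions on the base, so relations between their
    coefficients are relations between the entries themselves, and these can be substituted under
    the product.\<close>
  have eqs: "b Ev1 Ev2 = 0" "b Ev2 Ev1 = 0" "b Od2 Ev2 = cmul (1 + a) (b Ev1 Od1)"
    "b Od1 Ev2 = cmul (- (1 + a)) (b Ev1 Od2)" "b Od2 Ev1 = cmul (-1) (b Ev2 Od1)"
    "b Od1 Ev1 = b Ev2 Od2"
    by (rule base_eqI; (intro bd fibre_degree_0 fibre_degree_cmul)?; simp add: Jb cmul_def del: One_nat_def)+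
  have eq: "b Od2 Od2 = b Ev1 Ev1 + b Ev2 Ev2 + cmul (-1) (b Od1 Od1)"
    by (rule base_eqI; (intro bd fibre_degree_add fibre_degree_cmul)?; simp add: Jb cmul_def del: One_nat_def)
  \<comment> \<open>Nine entries are free: \<open>b Ev1 Ev1\<close>, \<open>b Ev2 Ev2\<close>,
    \<open>b Od1 Od1\<close>, the two between \<open>Od1\<close> and \<open>Od2\<close>, and the
    four from \<open>b Ev1 Od1\<close> to \<open>b Ev2 Od2\<close>. Eliminating the other seven
    collects the sum into base multiples of the nine generators.\<close>
  have decomp: "(\<Sum>j\<in>UNIV. \<Sum>i\<in>UNIV. b i j \<odot> fibre_op i j F) =
     b Ev1 Ev1 \<odot> (fibre_op Ev1 Ev1 F + fibre_op Od2 Od2 F) +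
     b Ev2 Ev2 \<odot> (fibre_op Ev2 Ev2 F + fibre_op Od2 Od2 F) +
     b Od1 Od1 \<odot> (fibre_op Od1 Od1 F - fibre_op Od2 Od2 F) +
     b Od1 Od2 \<odot> fibre_op Od1 Od2 F + b Od2 Od1 \<odot> fibre_op Od2 Od1 F +
     b Ev1 Od1 \<odot> (fibre_op Ev1 Od1 F + cmul (1 + a) (fibre_op Od2 Ev2 F)) +
     b Ev1 Od2 \<odot> (fibre_op Ev1 Od2 F - cmul (1 + a) (fibre_op Od1 Ev2 F)) +
     b Ev2 Od1 \<odot> (fibre_op Ev2 Od1 F - fibre_op Od2 Ev1 F) +
     b Ev2 Od2 \<odot> (fibre_op Ev2 Od2 F + fibre_op Od1 Ev1 F)"
    unfolding sum_coord eqs eq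
    by (simp only: smul_add_left smul_add_right smul_diff_right smul_cmul_left smul_cmul_right smul_zero)
       (intro ext, simp only: plus_fun_apply minus_apply zero_fun_apply cmul_def, simp add: algebra_simps)
  have "cone_coeffs a (\<Sum>j\<in>UNIV. \<Sum>i\<in>UNIV. b i j \<odot> fibre_op i j F)"
  proof -
    have P: "cone_coeffs a (b i j \<odot> G)" if "G \<in> fibre_ops a F" for i j G
      by (rule cone_coeffs_base_smul[OF bd cone_coeffs_fibre_ops[OF cF that]])
    show ?thesis unfolding decomp
      by (intro cone_coeffs_add P; simp only: fibre_ops_def insert_iff simp_thms)
  qed
  moreover have "cone_coeffs a (vf_apply X F)"
    unfolding vf_apply_def
    by (intro cone_coeffs_sum cone_coeffs_base_smul vector_fieldD X cone_coeffs_d_base cF hol)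
  ultimately have "cone_coeffs a (lift X F)"
    unfolding lift_eq[OF X] b_def by (intro cone_coeffs_add)
  then show "vanishes_on_cone a (lift X F)"
    using vanishes_iff_cone_coeffs[OF fibre_degree_lift[OF X Fd] a] by blast
qed

text \<open>Forms with constant coefficients on M. The part of the lift along the base annihilates
  them, so on such forms only the Jacobian of the vector field is visible.\<close>

definition fibre_only :: "sfun \<Rightarrow> bool" where
  "fibre_only F \<longleftrightarrow> (\<forall>x y k l S. F x (k, l, S) = F y (k, l, S) \<and> (F x (k, l, S) \<noteq> 0 \<longrightarrow> S \<subseteq> {2,3}))"

lemma fibre_onlyD:
  assumes "fibre_only F"
  shows "F x (k, l, S) = F y (k, l, S)" "F x (k, l, S) \<noteq> 0 \<Longrightarrow> S \<subseteq> {2,3}"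
  using assms unfolding fibre_only_def by blast+

lemma fibre_only_monomial: "E \<subseteq> {2,3} \<Longrightarrow> fibre_only (monomial (p, q, E))"
  by (simp add: fibre_only_def monomial_def)

lemma fibre_only_add: "fibre_only F \<Longrightarrow> fibre_only G \<Longrightarrow> fibre_only (F + G)"
  unfolding fibre_only_def plus_fun_apply by (metis add_0)

lemma fibre_only_cmul: "fibre_only F \<Longrightarrow> fibre_only (cmul c F)"
  unfolding fibre_only_def cmul_def by (metis mult_zero_right)

lemma d_base_fibre_only:
  assumes "fibre_only F" shows "d_base i F = 0"
proof (intro ext)
  fix x and m :: smono
  obtain k l S where m: "m = (k, l, S)" by (cases m)
  have c: "F y = F x" for y
  proof
    fix m show "F y m = F x m" by (cases m) (simp only: fibre_onlyD(1)[OF assms, of y _ _ _ x])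
  qed
  have z: "F x (k, l, insert n S) = 0" if "n \<in> {0,1}" for n
  proof (rule ccontr)
    assume "F x (k, l, insert n S) \<noteq> 0"
    then have "insert n S \<subseteq> {2,3}" by (rule fibre_onlyD(2)[OF assms])
    with that show False by auto
  qed
  show "d_base i F x m = 0 x m"
  proof (cases i)
    case Ev1
    have "(\<lambda>t. F (t, snd x) m) = (\<lambda>t. F x m)" by (intro ext fun_cong[OF c])
    then show ?thesis by (simp add: Ev1)
  next
    case Ev2
    have "(\<lambda>t. F (fst x, t) m) = (\<lambda>t. F x m)" by (intro ext fun_cong[OF c])
    then show ?thesis by (simp add: Ev2)
  qed (simp_all add: m d_odd_def z[of 0] z[of 1, simplified])
qed

lemma fibre_only_fibre_op:
  assumes "fibre_only F" shows "fibre_op i j F x (k, l, S) \<noteq> 0 \<Longrightarrow> S \<subseteq> {2,3}"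
proof -
  have d: "S \<subseteq> {2,3}" if nz: "d_fibre j F x (k, l, S) \<noteq> 0" for k l S
  proof -
    have "\<exists>k l n. F x (k, l, S) \<noteq> 0 \<or> F x (k, l, insert n S) \<noteq> 0"
      using nz by (cases j) (auto simp: d_odd_def split: if_splits)
    then obtain k l n where "F x (k, l, S) \<noteq> 0 \<or> F x (k, l, insert n S) \<noteq> 0" by blast
    then show ?thesis
      using fibre_onlyD(2)[OF assms, of x k l S] fibre_onlyD(2)[OF assms, of x k l "insert n S"] by blast
  qed
  assume nz: "fibre_op i j F x (k, l, S) \<noteq> 0"
  then have fin: "finite S" unfolding fibre_op_def using smul_infinite by blast
  obtain p q E where e: "fibre_coord i = monomial (p, q, E)" "E \<subseteq> {2,3}"
  proof (cases i)
    case Ev1 then show ?thesis by (intro that[of 1 0 "{}"]) simp_all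
  next
    case Ev2 then show ?thesis by (intro that[of 0 1 "{}"]) simp_all
  next
    case Od1 then show ?thesis by (intro that[of 0 0 "{2}"]) simp_all
  next
    case Od2 then show ?thesis by (intro that[of 0 0 "{3}"]) simp_all
  qed
  have "d_fibre j F x (k - p, l - q, S - E) \<noteq> 0"
    using nz unfolding fibre_op_def e(1) monomial_smul[OF fin] by (auto split: if_splits)
  then have "S - E \<subseteq> {2,3}" by (rule d)
  with e(2) show "S \<subseteq> {2,3}" by blast
qed

lemma cone_jacobian_values:
  assumes X: "vector_field X" and T: "fibre_only T" and B: "B \<subseteq> {0,1}" and P: "P \<subseteq> {2,3}"
  shows "lift X T x (k, l, B \<union> P) =
    (\<Sum>j\<in>UNIV. \<Sum>i\<in>UNIV. lift_matrix X i j x (0, 0, B) * fibre_op i j T x (k, l, P))"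
proof -
  have "vf_apply X T = 0" unfolding vf_apply_def d_base_fibre_only[OF T] by simp
  then show ?thesis
    unfolding lift_eq[OF X] sum_coord plus_fun_apply
    by (simp add: base_smul_const[OF fibre_degree_lift_matrix[OF X] B P fibre_only_fibre_op[OF T]])
qed

lemma symmetry_imp_jacobian:
  assumes a: "a \<noteq> 0" "a \<noteq> - 1" and S: "infinitesimal_symmetry a X"
  shows "vector_field X" "cone_jacobian a X"
proof -
  show X: "vector_field X" using S by (simp add: infinitesimal_symmetry_def)
  define T1 where "T1 = monomial (1, 1, {2})"
  define T2 where "T2 = monomial (1, 1, {3})"
  define T3 where "T3 = monomial (Suc (Suc 0), 1, {}) + cmul (- (1 + a)) (monomial (1, 0, {2,3}))"
  note T_defs = T1_def T2_def T3_def
  have fo: "fibre_only T1" "fibre_only T2" "fibre_only T3"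
    unfolding T_defs by (intro fibre_only_add fibre_only_cmul fibre_only_monomial; simp)+
  have fm: "fibre_degree 3 (monomial (p, q, E))" if "E \<subseteq> {2,3}" "p + q + card E = 3" for p q E
  proof (rule fibre_degreeI)
    fix x k l S assume "monomial (p, q, E) x (k, l, S) \<noteq> 0"
    then have e: "k = p" "l = q" "S = E" by (auto simp: monomial_def split: if_splits)
    have "E \<inter> {2,3} = E" "E \<subseteq> {0,1,2,3}" using that(1) by auto
    then show "S \<subseteq> {0,1,2,3} \<and> k + l + card (S \<inter> {2,3}) = 3" using that(2) e by simp
  qed
  have fd: "fibre_degree 3 T1" "fibre_degree 3 T2" "fibre_degree 3 T3"
    unfolding T_defs by (intro fibre_degree_add fibre_degree_cmul fm; simp)+
  have hol: "holomorphic2 (\<lambda>x. c)" for c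
    unfolding holomorphic2_def by (intro allI exI[of _ 0]) (auto intro!: derivative_eq_intros)
  have ff: "fibre_form 3 T" if "fibre_only T" "fibre_degree 3 T" for T
  proof -
    have eq: "(\<lambda>x. T x m) = (\<lambda>x. T (0, 0) m)" for m
      by (rule ext, cases m, hypsubst, rule fibre_onlyD(1)[OF that(1)])
    have "holomorphic2 (\<lambda>x. T x m)" for m by (subst eq) (rule hol)
    then show ?thesis unfolding fibre_form_iff using that(2) by blast
  qed
  have mono: "monomial (p, q, E) x (k, l, B \<union> P) = (if p = k \<and> q = l \<and> B = {} \<and> E = P then 1 else 0)"
    if "B \<subseteq> {0,1}" "P \<subseteq> {2,3}" "E \<subseteq> {2,3}" for p q E x k l B P
    using Un_base_fibre_inj[of B P "{}" E] that by (auto simp: monomial_def)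
  have m: "monomial (p, q, E) x (k, l, B) = (if p = k \<and> q = l \<and> B = {} \<and> E = {} then 1 else 0)"
    "monomial (p, q, E) x (k, l, insert 2 B) = (if p = k \<and> q = l \<and> B = {} \<and> E = {2} then 1 else 0)"
    "monomial (p, q, E) x (k, l, insert 3 B) = (if p = k \<and> q = l \<and> B = {} \<and> E = {3} then 1 else 0)"
    "monomial (p, q, E) x (k, l, insert 2 (insert 3 B)) = (if p = k \<and> q = l \<and> B = {} \<and> E = {2,3} then 1 else 0)"
    if "B \<subseteq> {0,1}" "E \<subseteq> {2,3}" for p q E x k l B
    using mono[OF that(1) _ that(2), of "{}"] mono[OF that(1) _ that(2), of "{2}"]
      mono[OF that(1) _ that(2), of "{3}"] mono[OF that(1) _ that(2), of "{2,3}"]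
    by simp_all
  have cone: "cone_coeffs a T1" "cone_coeffs a T2" "cone_coeffs a T3"
    unfolding T_defs
    by (rule cone_coeffsI; simp add: m cmul_def del: One_nat_def)+
  have cone_lift: "cone_coeffs a (lift X T)" if "fibre_only T" "fibre_degree 3 T" "cone_coeffs a T" for T
    using S ff[OF that(1,2)] that(3) vanishes_iff_cone_coeffs[OF that(2) a(1)]
      vanishes_iff_cone_coeffs[OF fibre_degree_lift[OF X that(2)] a(1)]
    unfolding infinitesimal_symmetry_def by blast
  show "cone_jacobian a X"
    unfolding cone_jacobian_def Let_def
  proof (intro allI impI)
    fix x B assume B: "B \<subseteq> {0,1::nat}"
    define b where "b = (\<lambda>i j. lift_matrix X i j x (0, 0, B))"
    \<comment> \<open>The lift of X has coefficient \<open>v T k l P\<close> at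
      \<open>(k, l, B \<union> P)\<close>; for fixed \<open>B\<close> the tests thus involve only
      the single complex matrix b.\<close>
    define v where "v T k l P = (\<Sum>j\<in>UNIV. \<Sum>i\<in>UNIV. b i j * fibre_op i j T x (k, l, P))" for T k l P
    have v: "v T k 0 {2} = 0" "v T 0 l {2} = 0"
      "(1 + a) * v T (Suc k) 1 {} + v T k 0 {2,3} = 0" "v T 1 (Suc l) {} - v T 0 l {2,3} = 0"
      if "fibre_only T" "fibre_degree 3 T" "cone_coeffs a T" for T k l
    proof -
      have V: "v T k l P = lift X T x (k, l, B \<union> P)" if "P \<subseteq> {2,3}" for k l P
        unfolding v_def b_def by (rule cone_jacobian_values[OF X \<open>fibre_only T\<close> B that, symmetric])
      note c = cone_lift[OF that, unfolded cone_coeffs_def, THEN spec, THEN spec, THEN spec, THEN spec, THEN mp, OF B, of x k l]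
      show "v T k 0 {2} = 0" "v T 0 l {2} = 0"
        "(1 + a) * v T (Suc k) 1 {} + v T k 0 {2,3} = 0" "v T 1 (Suc l) {} - v T 0 l {2,3} = 0"
        using c V[of "{}"] V[of "{2}"] V[of "{2,3}"] by simp_all
    qed
    note v1 = v[OF fo(1) fd(1) cone(1)] and v2 = v[OF fo(2) fd(2) cone(2)] and v3 = v[OF fo(3) fd(3) cone(3)]
    note vals = v_def sum_coord fibre_op_def fibre_mult_values[OF empty_subsetI] d_odd_values[OF empty_subsetI]
      even_mult_values m[OF empty_subsetI] T_defs cmul_def
    \<comment> \<open>The coefficients of \<open>y1^2 \<zeta>2\<close> and
      \<open>y2^2 \<zeta>2\<close> in the image of \<open>T1\<close> isolate the even off-diagonal
      entries. The mixed entries come from comparing \<open>y1^2 y2\<close> with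
      \<open>y1 \<zeta>2 \<zeta>3\<close> and \<open>y1 y2^2\<close> with
      \<open>y2 \<zeta>2 \<zeta>3\<close> in the images of \<open>T1\<close> and
      \<open>T2\<close>.\<close>
    have "b Ev1 Ev2 = 0" using v1(1)[of "Suc (Suc 0)"] by (simp add: vals)
    moreover have "b Ev2 Ev1 = 0" using v1(2)[of "Suc (Suc 0)"] by (simp add: vals)
    moreover have "b Od2 Ev2 = (1 + a) * b Ev1 Od1" using v1(3)[of "Suc 0"] by (simp add: vals)
    moreover have "b Od1 Ev2 = - (1 + a) * b Ev1 Od2" using v2(3)[of "Suc 0"] by (simp add: vals algebra_simps eq_neg_iff_add_eq_0)
    moreover have "b Od2 Ev1 = - b Ev2 Od1" using v1(4)[of "Suc 0"] by (simp add: vals algebra_simps eq_neg_iff_add_eq_0)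
    moreover have "b Od1 Ev1 = b Ev2 Od2" using v2(4)[of "Suc 0"] by (simp add: vals)
    moreover have "b Ev1 Ev1 + b Ev2 Ev2 = b Od1 Od1 + b Od2 Od2"
    proof -
      \<comment> \<open>The first condition on \<open>T3\<close> yields the trace equation
        multiplied by 1 + a; here it stands with both sides multiplied out.\<close>
      have "b Ev1 Ev1 + (b Ev2 Ev2 + (a * b Ev1 Ev1 + a * b Ev2 Ev2)) =
          b Od1 Od1 + (b Od2 Od2 + (a * b Od1 Od1 + a * b Od2 Od2))"
        using v3(3)[of "Suc 0"] by (simp add: vals) (simp add: algebra_simps)
      then have "(1 + a) * (b Ev1 Ev1 + b Ev2 Ev2 - (b Od1 Od1 + b Od2 Od2)) = 0"
        by algebra
      moreover have "1 + a \<noteq> 0" using a(2) by (metis add.commute eq_neg_iff_add_eq_0)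
      ultimately show ?thesis by simp
    qed
    ultimately show "lift_matrix X Ev1 Ev2 x (0, 0, B) = 0 \<and> lift_matrix X Ev2 Ev1 x (0, 0, B) = 0 \<and>
       lift_matrix X Od2 Ev2 x (0, 0, B) = (1 + a) * lift_matrix X Ev1 Od1 x (0, 0, B) \<and>
       lift_matrix X Od1 Ev2 x (0, 0, B) = - (1 + a) * lift_matrix X Ev1 Od2 x (0, 0, B) \<and>
       lift_matrix X Od2 Ev1 x (0, 0, B) = - lift_matrix X Ev2 Od1 x (0, 0, B) \<and>
       lift_matrix X Od1 Ev1 x (0, 0, B) = lift_matrix X Ev2 Od2 x (0, 0, B) \<and>
       lift_matrix X Ev1 Ev1 x (0, 0, B) + lift_matrix X Ev2 Ev2 x (0, 0, B) =
       lift_matrix X Od1 Od1 x (0, 0, B) + lift_matrix X Od2 Od2 x (0, 0, B)"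
      unfolding b_def by blast
  qed
qed

section \<open>The explicit symmetries and their brackets\<close>

text \<open>The superfunction \<open>p + q \<xi>1 + r \<xi>2 + s \<xi>1 \<xi>2\<close> on M. Working
  with its four components reduces the computation of brackets to ordinary polynomials in
  \<open>x1\<close>, \<open>x2\<close>.\<close>

definition base_fun :: "(complex \<times> complex \<Rightarrow> complex) \<Rightarrow> (complex \<times> complex \<Rightarrow> complex) \<Rightarrow>
    (complex \<times> complex \<Rightarrow> complex) \<Rightarrow> (complex \<times> complex \<Rightarrow> complex) \<Rightarrow> sfun" where
  "base_fun p q r s = (\<lambda>x (k, l, S). if k = 0 \<and> l = 0 then
     (if S = {} then p x else if S = {0} then q x else if S = {1} then r x else if S = {0,1} then s x else 0) else 0)"

lemma base_fun_values [simp]: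
  "base_fun p q r s x (0, 0, {}) = p x" "base_fun p q r s x (0, 0, {0}) = q x"
  "base_fun p q r s x (0, 0, {Suc 0}) = r x" "base_fun p q r s x (0, 0, {0, Suc 0}) = s x"
  by (simp_all add: base_fun_def)

lemma base_subset_cases:
  assumes "B \<subseteq> {0,1::nat}"
  obtains "B = {}" | "B = {0}" | "B = {1}" | "B = {0,1}"
  using assms by (metis subset_insert_iff subset_singletonD insert_Diff insertCI Diff_insert_absorb insert_commute)

lemma fibre_degree_base_fun [simp]: "fibre_degree 0 (base_fun p q r s)"
  by (rule fibre_degreeI) (auto simp: base_fun_def split: if_splits)

lemma base_fun_eqI:
  assumes "fibre_degree 0 f"
    and "\<And>x. f x (0, 0, {}) = p x" "\<And>x. f x (0, 0, {0}) = q x"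
        "\<And>x. f x (0, 0, {1}) = r x" "\<And>x. f x (0, 0, {0,1}) = s x"
  shows "f = base_fun p q r s"
proof (rule base_eqI[OF assms(1) fibre_degree_base_fun])
  fix x B assume "B \<subseteq> {0,1::nat}"
  then show "f x (0, 0, B) = base_fun p q r s x (0, 0, B)"
    by (cases rule: base_subset_cases) (simp_all add: assms(2-5)[unfolded One_nat_def])
qed

lemma base_fun_add:
  "base_fun p q r s + base_fun p' q' r' s' =
    base_fun (\<lambda>x. p x + p' x) (\<lambda>x. q x + q' x) (\<lambda>x. r x + r' x) (\<lambda>x. s x + s' x)"
  by (intro base_fun_eqI fibre_degree_add fibre_degree_base_fun) simp_all

lemma base_fun_cmul:
  "cmul c (base_fun p q r s) = base_fun (\<lambda>x. c * p x) (\<lambda>x. c * q x) (\<lambda>x. c * r x) (\<lambda>x. c * s x)"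
  by (intro base_fun_eqI fibre_degree_cmul fibre_degree_base_fun) (simp_all add: cmul_def)

lemma base_fun_diff:
  "base_fun p q r s - base_fun p' q' r' s' =
    base_fun (\<lambda>x. p x - p' x) (\<lambda>x. q x - q' x) (\<lambda>x. r x - r' x) (\<lambda>x. s x - s' x)"
proof -
  have "base_fun p q r s - base_fun p' q' r' s' = base_fun p q r s + cmul (-1) (base_fun p' q' r' s')"
    by (auto simp: cmul_def fun_eq_iff)
  then show ?thesis by (simp only: base_fun_cmul base_fun_add) simp
qed

lemma base_fun_mult:
  "base_fun p q r s \<odot> base_fun p' q' r' s' = base_fun (\<lambda>x. p x * p' x) (\<lambda>x. p x * q' x + q x * p' x)
     (\<lambda>x. p x * r' x + r x * p' x) (\<lambda>x. p x * s' x + q x * r' x - r x * q' x + s x * p' x)"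
proof (rule base_fun_eqI)
  show "fibre_degree 0 (base_fun p q r s \<odot> base_fun p' q' r' s')"
    using fibre_degree_smul[OF fibre_degree_base_fun fibre_degree_base_fun] by simp
  have k: "koszul {0} {Suc 0} = 1" by (rule koszul_eq_1) simp
  have k': "koszul {Suc 0} {0} = -1" using koszul_full[of "{Suc 0}" "{0}"] by simp
  have P: "Pow {0, Suc 0} = {{}, {0}, {Suc 0}, {0, Suc 0}}" by (auto simp: Pow_insert)
  have D: "{0, Suc 0} - {0} = {Suc 0}" "{0, Suc 0} - {Suc 0} = {0}" by auto
  note base_smul_Un[OF fibre_degree_base_fun _ empty_subsetI, unfolded Un_empty_right]
  note e = this[of "{}"] this[of "{0}"] this[of "{1}"] this[of "{0,1}"]
  fix x
  show "(base_fun p q r s \<odot> base_fun p' q' r' s') x (0, 0, {}) = p x * p' x"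
    by (subst e) simp_all
  show "(base_fun p q r s \<odot> base_fun p' q' r' s') x (0, 0, {0}) = p x * q' x + q x * p' x"
    by (subst e) (simp_all add: Pow_insert)
  show "(base_fun p q r s \<odot> base_fun p' q' r' s') x (0, 0, {1}) = p x * r' x + r x * p' x"
    by (subst e) (simp_all add: Pow_insert)
  show "(base_fun p q r s \<odot> base_fun p' q' r' s') x (0, 0, {0,1}) =
      p x * s' x + q x * r' x - r x * q' x + s x * p' x"
    by (subst e) (simp_all add: P D k k')
qed

lemma d_base_odd_base_fun:
  "d_base Od1 (base_fun p q r s) = base_fun q (\<lambda>x. 0) s (\<lambda>x. 0)"
  "d_base Od2 (base_fun p q r s) = base_fun r (\<lambda>x. - s x) (\<lambda>x. 0) (\<lambda>x. 0)"
proof -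
  have "{s. s = 0 \<and> s < Suc 0} = {0}" by auto
  then show "d_base Od1 (base_fun p q r s) = base_fun q (\<lambda>x. 0) s (\<lambda>x. 0)"
    "d_base Od2 (base_fun p q r s) = base_fun r (\<lambda>x. - s x) (\<lambda>x. 0) (\<lambda>x. 0)"
    by (intro base_fun_eqI fibre_degree_d_base fibre_degree_base_fun; simp add: d_odd_def insert_commute)+
qed

lemma d_base_Ev1_base_fun:
  assumes "\<And>x. ((\<lambda>t. p (t, snd x)) has_field_derivative p' x) (at (fst x))"
    "\<And>x. ((\<lambda>t. q (t, snd x)) has_field_derivative q' x) (at (fst x))"
    "\<And>x. ((\<lambda>t. r (t, snd x)) has_field_derivative r' x) (at (fst x))"
    "\<And>x. ((\<lambda>t. s (t, snd x)) has_field_derivative s' x) (at (fst x))"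
  shows "d_base Ev1 (base_fun p q r s) = base_fun p' q' r' s'"
  by (intro base_fun_eqI fibre_degree_d_base fibre_degree_base_fun)
     (simp_all add: assms[THEN DERIV_imp_deriv])

lemma d_base_Ev2_base_fun:
  assumes "\<And>x. ((\<lambda>t. p (fst x, t)) has_field_derivative p' x) (at (snd x))"
    "\<And>x. ((\<lambda>t. q (fst x, t)) has_field_derivative q' x) (at (snd x))"
    "\<And>x. ((\<lambda>t. r (fst x, t)) has_field_derivative r' x) (at (snd x))"
    "\<And>x. ((\<lambda>t. s (fst x, t)) has_field_derivative s' x) (at (snd x))"
  shows "d_base Ev2 (base_fun p q r s) = base_fun p' q' r' s'"
  by (intro base_fun_eqI fibre_degree_d_base fibre_degree_base_fun)
     (simp_all add: assms[THEN DERIV_imp_deriv])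



text \<open>
  With \<open>E\<^sub>A = x\<^sub>2\<^sup>2\<partial>\<^sub>2 - \<xi>\<^sub>1\<xi>\<^sub>2\<partial>\<^sub>1 + x\<^sub>2(\<xi>\<^sub>1\<partial>\<^sub>\<xi>\<^sub>1 + \<xi>\<^sub>2\<partial>\<^sub>\<xi>\<^sub>2)\<close> and
  \<open>E\<^sub>B = x\<^sub>1\<^sup>2\<partial>\<^sub>1 + (1+a)\<xi>\<^sub>1\<xi>\<^sub>2\<partial>\<^sub>2 + x\<^sub>1(\<xi>\<^sub>1\<partial>\<^sub>\<xi>\<^sub>1 + \<xi>\<^sub>2\<partial>\<^sub>\<xi>\<^sub>2)\<close>, the three copies of \<open>\<ss>\<ll>\<^sub>2\<close> are embedded by
  \<open>X \<mapsto> E\<^sub>A, Y \<mapsto> -\<partial>\<^sub>2\<close>, by \<open>X \<mapsto> E\<^sub>B, Y \<mapsto> -\<partial>\<^sub>1\<close>, and by \<open>X \<mapsto> \<xi>\<^sub>1\<partial>\<^sub>\<xi>\<^sub>2, Y \<mapsto> \<xi>\<^sub>2\<partial>\<^sub>\<xi>\<^sub>1\<close>.  The odd part is generated under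
  \<open>E\<^sub>A, E\<^sub>B\<close> by \<open>y \<otimes> y \<otimes> x \<mapsto> \<partial>\<^sub>\<xi>\<^sub>2\<close> and \<open>y \<otimes> y \<otimes> y \<mapsto> -\<partial>\<^sub>\<xi>\<^sub>1\<close>.  Only the trace-free \<open>A, B, C\<close>
  matter, and so their last diagonal entries do not occur.
\<close>

fun sym_field :: "complex \<Rightarrow> gamma_elt \<Rightarrow> vfield" where
  "sym_field a ((A, B, C), t) Ev1 = base_fun
     (\<lambda>x. - B $ 2 $ 1 + 2 * B $ 1 $ 1 * fst x + B $ 1 $ 2 * (fst x)\<^sup>2)
     (\<lambda>x. t $ 1 $ 1 $ 1 * fst x - t $ 1 $ 2 $ 1) (\<lambda>x. t $ 1 $ 1 $ 2 * fst x - t $ 1 $ 2 $ 2)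
     (\<lambda>x. - A $ 1 $ 2)"
| "sym_field a ((A, B, C), t) Ev2 = base_fun
     (\<lambda>x. - A $ 2 $ 1 + 2 * A $ 1 $ 1 * snd x + A $ 1 $ 2 * (snd x)\<^sup>2)
     (\<lambda>x. (1 + a) * (t $ 2 $ 1 $ 1 - t $ 1 $ 1 $ 1 * snd x))
     (\<lambda>x. (1 + a) * (t $ 2 $ 1 $ 2 - t $ 1 $ 1 $ 2 * snd x))
     (\<lambda>x. (1 + a) * B $ 1 $ 2)"
| "sym_field a ((A, B, C), t) Od1 = base_fun
     (\<lambda>x. - t $ 1 $ 1 $ 2 * (fst x * snd x) + t $ 2 $ 1 $ 2 * fst x + t $ 1 $ 2 $ 2 * snd x - t $ 2 $ 2 $ 2)
     (\<lambda>x. A $ 1 $ 1 + B $ 1 $ 1 + C $ 1 $ 1 + A $ 1 $ 2 * snd x + B $ 1 $ 2 * fst x)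
     (\<lambda>x. C $ 2 $ 1) (\<lambda>x. a * t $ 1 $ 1 $ 2)"
| "sym_field a ((A, B, C), t) Od2 = base_fun
     (\<lambda>x. t $ 1 $ 1 $ 1 * (fst x * snd x) - t $ 2 $ 1 $ 1 * fst x - t $ 1 $ 2 $ 1 * snd x + t $ 2 $ 2 $ 1)
     (\<lambda>x. C $ 1 $ 2)
     (\<lambda>x. A $ 1 $ 1 + B $ 1 $ 1 - C $ 1 $ 1 + A $ 1 $ 2 * snd x + B $ 1 $ 2 * fst x)
     (\<lambda>x. - a * t $ 1 $ 1 $ 1)"

lemma d_base_Ev1_sym_field:
  "d_base Ev1 (sym_field a ((A, B, C), t) Ev1) = base_fun (\<lambda>x. 2 * B $ 1 $ 1 + 2 * B $ 1 $ 2 * fst x)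
     (\<lambda>x. t $ 1 $ 1 $ 1) (\<lambda>x. t $ 1 $ 1 $ 2) (\<lambda>x. 0)"
  "d_base Ev1 (sym_field a ((A, B, C), t) Ev2) = base_fun (\<lambda>x. 0) (\<lambda>x. 0) (\<lambda>x. 0) (\<lambda>x. 0)"
  "d_base Ev1 (sym_field a ((A, B, C), t) Od1) = base_fun
     (\<lambda>x. - t $ 1 $ 1 $ 2 * snd x + t $ 2 $ 1 $ 2) (\<lambda>x. B $ 1 $ 2) (\<lambda>x. 0) (\<lambda>x. 0)"
  "d_base Ev1 (sym_field a ((A, B, C), t) Od2) = base_fun
     (\<lambda>x. t $ 1 $ 1 $ 1 * snd x - t $ 2 $ 1 $ 1) (\<lambda>x. 0) (\<lambda>x. B $ 1 $ 2) (\<lambda>x. 0)"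
  unfolding sym_field.simps
  by (intro d_base_Ev1_base_fun; auto intro!: derivative_eq_intros simp: algebra_simps)+

lemma d_base_Ev2_sym_field:
  "d_base Ev2 (sym_field a ((A, B, C), t) Ev1) = base_fun (\<lambda>x. 0) (\<lambda>x. 0) (\<lambda>x. 0) (\<lambda>x. 0)"
  "d_base Ev2 (sym_field a ((A, B, C), t) Ev2) = base_fun (\<lambda>x. 2 * A $ 1 $ 1 + 2 * A $ 1 $ 2 * snd x)
     (\<lambda>x. - (1 + a) * t $ 1 $ 1 $ 1) (\<lambda>x. - (1 + a) * t $ 1 $ 1 $ 2) (\<lambda>x. 0)"
  "d_base Ev2 (sym_field a ((A, B, C), t) Od1) = base_fun
     (\<lambda>x. - t $ 1 $ 1 $ 2 * fst x + t $ 1 $ 2 $ 2) (\<lambda>x. A $ 1 $ 2) (\<lambda>x. 0) (\<lambda>x. 0)"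
  "d_base Ev2 (sym_field a ((A, B, C), t) Od2) = base_fun
     (\<lambda>x. t $ 1 $ 1 $ 1 * fst x - t $ 1 $ 2 $ 1) (\<lambda>x. 0) (\<lambda>x. A $ 1 $ 2) (\<lambda>x. 0)"
  unfolding sym_field.simps
  by (intro d_base_Ev2_base_fun; auto intro!: derivative_eq_intros simp: algebra_simps)+

lemma d_base_odd_sym_field:
  "d_base Od1 (sym_field a ((A, B, C), t) Ev1) = base_fun (\<lambda>x. t $ 1 $ 1 $ 1 * fst x - t $ 1 $ 2 $ 1)
     (\<lambda>x. 0) (\<lambda>x. - A $ 1 $ 2) (\<lambda>x. 0)"
  "d_base Od1 (sym_field a ((A, B, C), t) Ev2) = base_fun (\<lambda>x. (1 + a) * (t $ 2 $ 1 $ 1 - t $ 1 $ 1 $ 1 * snd x))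
     (\<lambda>x. 0) (\<lambda>x. (1 + a) * B $ 1 $ 2) (\<lambda>x. 0)"
  "d_base Od1 (sym_field a ((A, B, C), t) Od1) = base_fun
     (\<lambda>x. A $ 1 $ 1 + B $ 1 $ 1 + C $ 1 $ 1 + A $ 1 $ 2 * snd x + B $ 1 $ 2 * fst x)
     (\<lambda>x. 0) (\<lambda>x. a * t $ 1 $ 1 $ 2) (\<lambda>x. 0)"
  "d_base Od1 (sym_field a ((A, B, C), t) Od2) = base_fun (\<lambda>x. C $ 1 $ 2) (\<lambda>x. 0) (\<lambda>x. - a * t $ 1 $ 1 $ 1) (\<lambda>x. 0)"
  "d_base Od2 (sym_field a ((A, B, C), t) Ev1) = base_fun (\<lambda>x. t $ 1 $ 1 $ 2 * fst x - t $ 1 $ 2 $ 2)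
     (\<lambda>x. A $ 1 $ 2) (\<lambda>x. 0) (\<lambda>x. 0)"
  "d_base Od2 (sym_field a ((A, B, C), t) Ev2) = base_fun (\<lambda>x. (1 + a) * (t $ 2 $ 1 $ 2 - t $ 1 $ 1 $ 2 * snd x))
     (\<lambda>x. - ((1 + a) * B $ 1 $ 2)) (\<lambda>x. 0) (\<lambda>x. 0)"
  "d_base Od2 (sym_field a ((A, B, C), t) Od1) = base_fun (\<lambda>x. C $ 2 $ 1) (\<lambda>x. - (a * t $ 1 $ 1 $ 2)) (\<lambda>x. 0) (\<lambda>x. 0)"
  "d_base Od2 (sym_field a ((A, B, C), t) Od2) = base_fun
     (\<lambda>x. A $ 1 $ 1 + B $ 1 $ 1 - C $ 1 $ 1 + A $ 1 $ 2 * snd x + B $ 1 $ 2 * fst x)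
     (\<lambda>x. a * t $ 1 $ 1 $ 1) (\<lambda>x. 0) (\<lambda>x. 0)"
  unfolding sym_field.simps d_base_odd_base_fun by simp_all

lemmas d_base_sym_field = d_base_Ev1_sym_field d_base_Ev2_sym_field d_base_odd_sym_field

lemma base_fun_cong:
  "(\<And>x. p x = p' x) \<Longrightarrow> (\<And>x. q x = q' x) \<Longrightarrow> (\<And>x. r x = r' x) \<Longrightarrow> (\<And>x. s x = s' x) \<Longrightarrow>
     base_fun p q r s = base_fun p' q' r' s'"
  by presburger

lemma sym_field_linear:
  "sym_field a (g + h) i = sym_field a g i + sym_field a h i"
  "sym_field a (gamma_scale c g) i = cmul c (sym_field a g i)"
proof -
  obtain A B C t A' B' C' t' where gh: "g = ((A, B, C), t)" "h = ((A', B', C'), t')" by (metis prod.exhaust)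
  show "sym_field a (g + h) i = sym_field a g i + sym_field a h i"
    unfolding gh by (cases i) (simp_all add: base_fun_add, (rule base_fun_cong; simp add: algebra_simps)+)
  show "sym_field a (gamma_scale c g) i = cmul c (sym_field a g i)"
    unfolding gh gamma_scale.simps mat3_scale.simps
    by (cases i) (simp_all add: base_fun_cmul, (rule base_fun_cong; simp add: algebra_simps)+)
qed

text \<open>Counting the parity of the frame vector, the matrices fill exactly the even slots of the
  field and the tensor the odd ones.\<close>

lemma vf_part_sym_field:
  "vf_part 0 (sym_field a (M, t)) = sym_field a (M, 0)"
  "vf_part 1 (sym_field a (M, t)) = sym_field a (0, t)"
proof -
  obtain A B C where M: "M = (A, B, C)" by (cases M)
  have v: "vf_part n (sym_field a ((A, B, C), t)) i = base_fun
      (\<lambda>x. if even (par i + n) then sym_field a ((A, B, C), t) i x (0, 0, {}) else 0)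
      (\<lambda>x. if odd (par i + n) then sym_field a ((A, B, C), t) i x (0, 0, {0}) else 0)
      (\<lambda>x. if odd (par i + n) then sym_field a ((A, B, C), t) i x (0, 0, {1}) else 0)
      (\<lambda>x. if even (par i + n) then sym_field a ((A, B, C), t) i x (0, 0, {0,1}) else 0)" for n i
  proof (rule base_fun_eqI)
    show "fibre_degree 0 (vf_part n (sym_field a ((A, B, C), t)) i)"
    proof (rule fibre_degreeI)
      fix x k l S assume "vf_part n (sym_field a ((A, B, C), t)) i x (k, l, S) \<noteq> 0"
      then have nz: "sym_field a ((A, B, C), t) i x (k, l, S) \<noteq> 0" by (auto simp: vf_part_def split: if_splits)
      have "fibre_degree 0 (sym_field a ((A, B, C), t) i)" by (cases i) simp_all
      from fibre_degreeD[OF this nz] show "S \<subseteq> {0,1,2,3} \<and> k + l + card (S \<inter> {2,3}) = 0" by blast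
    qed
  qed (simp_all add: vf_part_def)
  show "vf_part 0 (sym_field a (M, t)) = sym_field a (M, 0)"
    unfolding M
  proof
    fix i show "vf_part 0 (sym_field a ((A, B, C), t)) i = sym_field a ((A, B, C), 0) i"
      unfolding v by (cases i) simp_all
  qed
  show "vf_part 1 (sym_field a (M, t)) = sym_field a (0, t)"
    unfolding M zero_prod_def
  proof
    fix i show "vf_part 1 (sym_field a ((A, B, C), t)) i = sym_field a ((0, 0, 0), t) i"
      unfolding v by (cases i) simp_all
  qed
qed

section \<open>Brackets of the explicit fields\<close>

lemma sum_01: "(\<Sum>p\<in>{0,1::nat}. f p) = f 0 + f 1"
  by simp

lemma trace_zero_mat2: "trace (A::mat2) = 0 \<Longrightarrow> A $ 2 $ 2 = - A $ 1 $ 1"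
  by (simp add: trace_mat2 eq_neg_iff_add_eq_0 add.commute)

lemma vf_apply_even_even:
  assumes "trace A = 0" "trace B = 0" "trace C = 0" "trace A' = 0" "trace B' = 0" "trace C' = 0"
  shows "vf_apply (sym_field a ((A, B, C), 0)) (sym_field a ((A', B', C'), 0) i) -
      vf_apply (sym_field a ((A', B', C'), 0)) (sym_field a ((A, B, C), 0) i) =
    sym_field a ((commutator A A', commutator B B', commutator C C'), 0) i"
  by (cases i; simp only: vf_apply_def sum_coord d_base_sym_field;
      simp only: sym_field.simps base_fun_mult base_fun_add base_fun_diff;
      rule base_fun_cong;
      simp add: commutator_component assms[THEN trace_zero_mat2] power2_eq_square;
      simp add: algebra_simps)

lemma vf_apply_even_odd:
  assumes "trace A = 0" "trace B = 0" "trace C = 0"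
  shows "vf_apply (sym_field a ((A, B, C), 0)) (sym_field a ((0, 0, 0), t) i) -
      vf_apply (sym_field a ((0, 0, 0), t)) (sym_field a ((A, B, C), 0) i) =
    sym_field a ((0, 0, 0), sl2_act (A, B, C) t) i"
  by (cases i; simp only: vf_apply_def sum_coord d_base_sym_field;
      simp only: sym_field.simps base_fun_mult base_fun_add base_fun_diff;
      rule base_fun_cong;
      simp add: sl2_act_component assms[THEN trace_zero_mat2] power2_eq_square del: sl2_act.simps;
      simp add: algebra_simps)

text \<open>The parameters of D(2,1;a) originate here. In the
  \<open>\<xi>1 \<xi>2\<close>-coefficient of \<open>\<partial>1\<close> the linear terms contribute
  1 and the \<open>\<xi>1 \<xi>2\<close>-terms of the fields contribute a; as
  \<open>sym_field\<close> has \<open>- A $ 1 $ 2\<close> there, the first weight is -(1 + a). For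
  \<open>\<partial>2\<close> the contributions are \<open>(1 + a)^2 - a (1 + a) = 1 + a\<close>, and
  the normalization \<open>(1 + a) * B $ 1 $ 2\<close> leaves the weight 1. The
  \<open>\<xi>1\<close>-coefficient of \<open>\<partial>\<xi>2\<close> gives the third weight
  a.\<close>

lemma vf_apply_odd_odd:
  "vf_apply (sym_field a ((0, 0, 0), t)) (sym_field a ((0, 0, 0), u) i) +
      vf_apply (sym_field a ((0, 0, 0), u)) (sym_field a ((0, 0, 0), t) i) =
    sym_field a (gamma_odd (- 1 - a) 1 a t u, 0) i"
  unfolding gamma_odd_eq
  by (cases i; simp only: vf_apply_def sum_coord d_base_sym_field;
      simp only: sym_field.simps base_fun_mult base_fun_add base_fun_diff;
      rule base_fun_cong;
      simp add: odd1_def odd2_def odd3_def power2_eq_square;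
      simp add: field_simps)

lemma sym_field_bracket:
  assumes "trace A = 0" "trace B = 0" "trace C = 0" "trace A' = 0" "trace B' = 0" "trace C' = 0"
  shows "vf_bracket (sym_field a ((A, B, C), t)) (sym_field a ((A', B', C'), u)) =
    sym_field a (gamma_bracket (- 1 - a) 1 a ((A, B, C), t) ((A', B', C'), u))"
proof
  fix i
  let ?E = "sym_field a ((A, B, C), 0)" and ?E' = "sym_field a ((A', B', C'), 0)"
  let ?O = "sym_field a ((0, 0, 0), t)" and ?O' = "sym_field a ((0, 0, 0), u)"
  let ?c = "(commutator A A', commutator B B', commutator C C')"
  have m: "cmul ((- 1) ^ (0::nat)) f = f" "cmul ((- 1) ^ (1::nat)) f = - f" for f
    by (auto simp: cmul_def fun_eq_iff)
  have "vf_bracket (sym_field a ((A, B, C), t)) (sym_field a ((A', B', C'), u)) i =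
     (vf_apply ?E (?E' i) - vf_apply ?E' (?E i)) + (vf_apply ?E (?O' i) - vf_apply ?O' (?E i)) -
     (vf_apply ?E' (?O i) - vf_apply ?O (?E' i)) + (vf_apply ?O (?O' i) + vf_apply ?O' (?O i))"
    unfolding vf_bracket_def sum_01 vf_part_sym_field zero_prod_def mult_0 mult_0_right mult_1 m
    by (simp only: algebra_simps add.right_inverse add_0_right add_0)
  also have "\<dots> = sym_field a (?c, 0) i + sym_field a ((0, 0, 0), sl2_act (A, B, C) u) i -
      sym_field a ((0, 0, 0), sl2_act (A', B', C') t) i + sym_field a (gamma_odd (- 1 - a) 1 a t u, 0) i"
    by (simp only: vf_apply_even_even[OF assms] vf_apply_even_odd[OF assms(1-3)]
        vf_apply_even_odd[OF assms(4-6)] vf_apply_odd_odd)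
  also have "\<dots> = sym_field a (gamma_bracket (- 1 - a) 1 a ((A, B, C), t) ((A', B', C'), u)) i"
  proof -
    have neg: "f - sym_field a g i = f + sym_field a (gamma_scale (- 1) g) i" for f g
      unfolding sym_field_linear by (auto simp: cmul_def fun_eq_iff)
    show ?thesis
      unfolding neg sym_field_linear(1)[symmetric]
      by (rule arg_cong[of _ _ "\<lambda>g. sym_field a g i"])
         (simp add: gamma_bracket.simps gamma_odd_eq tensor_eq_iff mat2_eq_iff)
  qed
  finally show "vf_bracket (sym_field a ((A, B, C), t)) (sym_field a ((A', B', C'), u)) i =
    sym_field a (gamma_bracket (- 1 - a) 1 a ((A, B, C), t) ((A', B', C'), u)) i" .
qed

section \<open>First-order equations with polynomial solutions\<close>

lemma quadratic_from_deriv: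
  fixes f :: "complex \<Rightarrow> complex"
  assumes "\<And>z. f field_differentiable at z" "\<And>z. deriv f z = r + 2 * m * z"
  shows "f z = f 0 + r * z + m * z\<^sup>2"
proof -
  let ?g = "\<lambda>z. f z - r * z - m * z\<^sup>2"
  have "(?g has_field_derivative 0) (at z within UNIV)" for z
  proof -
    have "(f has_field_derivative r + 2 * m * z) (at z)"
      using assms(1)[of z] assms(2)[of z] by (metis DERIV_deriv_iff_field_differentiable)
    then show ?thesis by (auto intro!: derivative_eq_intros)
  qed
  then obtain c where "\<And>z. ?g z = c"
    using has_field_derivative_zero_constant[of UNIV ?g] by auto
  from this[of z] this[of 0] show ?thesis by (simp add: algebra_simps)
qed

text \<open>The function f is affine in each variable separately. Integrating from the origin along
  both axes in either order gives \<open>u p * q + w 0 * p = u 0 * q + w q * p\<close>; setting q =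
  1 and p = 1 shows that u and w are affine, with a common slope.\<close>

lemma bilinear_from_partials:
  fixes f :: "complex \<times> complex \<Rightarrow> complex"
  assumes d: "\<And>y z. (\<lambda>t. f (t, y)) field_differentiable at z" "\<And>y z. (\<lambda>t. f (y, t)) field_differentiable at z"
    and w: "\<And>x. deriv (\<lambda>t. f (t, snd x)) (fst x) = w (snd x)"
    and u: "\<And>x. deriv (\<lambda>t. f (fst x, t)) (snd x) = u (fst x)"
  obtains k l m n where "\<And>x. f x = k * (fst x * snd x) + l * fst x + m * snd x + n"
    "\<And>z. u z = k * z + m" "\<And>z. w z = k * z + l"
proof -
  have 1: "f (p, q) = f (p, 0) + u p * q" for p q
    using quadratic_from_deriv[of "\<lambda>t. f (p, t)" "u p" 0 q] d u[of "(p, _)"] by simp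
  have 2: "f (p, q) = f (0, q) + w q * p" for p q
    using quadratic_from_deriv[of "\<lambda>t. f (t, q)" "w q" 0 p] d w[of "(_, q)"] by simp
  have e: "u p * q + f (0, 0) + w 0 * p = f (0, 0) + u 0 * q + w q * p" for p q
    using 1[of p q] 2[of p q] 2[of p 0] 1[of 0 q] by algebra
  define k where "k = w 1 - w 0"
  have u': "u p = k * p + u 0" for p using e[of p 1] by (simp add: k_def algebra_simps)
  have w': "w q = k * q + w 0" for q using e[of 1 q] u'[of 1] by (simp add: algebra_simps)
  show thesis
  proof (rule that[of k "w 0" "u 0" "f (0, 0)"])
    fix x :: "complex \<times> complex"
    show "f x = k * (fst x * snd x) + w 0 * fst x + u 0 * snd x + f (0, 0)"
      using 1[of "fst x" "snd x"] 2[of "fst x" 0] u'[of "fst x"] by (simp add: algebra_simps)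
  qed (rule u' w')+
qed

lemma base_odd_values:
  "d_odd 0 F x (0, 0, {}) = F x (0, 0, {0})" "d_odd 0 F x (0, 0, {0}) = 0"
  "d_odd 0 F x (0, 0, {Suc 0}) = F x (0, 0, {0, Suc 0})" "d_odd 0 F x (0, 0, {0, Suc 0}) = 0"
  "d_odd (Suc 0) F x (0, 0, {}) = F x (0, 0, {Suc 0})" "d_odd (Suc 0) F x (0, 0, {0}) = - F x (0, 0, {0, Suc 0})"
  "d_odd (Suc 0) F x (0, 0, {Suc 0}) = 0" "d_odd (Suc 0) F x (0, 0, {0, Suc 0}) = 0"
proof -
  have "{s. s = 0 \<and> s < Suc 0} = {0}" by auto
  then show "d_odd 0 F x (0, 0, {}) = F x (0, 0, {0})" "d_odd 0 F x (0, 0, {0}) = 0"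
    "d_odd 0 F x (0, 0, {Suc 0}) = F x (0, 0, {0, Suc 0})" "d_odd 0 F x (0, 0, {0, Suc 0}) = 0"
    "d_odd (Suc 0) F x (0, 0, {}) = F x (0, 0, {Suc 0})" "d_odd (Suc 0) F x (0, 0, {0}) = - F x (0, 0, {0, Suc 0})"
    "d_odd (Suc 0) F x (0, 0, {Suc 0}) = 0" "d_odd (Suc 0) F x (0, 0, {0, Suc 0}) = 0"
    by (simp_all add: d_odd_def insert_commute)
qed


text \<open>The Jacobian equations, sorted by their coefficient in the odd coordinates. The pure
  vanishing statements for \<open>Od1\<close> at \<open>{1}\<close> and \<open>Od2\<close> at
  \<open>{0}\<close> arise because a derivative with respect to an odd coordinate no longer contains
  that coordinate.\<close>

lemma coefficient_eqs:
  assumes a: "a \<noteq> - 1" and J: "cone_jacobian a X"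
  defines "c \<equiv> \<lambda>i B x. X i x (0, 0, B)"
    and "D1 \<equiv> \<lambda>i B x. deriv (\<lambda>t. X i (t, snd x) (0, 0, B)) (fst x)"
    and "D2 \<equiv> \<lambda>i B x. deriv (\<lambda>t. X i (fst x, t) (0, 0, B)) (snd x)"
  shows "B \<subseteq> {0,1} \<Longrightarrow> D1 Ev2 B x = 0" "B \<subseteq> {0,1} \<Longrightarrow> D2 Ev1 B x = 0"
    "(1 + a) * D1 Od1 {} x = c Ev2 {1} x" "(1 + a) * D1 Od1 {0} x = c Ev2 {0,1} x"
    "D1 Od1 {1} x = 0"
    "(1 + a) * D1 Od2 {} x = - c Ev2 {0} x" "(1 + a) * D1 Od2 {1} x = c Ev2 {0,1} x"
    "D1 Od2 {0} x = 0"
    "D2 Od1 {} x = - c Ev1 {1} x" "D2 Od1 {0} x = - c Ev1 {0,1} x" "D2 Od1 {1} x = 0"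
    "D2 Od2 {} x = c Ev1 {0} x" "D2 Od2 {1} x = - c Ev1 {0,1} x" "D2 Od2 {0} x = 0"
    "D1 Ev1 {} x + D2 Ev2 {} x = c Od1 {0} x + c Od2 {1} x"
    "D1 Ev1 {0} x + D2 Ev2 {0} x = c Od2 {0,1} x"
    "D1 Ev1 {1} x + D2 Ev2 {1} x = - c Od1 {0,1} x"
    "D1 Ev1 {0,1} x + D2 Ev2 {0,1} x = 0"
proof -
  have a': "1 + a \<noteq> 0" using a by (metis add.commute eq_neg_iff_add_eq_0)
  note JB = J[unfolded cone_jacobian_def Let_def, THEN spec, THEN spec, THEN mp, of _ x]
  show "D1 Ev2 B x = 0" "D2 Ev1 B x = 0" if "B \<subseteq> {0,1}"
    using JB[OF that] unfolding D1_def D2_def by (simp_all add: lift_matrix_def)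
  note vals = lift_matrix_def base_odd_values c_def D1_def D2_def
  note J0 = JB[of "{}", simplified, simplified vals, simplified]
  note J1 = JB[of "{0}", simplified, simplified vals, simplified]
  note J2 = JB[of "{1}", simplified, simplified vals, simplified]
  note J3 = JB[of "{0,1}", simplified, simplified vals, simplified]
  show "(1 + a) * D1 Od1 {} x = c Ev2 {1} x" "(1 + a) * D1 Od2 {} x = - c Ev2 {0} x"
    "D2 Od1 {} x = - c Ev1 {1} x" "D2 Od2 {} x = c Ev1 {0} x"
    "D1 Ev1 {} x + D2 Ev2 {} x = c Od1 {0} x + c Od2 {1} x"
    using J0 by (simp_all add: vals base_odd_values) (simp_all add: algebra_simps)
  show "(1 + a) * D1 Od1 {0} x = c Ev2 {0,1} x" "D1 Od2 {0} x = 0"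
    "D2 Od1 {0} x = - c Ev1 {0,1} x" "D2 Od2 {0} x = 0"
    "D1 Ev1 {0} x + D2 Ev2 {0} x = c Od2 {0,1} x"
    using J1 a' a a[symmetric] by (simp_all add: vals base_odd_values)
  show "D1 Od1 {1} x = 0" "(1 + a) * D1 Od2 {1} x = c Ev2 {0,1} x"
    "D2 Od1 {1} x = 0" "D2 Od2 {1} x = - c Ev1 {0,1} x"
    "D1 Ev1 {1} x + D2 Ev2 {1} x = - c Od1 {0,1} x"
    using J2 a' a a[symmetric] by (simp_all add: vals base_odd_values) (simp_all add: algebra_simps)
  show "D1 Ev1 {0,1} x + D2 Ev2 {0,1} x = 0"
    using J3 by (simp_all add: vals base_odd_values)
qed

section \<open>Solving the symmetry equations\<close>

lemma deriv_affine: "deriv (\<lambda>z. c * (k * z + m)) z = c * (k::complex)"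
  by (rule DERIV_imp_deriv) (auto intro!: derivative_eq_intros)

lemma symmetry_field_exists:
  assumes a: "a \<noteq> 0" "a \<noteq> - 1" and X: "vector_field X" and J: "cone_jacobian a X"
  obtains A B C t where "trace A = 0" "trace B = 0" "trace C = 0" "X = sym_field a ((A, B, C), t)"
proof -
  have a1: "1 + a \<noteq> 0" using a(2) by (metis add.commute eq_neg_iff_add_eq_0)
  have hol: "holomorphic2 (\<lambda>x. X i x m)" for i m
    using X unfolding vector_field_def fibre_form_iff by blast
  have dif: "(\<lambda>t. X i (t, y) m) field_differentiable at z" "(\<lambda>t. X i (y, t) m) field_differentiable at z" for i y z m
    by (rule holomorphic2_partial[OF hol])+
  note E = coefficient_eqs[OF a(2) J]
  \<comment> \<open>The \<open>\<partial>1\<close>-component does not depend on \<open>x2\<close>,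
    nor the \<open>\<partial>2\<close>-component on \<open>x1\<close>, so all their coefficients are
    functions p and q of one variable.\<close>
  define p where "p B z = X Ev1 (z, 0) (0, 0, B)" for B z
  define q where "q B z = X Ev2 (0, z) (0, 0, B)" for B z
  have cEv1: "X Ev1 x (0, 0, B) = p B (fst x)" if "B \<subseteq> {0,1}" for x B
    using quadratic_from_deriv[of "\<lambda>t. X Ev1 (fst x, t) (0, 0, B)" 0 0 "snd x", OF dif(2)]
      E(2)[OF that, of "(fst x, _)"] by (simp add: p_def)
  have cEv2: "X Ev2 x (0, 0, B) = q B (snd x)" if "B \<subseteq> {0,1}" for x B
    using quadratic_from_deriv[of "\<lambda>t. X Ev2 (t, snd x) (0, 0, B)" 0 0 "fst x", OF dif(1)]
      E(1)[OF that, of "(_, snd x)"] by (simp add: q_def)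
  have sub: "{} \<subseteq> {0,1::nat}" "{0} \<subseteq> {0,1::nat}" "{1} \<subseteq> {0,1::nat}" "{0,1} \<subseteq> {0,1::nat}" by auto
  note c1 = cEv1[OF sub(1)] cEv1[OF sub(2)] cEv1[OF sub(3)] cEv1[OF sub(4)]
  note c2 = cEv2[OF sub(1)] cEv2[OF sub(2)] cEv2[OF sub(3)] cEv2[OF sub(4)]
  have quot: "(1 + a) * d = e \<longleftrightarrow> d = e / (1 + a)" for d e using a1 by (auto simp: field_simps)
  \<comment> \<open>Each coefficient of an odd component below has its \<open>x1\<close>-derivative
    given by some q over 1 + a and its \<open>x2\<close>-derivative by some p, up to sign. Hence it
    is bilinear, and the same constants describe p and q.\<close>
  obtain k l m n where g1: "\<And>x. X Od1 x (0, 0, {}) = k * (fst x * snd x) + l * fst x + m * snd x + n"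
    and p1: "\<And>z. - p {1} z = k * z + m" and q1: "\<And>z. q {1} z / (1 + a) = k * z + l"
    by (rule bilinear_from_partials[of "\<lambda>x. X Od1 x (0, 0, {})" "\<lambda>z. q {1} z / (1 + a)" "\<lambda>z. - p {1} z"])
       (use dif E(3)[unfolded quot] E(9) in \<open>simp_all only: c1 c2\<close>)
  obtain k' l' m' n' where g2: "\<And>x. X Od2 x (0, 0, {}) = k' * (fst x * snd x) + l' * fst x + m' * snd x + n'"
    and p0: "\<And>z. p {0} z = k' * z + m'" and q0: "\<And>z. - q {0} z / (1 + a) = k' * z + l'"
    by (rule bilinear_from_partials[of "\<lambda>x. X Od2 x (0, 0, {})" "\<lambda>z. - q {0} z / (1 + a)" "\<lambda>z. p {0} z"])
       (use dif E(6)[unfolded quot] E(12) in \<open>simp_all only: c1 c2\<close>)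
  obtain k1 l1 m1 n1 where h1: "\<And>x. X Od1 x (0, 0, {0}) = k1 * (fst x * snd x) + l1 * fst x + m1 * snd x + n1"
    and p3: "\<And>z. - p {0,1} z = k1 * z + m1" and q3: "\<And>z. q {0,1} z / (1 + a) = k1 * z + l1"
    by (rule bilinear_from_partials[of "\<lambda>x. X Od1 x (0, 0, {0})" "\<lambda>z. q {0,1} z / (1 + a)" "\<lambda>z. - p {0,1} z"])
       (use dif E(4)[unfolded quot] E(10) in \<open>simp_all only: c1 c2\<close>)
  obtain k2 l2 m2 n2 where h2: "\<And>x. X Od2 x (0, 0, {1}) = k2 * (fst x * snd x) + l2 * fst x + m2 * snd x + n2"
    and p3': "\<And>z. - p {0,1} z = k2 * z + m2" and q3': "\<And>z. q {0,1} z / (1 + a) = k2 * z + l2"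
    by (rule bilinear_from_partials[of "\<lambda>x. X Od2 x (0, 0, {1})" "\<lambda>z. q {0,1} z / (1 + a)" "\<lambda>z. - p {0,1} z"])
       (use dif E(7)[unfolded quot] E(13) in \<open>simp_all only: c1 c2\<close>)
  obtain u where u: "\<And>x. X Od1 x (0, 0, {1}) = u"
  proof (rule bilinear_from_partials[of "\<lambda>x. X Od1 x (0, 0, {1})" "\<lambda>z. 0" "\<lambda>z. 0"])
    fix k l m n assume "\<And>x. X Od1 x (0, 0, {1}) = k * (fst x * snd x) + l * fst x + m * snd x + n"
      "\<And>z::complex. 0 = k * z + m" "\<And>z::complex. 0 = k * z + l"
    moreover from this(2)[of 0] this(2)[of 1] this(3)[of 0] have "m = 0" "k = 0" "l = 0" by auto
    ultimately show thesis by (intro that[of n]) simp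
  qed (use dif E(5) E(11) in \<open>simp_all only:\<close>)
  obtain v where v: "\<And>x. X Od2 x (0, 0, {0}) = v"
  proof (rule bilinear_from_partials[of "\<lambda>x. X Od2 x (0, 0, {0})" "\<lambda>z. 0" "\<lambda>z. 0"])
    fix k l m n assume "\<And>x. X Od2 x (0, 0, {0}) = k * (fst x * snd x) + l * fst x + m * snd x + n"
      "\<And>z::complex. 0 = k * z + m" "\<And>z::complex. 0 = k * z + l"
    moreover from this(2)[of 0] this(2)[of 1] this(3)[of 0] have "m = 0" "k = 0" "l = 0" by auto
    ultimately show thesis by (intro that[of n]) simp
  qed (use dif E(8) E(14) in \<open>simp_all only:\<close>)
  have P: "p {1} = (\<lambda>z. (-1) * (k * z + m))" "p {0} = (\<lambda>z. 1 * (k' * z + m'))" "p {0,1} = (\<lambda>z. (-1) * (k1 * z + m1))"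
    using p1 p0 p3 by (auto simp: fun_eq_iff minus_equation_iff[of "p _ _"] simp flip: One_nat_def)
  have Q: "q {1} = (\<lambda>z. (1 + a) * (k * z + l))" "q {0} = (\<lambda>z. (- (1 + a)) * (k' * z + l'))"
    "q {0,1} = (\<lambda>z. (1 + a) * (k1 * z + l1))"
  proof -
    show "q {1} = (\<lambda>z. (1 + a) * (k * z + l))"
      by (rule ext) (simp only: q1[symmetric], simp add: a1)
    show "q {0} = (\<lambda>z. (- (1 + a)) * (k' * z + l'))"
    proof
      fix z
      have "- q {0} z / (1 + a) * (1 + a) = - q {0} z" using a1 by simp
      then show "q {0} z = - (1 + a) * (k' * z + l')" unfolding q0 by algebra
    qed
    show "q {0,1} = (\<lambda>z. (1 + a) * (k1 * z + l1))"
      by (rule ext) (simp only: q3[symmetric], simp add: a1)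
  qed
  have D1: "deriv (\<lambda>t. X Ev1 (t, y) (0, 0, B)) z = deriv (p B) z" if "B \<subseteq> {0,1}" for y z B
    using that by (simp add: cEv1)
  have D2: "deriv (\<lambda>t. X Ev2 (y, t) (0, 0, B)) z = deriv (q B) z" if "B \<subseteq> {0,1}" for y z B
    using that by (simp add: cEv2)
  \<comment> \<open>The slopes of \<open>p {0,1}\<close> and \<open>q {0,1}\<close> are
    \<open>- k1\<close> and \<open>(1 + a) * k1\<close>, and the trace equation makes their sum
    \<open>a * k1\<close> zero.\<close>
  have "- k1 + (1 + a) * k1 = 0"
    using E(18)[of "(0,0)"] unfolding D1[OF sub(4)] D2[OF sub(4)] P Q deriv_affine by simp
  then have k1: "k1 = 0" using a(1) by (simp add: algebra_simps)
  \<comment> \<open>Both diagonal odd coefficients are governed by the same \<open>p {0,1}\<close>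
    and \<open>q {0,1}\<close>, so they differ by a constant, which becomes the Cartan part of the
    third \<open>sl2\<close>.\<close>
  have k2: "k2 = 0" "m2 = m1" "l2 = l1"
    using p3[of 0] p3'[of 0] p3[of 1] p3'[of 1] q3[of 0] q3'[of 0] k1 by auto
  have g2': "X Od2 x (0, 0, {0,1}) = - a * k'" for x
    using E(16)[of x] unfolding D1[OF sub(2)] D2[OF sub(2)] P Q deriv_affine by (simp add: algebra_simps)
  have g1': "X Od1 x (0, 0, {0,1}) = - a * k" for x
    using E(17)[of x] unfolding D1[OF sub(3)] D2[OF sub(3)] P Q deriv_affine by (simp add: algebra_simps minus_equation_iff)
  \<comment> \<open>The remaining trace equation separates the variables. Here r and s are the
    linear coefficients of \<open>p {}\<close> and \<open>q {}\<close>, and s is chosen to satisfy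
    the equation at the origin, \<open>r + s = n1 + n2\<close>.\<close>
  define r where "r = deriv (p {}) 0"
  define s where "s = n1 + n2 - r"
  have tr: "deriv (p {}) y + deriv (q {}) z = n1 + n2 + 2 * l1 * y + 2 * m1 * z" for y z
    using E(15)[of "(y, z)"] unfolding D1[OF sub(1)] D2[OF sub(1)] h1 h2 by (simp add: k1 k2)
  have dp: "deriv (p {}) z = r + 2 * l1 * z" for z using tr[of z 0] tr[of 0 0] unfolding r_def by algebra
  have dq: "deriv (q {}) z = s + 2 * m1 * z" for z using tr[of 0 z] unfolding r_def s_def by algebra
  have pq: "p {} = (\<lambda>z. X Ev1 (z, 0) (0, 0, {}))" "q {} = (\<lambda>z. X Ev2 (0, z) (0, 0, {}))"
    by (simp_all add: fun_eq_iff p_def q_def)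
  have pz: "p {} z = p {} 0 + r * z + l1 * z\<^sup>2" for z
    by (rule quadratic_from_deriv[OF _ dp]) (simp only: pq dif)
  have qz: "q {} z = q {} 0 + s * z + m1 * z\<^sup>2" for z
    by (rule quadratic_from_deriv[OF _ dq]) (simp only: pq dif)
  \<comment> \<open>The entries are read off from \<open>sym_field\<close>. The halves of r and s
    reflect the terms \<open>2 * B $ 1 $ 1 * fst x\<close> and \<open>2 * A $ 1 $ 1 * snd x\<close>;
    those of \<open>n1 - n2\<close> split the diagonal coefficients into mean and
    difference.\<close>
  define A :: mat2 where "A = vector [vector [s / 2, m1], vector [- q {} 0, - s / 2]]"
  define B :: mat2 where "B = vector [vector [r / 2, l1], vector [- p {} 0, - r / 2]]"
  define C :: mat2 where "C = vector [vector [(n1 - n2) / 2, v], vector [u, - (n1 - n2) / 2]]"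
  define t :: tensor222 where "t = vector [vector [vector [k', - k], vector [- m', m]], vector [vector [- l', l], vector [n', - n]]]"
  have comps: "A $ 1 $ 1 = s / 2" "A $ 1 $ 2 = m1" "A $ 2 $ 1 = - q {} 0" "A $ 2 $ 2 = - s / 2"
    "B $ 1 $ 1 = r / 2" "B $ 1 $ 2 = l1" "B $ 2 $ 1 = - p {} 0" "B $ 2 $ 2 = - r / 2"
    "C $ 1 $ 1 = (n1 - n2) / 2" "C $ 1 $ 2 = v" "C $ 2 $ 1 = u" "C $ 2 $ 2 = - (n1 - n2) / 2"
    "t $ 1 $ 1 $ 1 = k'" "t $ 1 $ 1 $ 2 = - k" "t $ 1 $ 2 $ 1 = - m'" "t $ 1 $ 2 $ 2 = m"
    "t $ 2 $ 1 $ 1 = - l'" "t $ 2 $ 1 $ 2 = l" "t $ 2 $ 2 $ 1 = n'" "t $ 2 $ 2 $ 2 = - n"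
    by (simp_all add: A_def B_def C_def t_def)
  show thesis
  proof (rule that)
    show "trace A = 0" "trace B = 0" "trace C = 0" by (simp_all add: trace_mat2 comps diff_divide_distrib)
    show "X = sym_field a ((A, B, C), t)"
    proof
      fix i
      have half: "s / 2 + r / 2 + (n1 - n2) / 2 = n1" "s / 2 + r / 2 - (n1 - n2) / 2 = n2"
        by (simp_all add: s_def field_simps)
      show "X i = sym_field a ((A, B, C), t) i"
        using vector_fieldD[OF X, of i]
        by (cases i; simp only: sym_field.simps comps; intro base_fun_eqI; 
            simp only: c1 c2 g1 g2 h1 h2 u v g1' g2' P Q k1 k2 pz[of "fst _"] qz[of "snd _"] half;
            simp add: algebra_simps)
    qed
  qed
qed

section \<open>The isomorphism\<close>

lemma holomorphic2_const: "holomorphic2 (\<lambda>x. c)"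
  unfolding holomorphic2_def by (intro allI exI[of _ 0]) (auto intro!: derivative_eq_intros)

lemma holomorphic2_fst: "holomorphic2 fst" and holomorphic2_snd: "holomorphic2 snd"
proof -
  have "(fst has_derivative (\<lambda>h. 1 * fst h + 0 * snd h)) (at x)"
    "(snd has_derivative (\<lambda>h. 0 * fst h + 1 * snd h)) (at x)" for x :: "complex \<times> complex"
    by (auto intro!: derivative_eq_intros)
  then show "holomorphic2 fst" "holomorphic2 snd" unfolding holomorphic2_def by blast+
qed

lemma holomorphic2_add:
  assumes "holomorphic2 f" "holomorphic2 g" shows "holomorphic2 (\<lambda>x. f x + g x)"
  unfolding holomorphic2_def
proof
  fix x
  obtain A B C D where "(f has_derivative (\<lambda>h. A * fst h + B * snd h)) (at x)"
    "(g has_derivative (\<lambda>h. C * fst h + D * snd h)) (at x)"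
    using assms unfolding holomorphic2_def by blast
  from has_derivative_add[OF this]
  have "((\<lambda>x. f x + g x) has_derivative (\<lambda>h. (A + C) * fst h + (B + D) * snd h)) (at x)"
    by (rule has_derivative_eq_rhs) (simp add: fun_eq_iff algebra_simps)
  then show "\<exists>A B. ((\<lambda>x. f x + g x) has_derivative (\<lambda>h. A * fst h + B * snd h)) (at x)" by blast
qed

lemma holomorphic2_mult:
  assumes "holomorphic2 f" "holomorphic2 g" shows "holomorphic2 (\<lambda>x. f x * g x)"
  unfolding holomorphic2_def
proof
  fix x
  obtain A B C D where "(f has_derivative (\<lambda>h. A * fst h + B * snd h)) (at x)"
    "(g has_derivative (\<lambda>h. C * fst h + D * snd h)) (at x)"
    using assms unfolding holomorphic2_def by blast
  from has_derivative_mult[OF this]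
  have "((\<lambda>x. f x * g x) has_derivative
      (\<lambda>h. (f x * C + A * g x) * fst h + (f x * D + B * g x) * snd h)) (at x)"
    by (rule has_derivative_eq_rhs) (simp add: fun_eq_iff algebra_simps)
  then show "\<exists>A B. ((\<lambda>x. f x * g x) has_derivative (\<lambda>h. A * fst h + B * snd h)) (at x)" by blast
qed

lemma holomorphic2_uminus: "holomorphic2 f \<Longrightarrow> holomorphic2 (\<lambda>x. - f x)"
  using holomorphic2_mult[OF holomorphic2_const[of "-1"], of f] by simp

lemma holomorphic2_diff: "holomorphic2 f \<Longrightarrow> holomorphic2 g \<Longrightarrow> holomorphic2 (\<lambda>x. f x - g x)"
  using holomorphic2_add[OF _ holomorphic2_uminus, of f g] by simp

lemma holomorphic2_power2: "holomorphic2 f \<Longrightarrow> holomorphic2 (\<lambda>x. (f x)\<^sup>2)"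
  unfolding power2_eq_square by (rule holomorphic2_mult)

lemmas holomorphic2_intros = holomorphic2_const holomorphic2_fst holomorphic2_snd holomorphic2_add
  holomorphic2_diff holomorphic2_uminus holomorphic2_mult holomorphic2_power2

lemma superfunction_base_fun:
  assumes "holomorphic2 p" "holomorphic2 q" "holomorphic2 r" "holomorphic2 s"
  shows "superfunction (base_fun p q r s)"
  unfolding fibre_form_iff
proof (intro conjI allI)
  fix m :: smono
  obtain k l S where m: "m = (k, l, S)" by (cases m)
  show "holomorphic2 (\<lambda>x. base_fun p q r s x m)"
    using assms holomorphic2_const[of 0] unfolding m base_fun_def prod.case
    by (cases "k = 0"; cases "l = 0"; cases "S = {}"; cases "S = {0}"; cases "S = {1}"; cases "S = {0,1}";
        simp del: One_nat_def)
qed simp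

lemma vector_field_sym_field: "vector_field (sym_field a g)"
  unfolding vector_field_def
proof
  fix i
  obtain A B C t where g: "g = ((A, B, C), t)" by (metis prod.exhaust)
  show "superfunction (sym_field a g i)"
    unfolding g by (cases i; simp only: sym_field.simps; intro superfunction_base_fun holomorphic2_intros)
qed

lemma cone_jacobian_sym_field: "cone_jacobian a (sym_field a g)"
proof -
  obtain A B C t where g: "g = ((A, B, C), t)" by (metis prod.exhaust)
  show ?thesis
    unfolding cone_jacobian_def Let_def
  proof (intro allI impI)
    fix x B' assume "B' \<subseteq> {0,1::nat}"
    then show "lift_matrix (sym_field a g) Ev1 Ev2 x (0, 0, B') = 0 \<and>
       lift_matrix (sym_field a g) Ev2 Ev1 x (0, 0, B') = 0 \<and>
       lift_matrix (sym_field a g) Od2 Ev2 x (0, 0, B') = (1 + a) * lift_matrix (sym_field a g) Ev1 Od1 x (0, 0, B') \<and>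
       lift_matrix (sym_field a g) Od1 Ev2 x (0, 0, B') = - (1 + a) * lift_matrix (sym_field a g) Ev1 Od2 x (0, 0, B') \<and>
       lift_matrix (sym_field a g) Od2 Ev1 x (0, 0, B') = - lift_matrix (sym_field a g) Ev2 Od1 x (0, 0, B') \<and>
       lift_matrix (sym_field a g) Od1 Ev1 x (0, 0, B') = lift_matrix (sym_field a g) Ev2 Od2 x (0, 0, B') \<and>
       lift_matrix (sym_field a g) Ev1 Ev1 x (0, 0, B') + lift_matrix (sym_field a g) Ev2 Ev2 x (0, 0, B') =
       lift_matrix (sym_field a g) Od1 Od1 x (0, 0, B') + lift_matrix (sym_field a g) Od2 Od2 x (0, 0, B')"
      unfolding g lift_matrix_def prod.case d_base_sym_field
      by (cases rule: base_subset_cases) (simp_all, simp_all add: algebra_simps)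
  qed
qed

lemma sym_field_inj:
  assumes "trace A = 0" "trace B = 0" "trace C = 0" "trace A' = 0" "trace B' = 0" "trace C' = 0"
    and eq: "sym_field a ((A, B, C), t) = sym_field a ((A', B', C'), u)"
  shows "((A, B, C), t) = ((A', B', C'), u)"
proof -
  have e: "sym_field a ((A, B, C), t) i x m = sym_field a ((A', B', C'), u) i x m" for i x m
    by (simp only: eq)
  note t22 = assms(1-6)[THEN trace_zero_mat2]
  have B: "B $ 2 $ 1 = B' $ 2 $ 1"
    using e[of Ev1 "(0,0)" "(0,0,{})"] by simp
  have A: "A $ 2 $ 1 = A' $ 2 $ 1" "A $ 1 $ 2 = A' $ 1 $ 2"
    using e[of Ev2 "(0,0)" "(0,0,{})"] e[of Ev1 "(0,0)" "(0,0,{0,1})"] by simp_all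
  have t: "t $ 1 $ 2 $ 1 = u $ 1 $ 2 $ 1" "t $ 1 $ 2 $ 2 = u $ 1 $ 2 $ 2"
    using e[of Ev1 "(0,0)" "(0,0,{0})"] e[of Ev1 "(0,0)" "(0,0,{1})"] by simp_all
  have t1: "t $ 1 $ 1 $ 1 = u $ 1 $ 1 $ 1" "t $ 1 $ 1 $ 2 = u $ 1 $ 1 $ 2"
    using e[of Ev1 "(1,0)" "(0,0,{0})"] e[of Ev1 "(1,0)" "(0,0,{1})"] t by simp_all
  have t2: "t $ 2 $ 2 $ 1 = u $ 2 $ 2 $ 1" "t $ 2 $ 2 $ 2 = u $ 2 $ 2 $ 2"
    using e[of Od2 "(0,0)" "(0,0,{})"] e[of Od1 "(0,0)" "(0,0,{})"] by simp_all
  have t3: "t $ 2 $ 1 $ 1 = u $ 2 $ 1 $ 1" "t $ 2 $ 1 $ 2 = u $ 2 $ 1 $ 2"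
    using e[of Od2 "(1,0)" "(0,0,{})"] e[of Od1 "(1,0)" "(0,0,{})"] t2 by simp_all
  have C: "C $ 1 $ 2 = C' $ 1 $ 2" "C $ 2 $ 1 = C' $ 2 $ 1"
    using e[of Od2 "(0,0)" "(0,0,{0})"] e[of Od1 "(0,0)" "(0,0,{1})"] by simp_all
  \<comment> \<open>The points \<open>x1 = 1\<close> and \<open>x1 = -1\<close> separate the linear
    from the quadratic coefficient.\<close>
  have q: "2 * B $ 1 $ 1 + B $ 1 $ 2 = 2 * B' $ 1 $ 1 + B' $ 1 $ 2"
    "- 2 * B $ 1 $ 1 + B $ 1 $ 2 = - 2 * B' $ 1 $ 1 + B' $ 1 $ 2"
    using e[of Ev1 "(1,0)" "(0,0,{})"] e[of Ev1 "(-1,0)" "(0,0,{})"] B by simp_all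
  have "4 * (B $ 1 $ 1) = 4 * (B' $ 1 $ 1)" using q by algebra
  then have B1: "B $ 1 $ 1 = B' $ 1 $ 1" by simp
  with q(1) have B2: "B $ 1 $ 2 = B' $ 1 $ 2" by simp
  have A1: "A $ 1 $ 1 = A' $ 1 $ 1"
    using e[of Ev2 "(0,1)" "(0,0,{})"] A by simp
  have "A $ 1 $ 1 + B $ 1 $ 1 + C $ 1 $ 1 = A' $ 1 $ 1 + B' $ 1 $ 1 + C' $ 1 $ 1"
    using e[of Od1 "(0,0)" "(0,0,{0})"] by simp
  with A1 B1 have C1: "C $ 1 $ 1 = C' $ 1 $ 1" by simp
  show ?thesis
    by (simp add: mat2_eq_iff tensor_eq_iff t22 A A1 B B1 B2 C C1 t t1 t2 t3)
qed

text \<open>The carrier of the target is the image of f, so every axiom about brackets is pulled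
  back to L. Only the vector space axioms concern the whole ambient type and are assumed separately.
  The isomorphism itself is the inverse of f on the carrier.\<close>

lemma lie_superalgebra_transport:
  assumes L: "lie_superalgebra L" and vs: "vector_space (sscale L')"
    and inj: "inj_on f (scarrier L)"
    and add: "\<And>x y. f (x + y) = f x + f y" and scale: "\<And>c x. f (sscale L c x) = sscale L' c (f x)"
    and ev: "ev_part L' = f ` ev_part L" and od: "od_part L' = f ` od_part L"
    and br: "\<And>x y. x \<in> scarrier L \<Longrightarrow> y \<in> scarrier L \<Longrightarrow> sbracket L' (f x) (f y) = f (sbracket L x y)"
  shows "lie_superalgebra_isomorphic L' L"
proof -
  note L' = L[unfolded lie_superalgebra_def]
  interpret L: vector_space "sscale L" using L' by blast
  interpret L': vector_space "sscale L'" by (rule vs)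
  have sub: "L.subspace (ev_part L)" "L.subspace (od_part L)" using L' by blast+
  have int: "ev_part L \<inter> od_part L = {0}" using L' by blast
  have f0: "f 0 = 0" using add[of 0 0] by simp
  have neg: "f (- x) = - f x" for x using add[of x "- x"] f0 by (simp add: eq_neg_iff_add_eq_0 add.commute)
  have car: "x \<in> scarrier L" if "x \<in> ev_part L \<or> x \<in> od_part L" for x
  proof -
    have "x = x + 0" "x = 0 + x" by simp_all
    then show ?thesis using that L.subspace_0[OF sub(1)] L.subspace_0[OF sub(2)]
      unfolding scarrier_def by blast
  qed
  have part_car: "x \<in> part L p \<Longrightarrow> x \<in> scarrier L" for x p
    using car by (auto simp: part_def split: if_splits)
  have car_add: "x + y \<in> scarrier L" if xy: "x \<in> scarrier L" "y \<in> scarrier L" for x y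
  proof -
    obtain u v u' v' where "x = u + v" "y = u' + v'" "u \<in> ev_part L" "v \<in> od_part L" "u' \<in> ev_part L" "v' \<in> od_part L"
      using xy unfolding scarrier_def by blast
    moreover from this have "x + y = (u + u') + (v + v')" by (simp add: algebra_simps)
    ultimately show ?thesis
      using L.subspace_add[OF sub(1)] L.subspace_add[OF sub(2)] unfolding scarrier_def by blast
  qed
  have car_scale: "sscale L c x \<in> scarrier L" if x: "x \<in> scarrier L" for c x
  proof -
    obtain u v where "x = u + v" "u \<in> ev_part L" "v \<in> od_part L" using x unfolding scarrier_def by blast
    moreover from this have "sscale L c x = sscale L c u + sscale L c v" by (simp add: L.scale_right_distrib)
    ultimately show ?thesis
      using L.subspace_scale[OF sub(1)] L.subspace_scale[OF sub(2)] unfolding scarrier_def by blast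
  qed
  have part': "part L' p = f ` part L p" for p by (simp add: part_def ev od)
  have car': "scarrier L' = f ` scarrier L"
  proof (intro equalityI subsetI)
    fix x assume "x \<in> scarrier L'"
    then obtain u v where "x = f u + f v" "u \<in> ev_part L" "v \<in> od_part L"
      unfolding scarrier_def ev od by blast
    then have "x = f (u + v)" "u + v \<in> scarrier L" unfolding scarrier_def by (auto simp: add)
    then show "x \<in> f ` scarrier L" by blast
  next
    fix x assume "x \<in> f ` scarrier L"
    then obtain u v where "x = f (u + v)" "u \<in> ev_part L" "v \<in> od_part L"
      unfolding scarrier_def by blast
    then show "x \<in> scarrier L'" unfolding scarrier_def ev od by (auto simp: add)
  qed
  have image_subspace: "L'.subspace (f ` U)" if U: "L.subspace U" for U
  proof (rule L'.subspaceI)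
    show "0 \<in> f ` U" using L.subspace_0[OF U] f0 by force
    show "x + y \<in> f ` U" if "x \<in> f ` U" "y \<in> f ` U" for x y
      using that L.subspace_add[OF U] add by (metis (no_types, lifting) image_iff)
    show "sscale L' c x \<in> f ` U" if "x \<in> f ` U" for c x
      using that L.subspace_scale[OF U] scale by (metis (no_types, lifting) image_iff)
  qed
  have bilinear: "sbracket L (x + y) z = sbracket L x z + sbracket L y z"
      "sbracket L z (x + y) = sbracket L z x + sbracket L z y"
      "sbracket L (sscale L c x) y = sscale L c (sbracket L x y)"
      "sbracket L x (sscale L c y) = sscale L c (sbracket L x y)"
    if "x \<in> scarrier L" "y \<in> scarrier L" "z \<in> scarrier L" for x y z c
    using L' that by blast+
  have closed: "sbracket L x y \<in> part L (p + q)" "sbracket L x y = - sscale L ((-1) ^ (p * q)) (sbracket L y x)"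
    if "x \<in> part L p" "y \<in> part L q" for x y p q
    using L' that by blast+
  have jacobi: "sbracket L x (sbracket L y z) =
      sbracket L (sbracket L x y) z + sscale L ((-1) ^ (p * q)) (sbracket L y (sbracket L x z))"
    if "x \<in> part L p" "y \<in> part L q" "z \<in> part L r" for x y z p q r
    using L' that by blast
  have "lie_superalgebra L'"
    unfolding lie_superalgebra_def
  proof (intro conjI)
    show "vector_space (sscale L')" by (rule vs)
    show "L'.subspace (ev_part L')" "L'.subspace (od_part L')"
      unfolding ev od by (intro image_subspace sub)+
    show "ev_part L' \<inter> od_part L' = {0}"
    proof (intro equalityI subsetI)
      fix x assume "x \<in> ev_part L' \<inter> od_part L'"
      then obtain u v where uv: "x = f u" "x = f v" "u \<in> ev_part L" "v \<in> od_part L" unfolding ev od by blast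
      then have "u = v" using inj_onD[OF inj, of u v] car by auto
      then have "u = 0" using uv int by blast
      then show "x \<in> {0}" using uv f0 by simp
    next
      fix x :: 'b assume "x \<in> {0}"
      then show "x \<in> ev_part L' \<inter> od_part L'"
        using L'.subspace_0[OF image_subspace[OF sub(1)]] L'.subspace_0[OF image_subspace[OF sub(2)]]
        unfolding ev od by simp
    qed
    show "\<forall>x\<in>scarrier L'. \<forall>y\<in>scarrier L'. \<forall>z\<in>scarrier L'. \<forall>c.
        sbracket L' (x + y) z = sbracket L' x z + sbracket L' y z \<and>
        sbracket L' z (x + y) = sbracket L' z x + sbracket L' z y \<and>
        sbracket L' (sscale L' c x) y = sscale L' c (sbracket L' x y) \<and>
        sbracket L' x (sscale L' c y) = sscale L' c (sbracket L' x y)"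
      unfolding car'
      by (auto simp: add[symmetric] scale[symmetric] br car_add car_scale bilinear)
    show "\<forall>p q. \<forall>x\<in>part L' p. \<forall>y\<in>part L' q.
        sbracket L' x y \<in> part L' (p + q) \<and>
        sbracket L' x y = - sscale L' ((-1) ^ (p * q)) (sbracket L' y x)"
      unfolding part'
    proof (intro allI ballI)
      fix p q x y assume "x \<in> f ` part L p" "y \<in> f ` part L q"
      then obtain u v where uv: "x = f u" "y = f v" "u \<in> part L p" "v \<in> part L q" by blast
      have e: "sbracket L' x y = f (sbracket L u v)" "sbracket L' y x = f (sbracket L v u)"
        unfolding uv(1,2) using uv(3,4) by (simp_all add: br part_car)
      have "f (sbracket L u v) = f (- sscale L ((-1) ^ (p * q)) (sbracket L v u))"
        by (rule arg_cong[OF closed(2)[OF uv(3,4)]])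
      then show "sbracket L' x y \<in> f ` part L (p + q) \<and> sbracket L' x y = - sscale L' ((-1) ^ (p * q)) (sbracket L' y x)"
        unfolding e neg scale using closed(1)[OF uv(3,4)] by blast
    qed
    show "\<forall>p q r. \<forall>x\<in>part L' p. \<forall>y\<in>part L' q. \<forall>z\<in>part L' r.
        sbracket L' x (sbracket L' y z) =
          sbracket L' (sbracket L' x y) z + sscale L' ((-1) ^ (p * q)) (sbracket L' y (sbracket L' x z))"
      unfolding part'
    proof (intro allI ballI)
      fix p q r x y z assume "x \<in> f ` part L p" "y \<in> f ` part L q" "z \<in> f ` part L r"
      then obtain u v w where uvw: "x = f u" "y = f v" "z = f w" "u \<in> part L p" "v \<in> part L q" "w \<in> part L r" by blast
      note c = part_car[OF uvw(4)] part_car[OF uvw(5)] part_car[OF uvw(6)]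
        part_car[OF closed(1)[OF uvw(5,6)]] part_car[OF closed(1)[OF uvw(4,5)]] part_car[OF closed(1)[OF uvw(4,6)]]
      show "sbracket L' x (sbracket L' y z) =
          sbracket L' (sbracket L' x y) z + sscale L' ((-1) ^ (p * q)) (sbracket L' y (sbracket L' x z))"
        unfolding uvw(1-3) br[OF c(2,3)] br[OF c(1,2)] br[OF c(1,3)] br[OF c(1,4)] br[OF c(5,3)] br[OF c(2,6)]
          scale[symmetric] add[symmetric]
        by (rule arg_cong[OF jacobi[OF uvw(4-6)]])
    qed
  qed
  moreover have "superalgebra_iso (inv_into (scarrier L) f) L' L"
  proof -
    have g: "inv_into (scarrier L) f (f x) = x" if "x \<in> scarrier L" for x
      using that by (rule inv_into_f_f[OF inj])
    have im: "inv_into (scarrier L) f ` f ` U = U" if "U \<subseteq> scarrier L" for U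
      using that by (force simp: image_image g)
    \<comment> \<open>Closure under the bracket is part of the grading axiom and is known for
      homogeneous elements only, hence the expansion into four brackets.\<close>
    have bc: "sbracket L x y \<in> scarrier L" if xy: "x \<in> scarrier L" "y \<in> scarrier L" for x y
    proof -
      obtain u v u' v' where e: "x = u + v" "y = u' + v'" "u \<in> part L 0" "v \<in> part L 1" "u' \<in> part L 0" "v' \<in> part L 1"
        using xy unfolding scarrier_def part_def by auto
      note c = part_car[OF e(3)] part_car[OF e(4)] part_car[OF e(5)] part_car[OF e(6)]
      have "sbracket L x y = (sbracket L u u' + sbracket L u v') + (sbracket L v u' + sbracket L v v')"
        using c by (simp add: e(1,2) bilinear car_add)
      then show ?thesis
        using closed(1)[OF e(3) e(5)] closed(1)[OF e(3) e(6)] closed(1)[OF e(4) e(5)] closed(1)[OF e(4) e(6)]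
        by (metis car_add part_car)
    qed
    show ?thesis
      unfolding superalgebra_iso_def
    proof (intro conjI)
      show "bij_betw (inv_into (scarrier L) f) (scarrier L') (scarrier L)"
        unfolding car' by (rule bij_betw_inv_into) (simp add: bij_betw_def inj)
      show "inv_into (scarrier L) f ` ev_part L' = ev_part L" "inv_into (scarrier L) f ` od_part L' = od_part L"
        unfolding ev od using car by (intro im; blast)+
    qed (unfold car', auto simp: add[symmetric] scale[symmetric] br g car_add car_scale bc)
  qed
  ultimately show ?thesis unfolding lie_superalgebra_isomorphic_def using L by blast
qed

lemma vector_space_vf_scale: "vector_space vf_scale"
  by unfold_locales (auto simp: vf_scale_def cmul_def fun_eq_iff algebra_simps)


lemma infinitesimal_symmetry_iff:
  assumes a: "a \<noteq> 0" "a \<noteq> - 1"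
  shows "infinitesimal_symmetry a X \<longleftrightarrow>
    (\<exists>A B C t. trace A = 0 \<and> trace B = 0 \<and> trace C = 0 \<and> X = sym_field a ((A, B, C), t))"
proof
  assume S: "infinitesimal_symmetry a X"
  show "\<exists>A B C t. trace A = 0 \<and> trace B = 0 \<and> trace C = 0 \<and> X = sym_field a ((A, B, C), t)"
    by (rule symmetry_field_exists[OF a symmetry_imp_jacobian[OF a S]]) blast
next
  assume "\<exists>A B C t. trace A = 0 \<and> trace B = 0 \<and> trace C = 0 \<and> X = sym_field a ((A, B, C), t)"
  then show "infinitesimal_symmetry a X"
    using jacobian_imp_symmetry[OF a(1) vector_field_sym_field cone_jacobian_sym_field] by blast
qed

lemma D21_parts:
  "ev_part (D21 a) = {((A, B, C), 0) | A B C. trace A = 0 \<and> trace B = 0 \<and> trace C = 0}"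
  "od_part (D21 a) = {(0, t) | t. True}"
  "scarrier (D21 a) = {((A, B, C), t) | A B C t. trace A = 0 \<and> trace B = 0 \<and> trace C = 0}"
  "sscale (D21 a) = gamma_scale" "sbracket (D21 a) = gamma_bracket (- 1 - a) 1 a"
proof -
  show ev: "ev_part (D21 a) = {((A, B, C), 0) | A B C. trace A = 0 \<and> trace B = 0 \<and> trace C = 0}"
    and od: "od_part (D21 a) = {(0, t) | t. True}"
    and "sscale (D21 a) = gamma_scale" "sbracket (D21 a) = gamma_bracket (- 1 - a) 1 a"
    by (simp_all add: D21_def Gamma_superalgebra_def)
  have "x \<in> scarrier (D21 a) \<longleftrightarrow> x \<in> {((A, B, C), t) | A B C t. trace A = 0 \<and> trace B = 0 \<and> trace C = 0}" for x
    unfolding scarrier_def ev od by (cases x) (auto simp: zero_prod_def)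
  then show "scarrier (D21 a) = {((A, B, C), t) | A B C t. trace A = 0 \<and> trace B = 0 \<and> trace C = 0}"
    by blast
qed

theorem theorem4p12:
  fixes a :: complex
  assumes "a \<noteq> 0" and "a \<noteq> - 1"
  shows "lie_superalgebra_isomorphic (symmetry_superalgebra a) (D21 a)"
proof (rule lie_superalgebra_transport[where f = "sym_field a"])
  note iff = infinitesimal_symmetry_iff[OF assms]
  show "lie_superalgebra (D21 a)"
    unfolding D21_def by (rule lie_superalgebra_Gamma) simp
  show "vector_space (sscale (symmetry_superalgebra a))"
    by (simp add: symmetry_superalgebra_def vector_space_vf_scale)
  show "inj_on (sym_field a) (scarrier (D21 a))"
  proof (rule inj_onI)
    fix g h assume gh: "g \<in> scarrier (D21 a)" "h \<in> scarrier (D21 a)" "sym_field a g = sym_field a h"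
    then show "g = h" unfolding D21_parts using sym_field_inj by blast
  qed
  show "sym_field a (x + y) = sym_field a x + sym_field a y" for x y
    by (rule ext) (simp only: sym_field_linear plus_fun_apply)
  show "sym_field a (sscale (D21 a) c x) = sscale (symmetry_superalgebra a) c (sym_field a x)" for c x
    unfolding D21_parts by (rule ext) (simp add: symmetry_superalgebra_def vf_scale_def sym_field_linear)
  show "ev_part (symmetry_superalgebra a) = sym_field a ` ev_part (D21 a)"
  proof (intro equalityI subsetI)
    fix X assume "X \<in> ev_part (symmetry_superalgebra a)"
    then obtain A B C t where tr: "trace A = 0" "trace B = 0" "trace C = 0"
      and X: "X = sym_field a ((A, B, C), t)" "vf_part 0 X = X"
      unfolding symmetry_superalgebra_def iff by auto
    \<comment> \<open>An even field equals its even part, and passing to the even part discards the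
      tensor.\<close>
    then have "X = sym_field a ((A, B, C), 0)" using vf_part_sym_field(1)[of a "(A, B, C)" t] by simp
    then show "X \<in> sym_field a ` ev_part (D21 a)" unfolding D21_parts using tr by blast
  next
    fix X assume "X \<in> sym_field a ` ev_part (D21 a)"
    then obtain A B C where tr: "trace A = 0" "trace B = 0" "trace C = 0" and X: "X = sym_field a ((A, B, C), 0)"
      unfolding D21_parts by blast
    have "vf_part 0 X = X" unfolding X by (rule vf_part_sym_field(1))
    moreover have "infinitesimal_symmetry a X" unfolding iff using tr X by blast
    ultimately show "X \<in> ev_part (symmetry_superalgebra a)" by (simp add: symmetry_superalgebra_def)
  qed
  show "od_part (symmetry_superalgebra a) = sym_field a ` od_part (D21 a)"
  proof (intro equalityI subsetI)
    fix X assume "X \<in> od_part (symmetry_superalgebra a)"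
    then obtain A B C t where X: "X = sym_field a ((A, B, C), t)" "vf_part 1 X = X"
      unfolding symmetry_superalgebra_def iff by auto
    then have "X = sym_field a (0, t)" using vf_part_sym_field(2)[of a "(A, B, C)" t] by simp
    then show "X \<in> sym_field a ` od_part (D21 a)" unfolding D21_parts by blast
  next
    fix X assume "X \<in> sym_field a ` od_part (D21 a)"
    then obtain t where X: "X = sym_field a (0, t)" unfolding D21_parts by blast
    have "vf_part 1 X = X" unfolding X by (rule vf_part_sym_field(2))
    moreover have "trace (0 :: mat2) = 0" by (simp add: trace_mat2)
    then have "infinitesimal_symmetry a X" unfolding iff using X unfolding zero_prod_def by blast
    ultimately show "X \<in> od_part (symmetry_superalgebra a)" by (simp add: symmetry_superalgebra_def)
  qed
  show "sbracket (symmetry_superalgebra a) (sym_field a x) (sym_field a y) = sym_field a (sbracket (D21 a) x y)"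
    if xy: "x \<in> scarrier (D21 a)" "y \<in> scarrier (D21 a)" for x y
  proof -
    obtain A B C t A' B' C' u where "x = ((A, B, C), t)" "y = ((A', B', C'), u)"
      and "trace A = 0" "trace B = 0" "trace C = 0" "trace A' = 0" "trace B' = 0" "trace C' = 0"
      using xy unfolding D21_parts by blast
    then show ?thesis
      unfolding D21_parts by (simp only: sym_field_bracket symmetry_superalgebra_def superalgebra.simps)
  qed
qed

end
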